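(* Let $M$ be an $F$-structure manifold of degree $K$. The distributions $D_l$ and $D_m$ are both integrable if and only if $$N_F(X,Y)=l\,N_F(lX,lY)+N_F(lX,mY)+N_F(mX,lY)$$ for all vector fields $X,Y$ on $M$.
   Context: An $F$-structure manifold of degree $K$ is a smooth $n$-dimensional manifold $M$ with a nonzero smooth $(1,1)$-tensor field $F$ of constant rank $r$ satisfying $\alpha F^{K+1}+\beta F^{K}+F=0$, where $K\ge 3$ is an integer and $\alpha,\beta$ are real or complex numbers (polynomials in $F$ with complex coefficients are regarded as endomorphisms of the complexified tangent bundle). Put $l=-(\alpha F^{K}+\beta F^{K-1})$ and $m=I+\alpha F^{K}+\beta F^{K-1}$; $D_l=\mathrm{Im}\,l$ and $D_m=\mathrm{Im}\,m$ are complementary distributions of dimensions $r$ and $n-r$. For a $(1,1)$-tensor field $T$, the Nijenhuis tensor is $N_T(X,Y)=[TX,TY]-T[TX,Y]-T[X,TY]+T^2[X,Y]$. A distribution $D$ is integrable if through each point of $M$ there is an integral manifold of $D$ (equivalently, by Frobenius, $D$ is involutive). *)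

theory Defs
  imports "HOL-Analysis.Analysis"
begin

section \<open>Smooth maps between Euclidean spaces\<close>

text \<open>Only meant for open \<open>S\<close>, where the Frechet derivative at each point is unique.\<close>

primrec Ck_on :: "nat \<Rightarrow> 'a::euclidean_space set \<Rightarrow> ('a \<Rightarrow> 'b::real_normed_vector) \<Rightarrow> bool" where
  "Ck_on 0 S f \<longleftrightarrow> continuous_on S f"
| "Ck_on (Suc k) S f \<longleftrightarrow>
     (\<forall>x\<in>S. f differentiable (at x)) \<and>
     (\<forall>v. Ck_on k S (\<lambda>x. frechet_derivative f (at x) v))"

definition smooth_on :: "'a::euclidean_space set \<Rightarrow> ('a \<Rightarrow> 'b::real_normed_vector) \<Rightarrow> bool" where
  "smooth_on S f \<longleftrightarrow> (\<forall>k. Ck_on k S f)"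


section \<open>Smooth manifolds\<close>

text \<open>A chart \<open>(U, \<phi>)\<close> consists of a domain and a coordinate map; the values of \<open>\<phi>\<close> outside
  \<open>U\<close> are irrelevant.\<close>

type_synonym ('m, 'n) chart = "'m set \<times> ('m \<Rightarrow> real ^ 'n)"

definition is_chart :: "'m topology \<Rightarrow> ('m, 'n::finite) chart \<Rightarrow> bool" where
  "is_chart M c \<longleftrightarrow>
     openin M (fst c) \<and> open (snd c ` fst c) \<and>
     homeomorphic_map (subtopology M (fst c)) (top_of_set (snd c ` fst c)) (snd c)"

text \<open>Coordinate expression of a function on \<open>M\<close>, as a function on \<open>\<phi>(U)\<close>.\<close>

definition in_coords :: "('m, 'n::finite) chart \<Rightarrow> ('m \<Rightarrow> 'b) \<Rightarrow> real ^ 'n \<Rightarrow> 'b" where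
  "in_coords c f = f \<circ> inv_into (fst c) (snd c)"

definition compatible :: "('m, 'n::finite) chart \<Rightarrow> ('m, 'n) chart \<Rightarrow> bool" where
  "compatible c c' \<longleftrightarrow>
     smooth_on (snd c ` (fst c \<inter> fst c')) (in_coords c (snd c')) \<and>
     smooth_on (snd c' ` (fst c \<inter> fst c')) (in_coords c' (snd c))"

text \<open>\<open>A\<close> is a maximal smooth atlas of dimension \<open>n = CARD('n)\<close> on \<open>M\<close>.\<close>

locale smooth_manifold =
  fixes M :: "'m topology" and A :: "('m, 'n::finite) chart set"
  assumes Hausdorff: "Hausdorff_space M"
    and second_countable: "second_countable M"
    and charts: "c \<in> A \<Longrightarrow> is_chart M c"
    and covers: "(\<Union>c\<in>A. fst c) = topspace M"
    and compat: "c \<in> A \<Longrightarrow> c' \<in> A \<Longrightarrow> compatible c c'"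
    and maximal: "is_chart M c \<Longrightarrow> (\<And>c'. c' \<in> A \<Longrightarrow> compatible c c') \<Longrightarrow> c \<in> A"

definition transition_jacobian ::
    "('m, 'n::finite) chart \<Rightarrow> ('m, 'n) chart \<Rightarrow> 'm \<Rightarrow> real ^ 'n ^ 'n" where
  "transition_jacobian c c' p = jacobian (in_coords c (snd c')) (at (snd c p))"


section \<open>Vector fields and (1,1)-tensor fields\<close>

text \<open>Fields are given by their components: \<open>X c p\<close> are the components of \<open>X\<close> at \<open>p\<close> with respect
  to the chart \<open>c\<close>, meaningful for \<open>c \<in> A\<close> and \<open>p \<in> fst c\<close> only. Complex components describe
  sections of the complexified tangent bundle and of its endomorphism bundle.\<close>

type_synonym ('m, 'n) vfield = "('m, 'n) chart \<Rightarrow> 'm \<Rightarrow> real ^ 'n"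
type_synonym ('m, 'n) cvfield = "('m, 'n) chart \<Rightarrow> 'm \<Rightarrow> complex ^ 'n"
type_synonym ('m, 'n) tfield = "('m, 'n) chart \<Rightarrow> 'm \<Rightarrow> real ^ 'n ^ 'n"
type_synonym ('m, 'n) ctfield = "('m, 'n) chart \<Rightarrow> 'm \<Rightarrow> complex ^ 'n ^ 'n"

definition smooth_vector_field :: "('m, 'n::finite) chart set \<Rightarrow> ('m, 'n) vfield \<Rightarrow> bool" where
  "smooth_vector_field A X \<longleftrightarrow>
     (\<forall>c\<in>A. smooth_on (snd c ` fst c) (in_coords c (X c))) \<and>
     (\<forall>c\<in>A. \<forall>c'\<in>A. \<forall>p \<in> fst c \<inter> fst c'.
        X c' p = transition_jacobian c c' p *v X c p)"

definition smooth_tensor_field :: "('m, 'n::finite) chart set \<Rightarrow> ('m, 'n) tfield \<Rightarrow> bool" where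
  "smooth_tensor_field A F \<longleftrightarrow>
     (\<forall>c\<in>A. smooth_on (snd c ` fst c) (in_coords c (F c))) \<and>
     (\<forall>c\<in>A. \<forall>c'\<in>A. \<forall>p \<in> fst c \<inter> fst c'.
        F c' p ** transition_jacobian c c' p = transition_jacobian c c' p ** F c p)"

definition cvec :: "real ^ 'n \<Rightarrow> complex ^ 'n" where
  "cvec v = (\<chi> i. complex_of_real (v $ i))"

definition complexify_field :: "('m, 'n::finite) vfield \<Rightarrow> ('m, 'n) cvfield" where
  "complexify_field X c p = cvec (X c p)"

definition complexify_tensor :: "('m, 'n::finite) tfield \<Rightarrow> ('m, 'n) ctfield" where
  "complexify_tensor F c p = map_matrix complex_of_real (F c p)"

definition apply_tensor ::
    "('m, 'n::finite) ctfield \<Rightarrow> ('m, 'n) cvfield \<Rightarrow> ('m, 'n) cvfield" where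
  "apply_tensor T X c p = T c p *v X c p"

text \<open>The complex-bilinear Lie bracket
  \<open>[X, Y]\<^sup>i = \<Sum>\<^sub>j (X\<^sup>j \<partial>\<^sub>j Y\<^sup>i - Y\<^sup>j \<partial>\<^sub>j X\<^sup>i)\<close>;
  \<open>directional X Y\<close> has the components \<open>\<Sum>\<^sub>j X\<^sup>j \<partial>\<^sub>j Y\<^sup>i\<close>.\<close>

definition directional ::
    "('m, 'n::finite) cvfield \<Rightarrow> ('m, 'n) cvfield \<Rightarrow> ('m, 'n) cvfield" where
  "directional X Y c p =
     (\<Sum>j\<in>UNIV. (X c p $ j) *s
        frechet_derivative (in_coords c (Y c)) (at (snd c p)) (axis j 1))"

definition lie_bracket ::
    "('m, 'n::finite) cvfield \<Rightarrow> ('m, 'n) cvfield \<Rightarrow> ('m, 'n) cvfield" where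
  "lie_bracket X Y c p = directional X Y c p - directional Y X c p"

definition nijenhuis ::
    "('m, 'n::finite) ctfield \<Rightarrow> ('m, 'n) cvfield \<Rightarrow> ('m, 'n) cvfield \<Rightarrow> ('m, 'n) cvfield" where
  "nijenhuis T X Y c p =
     lie_bracket (apply_tensor T X) (apply_tensor T Y) c p
     - apply_tensor T (lie_bracket (apply_tensor T X) Y) c p
     - apply_tensor T (lie_bracket X (apply_tensor T Y)) c p
     + apply_tensor T (apply_tensor T (lie_bracket X Y)) c p"


section \<open>Distributions and integrability\<close>

text \<open>A distribution assigns to a chart \<open>c\<close> and a point \<open>p\<close> a complex subspace of the complexified
  tangent space at \<open>p\<close>, expressed in the coordinates of \<open>c\<close>.\<close>

type_synonym ('m, 'n) distribution = "('m, 'n) chart \<Rightarrow> 'm \<Rightarrow> (complex ^ 'n) set"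

definition image_distribution :: "('m, 'n::finite) ctfield \<Rightarrow> ('m, 'n) distribution" where
  "image_distribution T c p = range (\<lambda>v. T c p *v v)"

definition embedded_submanifold ::
    "'m topology \<Rightarrow> ('m, 'n::finite) chart set \<Rightarrow> nat \<Rightarrow> 'm set \<Rightarrow> bool" where
  "embedded_submanifold M A k N \<longleftrightarrow>
     N \<subseteq> topspace M \<and>
     (\<forall>q\<in>N. \<exists>c\<in>A. q \<in> fst c \<and>
        (\<exists>S a. subspace S \<and> dim S = k \<and>
           snd c ` (fst c \<inter> N) = snd c ` fst c \<inter> (+) a ` S))"

text \<open>Tangent space of \<open>N\<close> at \<open>q\<close>, in the coordinates of \<open>c\<close>: velocities of smooth curves in \<open>N\<close>
  through \<open>q\<close>.\<close>

definition submanifold_tangent ::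
    "'m set \<Rightarrow> ('m, 'n::finite) chart \<Rightarrow> 'm \<Rightarrow> (real ^ 'n) set" where
  "submanifold_tangent N c q =
     {v. \<exists>\<gamma> e. 0 < e \<and> \<gamma> (0::real) = q \<and>
          (\<forall>t. \<bar>t\<bar> < e \<longrightarrow> \<gamma> t \<in> N \<inter> fst c) \<and>
          smooth_on {-e<..<e} (snd c \<circ> \<gamma>) \<and>
          ((snd c \<circ> \<gamma>) has_vector_derivative v) (at 0)}"

definition complex_hull :: "(real ^ 'n) set \<Rightarrow> (complex ^ 'n) set" where
  "complex_hull V = {cvec x + \<i> *s cvec y | x y. x \<in> V \<and> y \<in> V}"

text \<open>\<open>T\<^sub>qN \<otimes> \<complex> = D\<^sub>q\<close> at every point of \<open>N\<close>. Every immersed integral manifold contains an embedded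
  one around each of its points, so restricting to embedded ones does not affect integrability.\<close>

definition integral_manifold ::
    "'m topology \<Rightarrow> ('m, 'n::finite) chart set \<Rightarrow> ('m, 'n) distribution \<Rightarrow> 'm set \<Rightarrow> bool" where
  "integral_manifold M A D N \<longleftrightarrow>
     (\<exists>k. embedded_submanifold M A k N) \<and>
     (\<forall>c\<in>A. \<forall>q \<in> N \<inter> fst c. complex_hull (submanifold_tangent N c q) = D c q)"

definition integrable_distribution ::
    "'m topology \<Rightarrow> ('m, 'n::finite) chart set \<Rightarrow> ('m, 'n) distribution \<Rightarrow> bool" where
  "integrable_distribution M A D \<longleftrightarrow>
     (\<forall>p\<in>topspace M. \<exists>N. p \<in> N \<and> integral_manifold M A D N)"


section \<open>F-structure manifolds of degree K\<close>

text \<open>The power \<open>^\<close> on matrices would be componentwise.\<close>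

primrec matpow :: "'a::semiring_1 ^ 'n ^ 'n \<Rightarrow> nat \<Rightarrow> 'a ^ 'n ^ 'n" where
  "matpow B 0 = mat 1"
| "matpow B (Suc k) = B ** matpow B k"

definition matrix_scale :: "'a::times \<Rightarrow> 'a ^ 'n ^ 'n \<Rightarrow> 'a ^ 'n ^ 'n" (infixr "*\<^sub>M" 75) where
  "a *\<^sub>M B = map_matrix ((*) a) B"

definition tensor_pow :: "('m, 'n::finite) tfield \<Rightarrow> nat \<Rightarrow> ('m, 'n) ctfield" where
  "tensor_pow F k c p = matpow (complexify_tensor F c p) k"

locale F_structure_manifold = smooth_manifold M A
  for M :: "'m topology" and A :: "('m, 'n::finite) chart set" +
  fixes F :: "('m, 'n) tfield" and K r :: nat and \<alpha> \<beta> :: complex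
  assumes F_smooth: "smooth_tensor_field A F"
    and F_nonzero: "\<exists>c\<in>A. \<exists>p\<in>fst c. F c p \<noteq> 0"
    and F_rank: "c \<in> A \<Longrightarrow> p \<in> fst c \<Longrightarrow> rank (F c p) = r"
    and K_ge_3: "3 \<le> K"
    and F_eq: "c \<in> A \<Longrightarrow> p \<in> fst c \<Longrightarrow>
      \<alpha> *\<^sub>M tensor_pow F (K + 1) c p + \<beta> *\<^sub>M tensor_pow F K c p + complexify_tensor F c p = 0"

definition l_tensor ::
    "('m, 'n::finite) tfield \<Rightarrow> nat \<Rightarrow> complex \<Rightarrow> complex \<Rightarrow> ('m, 'n) ctfield" where
  "l_tensor F K \<alpha> \<beta> c p = - (\<alpha> *\<^sub>M tensor_pow F K c p + \<beta> *\<^sub>M tensor_pow F (K - 1) c p)"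

definition m_tensor ::
    "('m, 'n::finite) tfield \<Rightarrow> nat \<Rightarrow> complex \<Rightarrow> complex \<Rightarrow> ('m, 'n) ctfield" where
  "m_tensor F K \<alpha> \<beta> c p = mat 1 + \<alpha> *\<^sub>M tensor_pow F K c p + \<beta> *\<^sub>M tensor_pow F (K - 1) c p"

end

theory Submission
  imports Defs
begin

text \<open>From \<open>F = l F = F l\<close> it follows that \<open>l\<close> is the projection onto \<open>Im F\<close> along \<open>Ker F\<close>. Hence
  \<open>l\<close> and \<open>m\<close> are complexifications of real smooth fields of projections. By tensoriality the
  identity is a pointwise one; it reduces to \<open>m N(l X, l Y) + N(m X, m Y) = 0\<close>, whose two summands
  \<open>m [F X, F Y]\<close> and \<open>F\<^sup>2 [m X, m Y]\<close> lie in complementary subspaces, so it says that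
  \<open>D\<^sub>l\<close> and \<open>D\<^sub>m\<close> are involutive.

  For the Frobenius theorem, an involutive distribution is locally spanned by commuting fields
  \<open>A(\<cdot>) v\<close>, namely the lifts of constant fields from the tangent space of an integral manifold at
  the base point. The total differential equation \<open>D\<phi>(s) v = A(\<phi> s) v\<close> is then solvable and \<open>\<phi>\<close>
  parametrizes an integral manifold as a graph.\<close>

section \<open>Calculus of smooth maps\<close>

text \<open>Involutivity is carried by the derivative of the projection alone: for a projection
  field \<open>Q\<close> it says that \<open>Q'(a) b\<close> is symmetric for \<open>a\<close>,
  \<open>b\<close> in the range of \<open>Q\<close>. Likewise N_F(X,Y) at a point is an expression
  in \<open>F\<close>, its derivative and the values of the two fields, so the core equivalence is
  matrix algebra in a single tangent space, fed by the derivatives of F L = F, L F = F and L L = L.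
  Reality of l is the hinge: \<alpha> and \<beta> may be complex, while an integral manifold has
  only real tangent spaces. The commuting fields come from \<open>Q\<close> by a rational formula,
  \<open>graph_lift\<close>, and so inherit its smoothness. The slice chart demanded by the
  definition of an integral manifold is obtained from the graph by a shear with explicit inverse,
  and belongs to the atlas by maximality. The identity speaks of globally defined fields only; to
  return from it to single tangent vectors, every vector is extended by a bump function, and the
  Hausdorff property makes the extension by zero smooth.\<close>

lemma Ck_on_subset: "Ck_on k S f \<Longrightarrow> T \<subseteq> S \<Longrightarrow> Ck_on k T f"
  by (induction k arbitrary: f) (auto intro: continuous_on_subset)

text \<open>Openness of \<open>S\<close> is what transfers equality on \<open>S\<close> to the
  derivatives: \<open>frechet_derivative _ (at x)\<close> looks at a full neighbourhood of
  \<open>x\<close>.\<close>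

lemma Ck_on_cong:
  assumes "open S" "Ck_on k S f" "\<And>x. x \<in> S \<Longrightarrow> f x = g x"
  shows "Ck_on k S g"
  using assms(2,3)
proof (induction k arbitrary: f g)
  case 0
  then show ?case by (auto cong: continuous_on_cong)
next
  case (Suc k)
  have D: "(g has_derivative frechet_derivative f (at x)) (at x)" if "x \<in> S" for x
  proof (rule has_derivative_transform_within_open[OF _ \<open>open S\<close> that])
    show "(f has_derivative frechet_derivative f (at x)) (at x)"
      using Suc.prems that by (simp add: frechet_derivative_works)
  qed (use Suc.prems in auto)
  have eq: "frechet_derivative f (at x) = frechet_derivative g (at x)" if "x \<in> S" for x
    using frechet_derivative_at[OF D[OF that]] .
  have "Ck_on k S (\<lambda>x. frechet_derivative g (at x) v)" for v
    by (rule Suc.IH[where f = "\<lambda>x. frechet_derivative f (at x) v"]) (use Suc.prems eq in auto)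
  then show ?case
    using D by (auto simp: differentiable_def)
qed

text \<open>Accepts a derivative \<open>f'\<close> in closed form, so that the closure properties
  below state their product or chain rule explicitly instead of computing with
  \<open>frechet_derivative\<close> of a compound map.\<close>

lemma Ck_on_SucI:
  assumes "open S" "\<And>x. x \<in> S \<Longrightarrow> (f has_derivative f' x) (at x)"
    "\<And>v. Ck_on k S (\<lambda>x. f' x v)"
  shows "Ck_on (Suc k) S f"
proof -
  have "f' x = frechet_derivative f (at x)" if "x \<in> S" for x
    using frechet_derivative_at[OF assms(2)[OF that]] .
  then show ?thesis
    using assms by (auto simp: differentiable_def intro!: Ck_on_cong[OF assms(1) assms(3)])
qed

lemma Ck_on_imp_has_derivative:
  "Ck_on (Suc k) S f \<Longrightarrow> x \<in> S \<Longrightarrow> (f has_derivative frechet_derivative f (at x)) (at x)"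
  by (simp add: frechet_derivative_works)

text \<open>The recursion at \<open>Suc k\<close> speaks of differentiability and of the derivatives
  only. The descent to \<open>k\<close> is what feeds the inductions for products and compositions,
  where undifferentiated factors occur at the lower order.\<close>

lemma Ck_on_Suc_imp: "Ck_on (Suc k) S f \<Longrightarrow> Ck_on k S f"
proof (induction k arbitrary: f)
  case 0
  then show ?case
    by (auto intro!: continuous_at_imp_continuous_on differentiable_imp_continuous_within)
qed auto

lemma Ck_on_imp_continuous: "Ck_on k S f \<Longrightarrow> continuous_on S f"
proof (induction k)
  case (Suc k)
  then show ?case using Ck_on_Suc_imp by blast
qed simp

lemma Ck_on_const [simp]: "Ck_on k S (\<lambda>x. c)"
  by (induction k arbitrary: c) auto

lemma Ck_on_bounded_linear:
  assumes "open S" "bounded_linear f" shows "Ck_on k S f"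
proof (cases k)
  case 0
  with assms show ?thesis by (simp add: linear_continuous_on)
next
  case (Suc j)
  show ?thesis unfolding Suc
    by (rule Ck_on_SucI[where f' = "\<lambda>x. f"])
      (use assms in \<open>auto intro: bounded_linear_imp_has_derivative\<close>)
qed

lemma Ck_on_ident: "open S \<Longrightarrow> Ck_on k S (\<lambda>x. x)"
  by (rule Ck_on_bounded_linear) (auto intro: bounded_linear_ident)

lemma Ck_on_add:
  assumes "open S" "Ck_on k S f" "Ck_on k S g"
  shows "Ck_on k S (\<lambda>x. f x + g x)"
  using assms(2,3)
proof (induction k arbitrary: f g)
  case (Suc k)
  show ?case
  proof (rule Ck_on_SucI[OF assms(1)])
    show "((\<lambda>x. f x + g x) has_derivative
      (\<lambda>v. frechet_derivative f (at x) v + frechet_derivative g (at x) v)) (at x)" if "x \<in> S" for x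
      using Suc.prems that by (auto intro!: has_derivative_add Ck_on_imp_has_derivative)
  qed (use Suc in auto)
qed (auto intro: continuous_intros)

lemma Ck_on_bilinear:
  assumes "open S" and bl: "bounded_bilinear b" and "Ck_on k S f" "Ck_on k S g"
  shows "Ck_on k S (\<lambda>x. b (f x) (g x))"
  using assms(3,4)
proof (induction k arbitrary: f g)
  case 0
  then show ?case by (auto intro: bounded_bilinear.continuous_on[OF bl])
next
  case (Suc k)
  show ?case
  proof (rule Ck_on_SucI[OF assms(1)])
    show "((\<lambda>x. b (f x) (g x)) has_derivative
      (\<lambda>v. b (f x) (frechet_derivative g (at x) v) + b (frechet_derivative f (at x) v) (g x))) (at x)"
      if "x \<in> S" for x
      using Suc.prems that
      by (intro bounded_bilinear.FDERIV[OF bl] Ck_on_imp_has_derivative) auto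
    show "Ck_on k S (\<lambda>x. b (f x) (frechet_derivative g (at x) v) + b (frechet_derivative f (at x) v) (g x))" for v
      using Suc.prems Suc.prems[THEN Ck_on_Suc_imp] by (intro Ck_on_add assms Suc.IH) auto
  qed
qed

lemma Ck_on_bounded_linear_compose:
  assumes "open S" and bl: "bounded_linear h" and "Ck_on k S f"
  shows "Ck_on k S (\<lambda>x. h (f x))"
  using assms(3)
proof (induction k arbitrary: f)
  case 0
  then show ?case by (auto intro: bounded_linear.continuous_on[OF bl])
next
  case (Suc k)
  show ?case
  proof (rule Ck_on_SucI[OF assms(1)])
    show "((\<lambda>x. h (f x)) has_derivative (\<lambda>v. h (frechet_derivative f (at x) v))) (at x)"
      if "x \<in> S" for x
      using Suc.prems that
      by (intro bounded_linear.has_derivative[OF bl] Ck_on_imp_has_derivative) auto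
  qed (use Suc in auto)
qed

lemma Ck_on_sum:
  assumes "open S" "\<And>i. i \<in> I \<Longrightarrow> Ck_on k S (f i)"
  shows "Ck_on k S (\<lambda>x. \<Sum>i\<in>I. f i x)"
  using assms(2) by (induction I rule: infinite_finite_induct) (auto intro!: Ck_on_add assms(1))

lemma Ck_on_scaleR:
  "open S \<Longrightarrow> Ck_on k S f \<Longrightarrow> Ck_on k S g \<Longrightarrow> Ck_on k S (\<lambda>x. f x *\<^sub>R g x)"
  by (rule Ck_on_bilinear[OF _ bounded_bilinear_scaleR])

lemma Ck_on_mult:
  fixes f g :: "'a::euclidean_space \<Rightarrow> 'b::real_normed_algebra"
  shows "open S \<Longrightarrow> Ck_on k S f \<Longrightarrow> Ck_on k S g \<Longrightarrow> Ck_on k S (\<lambda>x. f x * g x)"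
  by (rule Ck_on_bilinear[OF _ bounded_bilinear_mult])

lemma Ck_on_prod:
  fixes f :: "'i \<Rightarrow> 'a::euclidean_space \<Rightarrow> 'b::{real_normed_algebra, comm_ring_1}"
  assumes "open S" "\<And>i. i \<in> I \<Longrightarrow> Ck_on k S (f i)"
  shows "Ck_on k S (\<lambda>x. \<Prod>i\<in>I. f i x)"
  using assms(2) by (induction I rule: infinite_finite_induct) (auto intro!: Ck_on_mult assms(1))

lemma Ck_on_uminus: "open S \<Longrightarrow> Ck_on k S f \<Longrightarrow> Ck_on k S (\<lambda>x. - f x)"
  by (rule Ck_on_bounded_linear_compose[OF _ bounded_linear_minus[OF bounded_linear_ident]])

lemma Ck_on_diff:
  "open S \<Longrightarrow> Ck_on k S f \<Longrightarrow> Ck_on k S g \<Longrightarrow> Ck_on k S (\<lambda>x. f x - g x)"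
  using Ck_on_add[OF _ _ Ck_on_uminus, of S k f g] by simp

text \<open>In the derivative \<open>?Dg (f x) (?Df x v)\<close> the direction varies with
  \<open>x\<close>, whereas the induction hypothesis covers \<open>?Dg _ b\<close> for a fixed
  direction \<open>b\<close> only. Expanding \<open>?Df x v\<close> in the basis separates the two
  dependences.\<close>

lemma Ck_on_compose:
  fixes f :: "'a::euclidean_space \<Rightarrow> 'b::euclidean_space" and g :: "'b \<Rightarrow> 'c::real_normed_vector"
  assumes "open S" "Ck_on k S f" "open T" "Ck_on k T g" "f ` S \<subseteq> T"
  shows "Ck_on k S (\<lambda>x. g (f x))"
  using assms(2,4)
proof (induction k arbitrary: g)
  case 0
  then show ?case using assms(5) by (auto intro: continuous_on_compose2)
next
  case (Suc k)
  let ?Df = "\<lambda>x. frechet_derivative f (at x)" and ?Dg = "\<lambda>x. frechet_derivative g (at x)"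
  have f: "Ck_on k S f" using Suc.prems(1) by (rule Ck_on_Suc_imp)
  show ?case
  proof (rule Ck_on_SucI[OF assms(1)])
    show "((\<lambda>x. g (f x)) has_derivative (\<lambda>v. \<Sum>b\<in>Basis. (?Df x v \<bullet> b) *\<^sub>R ?Dg (f x) b)) (at x)"
      if "x \<in> S" for x
    proof -
      have g: "(g has_derivative ?Dg (f x)) (at (f x))"
        using Suc.prems that assms(5) by (intro Ck_on_imp_has_derivative) auto
      have 1: "((\<lambda>x. g (f x)) has_derivative (\<lambda>v. ?Dg (f x) (?Df x v))) (at x)"
        using Suc.prems that by (intro has_derivative_compose[where g = g and f = f, OF _ g] Ck_on_imp_has_derivative) auto
      have 2: "?Dg (f x) w = (\<Sum>b\<in>Basis. (w \<bullet> b) *\<^sub>R ?Dg (f x) b)" for w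
      proof -
        interpret linear "?Dg (f x)" using g by (rule has_derivative_linear)
        show ?thesis
          by (subst euclidean_representation[of w, symmetric]) (simp add: sum scale)
      qed
      show ?thesis using has_derivative_eq_rhs[OF 1 ext[OF 2]] .
    qed
    show "Ck_on k S (\<lambda>x. \<Sum>b\<in>Basis. (?Df x v \<bullet> b) *\<^sub>R ?Dg (f x) b)" for v
    proof (intro Ck_on_sum Ck_on_scaleR assms(1))
      show "Ck_on k S (\<lambda>x. ?Df x v \<bullet> b)" for b
        using Suc.prems by (intro Ck_on_bounded_linear_compose[OF assms(1) bounded_linear_inner_left]) auto
      show "Ck_on k S (\<lambda>x. ?Dg (f x) b)" for b
        using Suc.prems by (intro Suc.IH[OF f]) auto
    qed
  qed
qed

lemma Ck_on_inverse:
  fixes f :: "'a::euclidean_space \<Rightarrow> real"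
  assumes "open S" "Ck_on k S f" "\<And>x. x \<in> S \<Longrightarrow> f x \<noteq> 0"
  shows "Ck_on k S (\<lambda>x. inverse (f x))"
  using assms(2)
proof (induction k)
  case 0
  then show ?case using assms(3) by (auto intro: continuous_intros)
next
  case (Suc k)
  have f: "Ck_on k S f" using Suc.prems by (rule Ck_on_Suc_imp)
  show ?case
  proof (rule Ck_on_SucI[OF assms(1)])
    show "((\<lambda>x. inverse (f x)) has_derivative
      (\<lambda>v. - (inverse (f x) * frechet_derivative f (at x) v * inverse (f x)))) (at x)" if "x \<in> S" for x
      using Suc.prems that assms(3) by (intro Deriv.has_derivative_inverse Ck_on_imp_has_derivative) auto
    show "Ck_on k S (\<lambda>x. - (inverse (f x) * frechet_derivative f (at x) v * inverse (f x)))" for v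
      using Suc.prems by (intro Ck_on_uminus Ck_on_mult assms(1) Suc.IH[OF f]) auto
  qed
qed

lemma Ck_on_vec_nth: "open S \<Longrightarrow> Ck_on k S f \<Longrightarrow> Ck_on k S (\<lambda>x. f x $ i)"
  by (rule Ck_on_bounded_linear_compose[OF _ bounded_linear_vec_nth])

lemma Ck_on_vecI:
  fixes f :: "'a::euclidean_space \<Rightarrow> 'b::real_normed_vector ^ 'n::finite"
  assumes "open S" "\<And>i. Ck_on k S (\<lambda>x. f x $ i)"
  shows "Ck_on k S f"
proof -
  have 1: "f x = (\<Sum>i\<in>UNIV. axis i (f x $ i))" for x
    by (simp add: vec_eq_iff axis_def if_distrib if_distribR cong: if_cong)
  have "bounded_linear (axis i :: 'b \<Rightarrow> 'b ^ 'n)" for i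
  proof (rule bounded_linear_intro[where K = 1])
    show "norm (axis i x :: 'b ^ 'n) \<le> norm x * 1" for x
    proof -
      have "(norm (axis i x $ j :: 'b))\<^sup>2 = (if j = i then (norm x)\<^sup>2 else 0)" for j
        by (simp add: axis_def)
      then show ?thesis by (simp add: norm_vec_def L2_set_def)
    qed
  qed (auto simp: axis_def vec_eq_iff)
  then have 2: "Ck_on k S (\<lambda>x. \<Sum>i\<in>UNIV. axis i (f x $ i))"
    by (intro Ck_on_sum assms(1) Ck_on_bounded_linear_compose[OF assms(1) _ assms(2)])
  show ?thesis by (rule Ck_on_cong[OF assms(1) 2]) (simp only: 1[symmetric])
qed

lemma Ck_on_Un:
  assumes "open S" "open T" "Ck_on k S f" "Ck_on k T f"
  shows "Ck_on k (S \<union> T) f"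
  using assms(3,4)
  by (induction k arbitrary: f) (auto intro: continuous_on_open_Un assms(1,2))

section \<open>Smooth maps with matrix values\<close>

lemma bounded_bilinear_matrix_vector_mult:
  "bounded_bilinear ((*v) :: real^'n^'m \<Rightarrow> real^'n \<Rightarrow> real^'m)"
  unfolding bilinear_conv_bounded_bilinear[symmetric] bilinear_def
  by (auto intro!: linearI simp: matrix_vector_mult_add_rdistrib matrix_vector_right_distrib
      scaleR_matrix_vector_assoc matrix_scaleR_vector_ac)

lemma bounded_bilinear_matrix_matrix_mult:
  "bounded_bilinear ((**) :: real^'n^'m \<Rightarrow> real^'k^'n \<Rightarrow> real^'k^'m)"
  unfolding bilinear_conv_bounded_bilinear[symmetric] bilinear_def
  by (auto intro!: linearI simp: matrix_matrix_mult_def vec_eq_iff sum.distrib[symmetric]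
      distrib_left distrib_right sum_distrib_left mult_ac)

lemma Ck_on_matrix_vector_mult:
  fixes f :: "'a::euclidean_space \<Rightarrow> real^'n^'m"
  shows "open S \<Longrightarrow> Ck_on k S f \<Longrightarrow> Ck_on k S g \<Longrightarrow> Ck_on k S (\<lambda>x. f x *v g x)"
  by (rule Ck_on_bilinear[OF _ bounded_bilinear_matrix_vector_mult])

lemma Ck_on_matrix_matrix_mult:
  fixes f :: "'a::euclidean_space \<Rightarrow> real^'n^'m"
  shows "open S \<Longrightarrow> Ck_on k S f \<Longrightarrow> Ck_on k S g \<Longrightarrow> Ck_on k S (\<lambda>x. f x ** g x)"
  by (rule Ck_on_bilinear[OF _ bounded_bilinear_matrix_matrix_mult])

lemma Ck_on_det:
  fixes f :: "'a::euclidean_space \<Rightarrow> real^'n^'n"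
  assumes "open S" "Ck_on k S f"
  shows "Ck_on k S (\<lambda>x. det (f x))"
  unfolding det_def
  by (intro Ck_on_sum Ck_on_mult Ck_on_prod Ck_on_vec_nth Ck_on_const assms)

lemma Ck_on_matrix_inv:
  fixes f :: "'a::euclidean_space \<Rightarrow> real^'n^'n"
  assumes "open S" "Ck_on k S f" "\<And>x. x \<in> S \<Longrightarrow> det (f x) \<noteq> 0"
  shows "Ck_on k S (\<lambda>x. matrix_inv (f x))"
proof -
  \<comment> \<open>Cramer's rule: \<open>G M i j\<close> is \<open>M\<close> with column
    \<open>i\<close> replaced by the \<open>j\<close>-th unit vector, so its determinant divided by
    that of \<open>M\<close> is the entry \<open>(i, j)\<close> of the inverse. Smoothness of the
    inverse thereby reduces to determinants and one scalar reciprocal.\<close>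
  define G where "G = (\<lambda>(M::real^'n^'n) i j. (\<chi> a b. if b = i then (axis j 1 :: real^'n) $ a else M $ a $ b))"
  have G: "Ck_on k S (\<lambda>x. G (f x) i j)" for i j
  proof (intro Ck_on_vecI assms(1))
    show "Ck_on k S (\<lambda>x. G (f x) i j $ a $ b)" for a b
      by (cases "b = i") (auto simp: G_def intro!: Ck_on_vec_nth assms)
  qed
  have inv: "matrix_inv (f x) = (\<chi> i j. det (G (f x) i j) * inverse (det (f x)))" if "x \<in> S" for x
  proof -
    have "f x ** matrix_inv (f x) = mat 1"
      using assms(3)[OF that] someI_ex[of "\<lambda>B. f x ** B = mat 1 \<and> B ** f x = mat 1"]
      by (auto simp: invertible_det_nz[symmetric] invertible_def matrix_inv_def)
    then have "f x *v (matrix_inv (f x) *v axis j 1) = axis j 1" for j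
      by (simp add: matrix_vector_mul_assoc)
    then have "matrix_inv (f x) *v axis j 1 = (\<chi> i. det (G (f x) i j) / det (f x))" for j
      using cramer[OF assms(3)[OF that]] by (auto simp: G_def)
    then show ?thesis
      by (simp add: matrix_vector_mult_basis column_def vec_eq_iff field_simps)
  qed
  have "Ck_on k S (\<lambda>x. \<chi> i j. det (G (f x) i j) * inverse (det (f x)))"
    by (rule Ck_on_vecI[OF assms(1)], simp, rule Ck_on_vecI[OF assms(1)], simp)
      (intro Ck_on_mult Ck_on_det G Ck_on_inverse assms)
  then show ?thesis
    by (rule Ck_on_cong[OF assms(1)]) (simp add: inv)
qed

section \<open>Uniform estimates on compact convex sets\<close>

lemma Ck_on_locally_Lipschitz:
  fixes f :: "'a::euclidean_space \<Rightarrow> 'b::real_normed_vector"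
  assumes "Ck_on (Suc 0) S f" "compact C" "convex C" "C \<subseteq> S"
  obtains B where "B \<ge> 0" "\<And>x. x \<in> C \<Longrightarrow> norm (f x) \<le> B"
    "\<And>x v. x \<in> C \<Longrightarrow> norm (frechet_derivative f (at x) v) \<le> B * norm v"
    "\<And>x y. x \<in> C \<Longrightarrow> y \<in> C \<Longrightarrow> norm (f y - f x) \<le> B * norm (y - x)"
proof -
  let ?D = "\<lambda>x. frechet_derivative f (at x)"
  have bounded: "\<exists>B\<ge>0. \<forall>x\<in>C. norm (g x) \<le> B" if "continuous_on S g" for g :: "'a \<Rightarrow> 'b"
  proof -
    have "bounded (g ` C)"
      by (intro compact_imp_bounded compact_continuous_image continuous_on_subset[OF that] assms)
    then obtain B where "B > 0" "\<forall>y\<in>g ` C. norm y \<le> B" by (auto simp: bounded_pos)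
    then show ?thesis by (intro exI[of _ B]) auto
  qed
  obtain B0 where B0: "B0 \<ge> 0" "\<And>x. x \<in> C \<Longrightarrow> norm (f x) \<le> B0"
    using bounded[OF Ck_on_imp_continuous[OF assms(1)]] by auto
  have "\<forall>b. \<exists>B\<ge>0. \<forall>x\<in>C. norm (?D x b) \<le> B"
    using assms(1) by (auto intro!: bounded)
  then obtain B1 where B1: "\<And>b. B1 b \<ge> 0" "\<And>b x. x \<in> C \<Longrightarrow> norm (?D x b) \<le> B1 b"
    by metis
  \<comment> \<open>One constant serves all three estimates: \<open>B0\<close> bounds the values,
    and the sum over the basis bounds the derivative in every direction, since each coordinate of
    \<open>v\<close> is at most \<open>norm v\<close>. The Lipschitz bound is then the mean value
    inequality on the convex set \<open>C\<close>.\<close>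
  define B where "B = B0 + (\<Sum>b\<in>Basis. B1 b)"
  have D: "(f has_derivative ?D x) (at x)" if "x \<in> C" for x
    using assms(4) that by (intro Ck_on_imp_has_derivative[OF assms(1)]) auto
  have le: "norm (?D x v) \<le> B * norm v" if "x \<in> C" for x v
  proof -
    interpret linear "?D x" using D[OF that] by (rule has_derivative_linear)
    have "?D x v = (\<Sum>b\<in>Basis. (v \<bullet> b) *\<^sub>R ?D x b)"
      by (subst euclidean_representation[of v, symmetric]) (simp add: sum scale)
    also have "norm \<dots> \<le> (\<Sum>b\<in>Basis. norm v * B1 b)"
      by (intro sum_norm_le) (auto intro!: mult_mono B1 that Basis_le_norm)
    also have "\<dots> \<le> B * norm v"
      using B0 by (simp add: B_def sum_distrib_left algebra_simps)
    finally show ?thesis .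
  qed
  show thesis
  proof (rule that)
    show "B \<ge> 0" using B0 B1 by (auto simp: B_def intro!: add_nonneg_nonneg sum_nonneg)
    show "norm (f x) \<le> B" if "x \<in> C" for x
      using B0(2)[OF that] B1 by (simp add: B_def add_increasing2 sum_nonneg)
    show "norm (f y - f x) \<le> B * norm (y - x)" if "x \<in> C" "y \<in> C" for x y
      by (rule differentiable_bound[OF assms(3), where f' = "?D"])
        (auto intro!: has_derivative_at_withinI D onorm_le le that)
  qed (rule le)
qed

text \<open>Provides the constants that the Picard argument consumes as its hypotheses
  \<open>b0\<close> to \<open>b3\<close>. The quadratic remainder is the mean value inequality for
  \<open>f z - ?D x z\<close> on the segment from \<open>x\<close> to \<open>y\<close>: its
  derivative \<open>?D z - ?D x\<close> is at most a constant times \<open>norm (y - x)\<close>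
  there.\<close>

lemma Ck_on_second_order_bounds:
  fixes f :: "'a::euclidean_space \<Rightarrow> 'b::real_normed_vector"
  assumes "Ck_on 2 S f" "compact C" "convex C" "C \<subseteq> S"
  obtains B where "B \<ge> 0" "\<And>x. x \<in> C \<Longrightarrow> norm (f x) \<le> B"
    "\<And>x v. x \<in> C \<Longrightarrow> norm (frechet_derivative f (at x) v) \<le> B * norm v"
    "\<And>x y. x \<in> C \<Longrightarrow> y \<in> C \<Longrightarrow> norm (f y - f x) \<le> B * norm (y - x)"
    "\<And>x y. x \<in> C \<Longrightarrow> y \<in> C \<Longrightarrow>
       norm (f y - f x - frechet_derivative f (at x) (y - x)) \<le> B * (norm (y - x))\<^sup>2"
proof -
  let ?D = "\<lambda>x. frechet_derivative f (at x)"
  have C2: "Ck_on (Suc (Suc 0)) S f" using assms(1) by (simp add: numeral_2_eq_2)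
  have D: "(f has_derivative ?D x) (at x)" if "x \<in> C" for x
    using assms(4) that by (intro Ck_on_imp_has_derivative[OF C2]) auto
  obtain B where B: "B \<ge> 0" "\<And>x. x \<in> C \<Longrightarrow> norm (f x) \<le> B"
    "\<And>x v. x \<in> C \<Longrightarrow> norm (?D x v) \<le> B * norm v"
    "\<And>x y. x \<in> C \<Longrightarrow> y \<in> C \<Longrightarrow> norm (f y - f x) \<le> B * norm (y - x)"
    using Ck_on_locally_Lipschitz[OF Ck_on_Suc_imp[OF C2] assms(2-4)] by blast
  have "\<exists>B\<ge>0. \<forall>x\<in>C. \<forall>y\<in>C. norm (?D y b - ?D x b) \<le> B * norm (y - x)" for b
    by (rule Ck_on_locally_Lipschitz[of S "\<lambda>x. ?D x b", OF _ assms(2-4)]) (use C2 in auto)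
  then obtain L where L: "\<And>b. L b \<ge> 0"
    "\<And>b x y. x \<in> C \<Longrightarrow> y \<in> C \<Longrightarrow> norm (?D y b - ?D x b) \<le> L b * norm (y - x)"
    by metis
  define B' where "B' = B + (\<Sum>b\<in>Basis. L b)"
  have L': "norm (?D y v - ?D x v) \<le> B' * norm (y - x) * norm v" if "x \<in> C" "y \<in> C" for x y v
  proof -
    interpret x: linear "?D x" using D[OF that(1)] by (rule has_derivative_linear)
    interpret y: linear "?D y" using D[OF that(2)] by (rule has_derivative_linear)
    have "?D y v - ?D x v = (\<Sum>b\<in>Basis. (v \<bullet> b) *\<^sub>R (?D y b - ?D x b))"
      by (subst (1 2) euclidean_representation[of v, symmetric])
        (simp add: x.sum y.sum x.scale y.scale scaleR_diff_right sum_subtractf)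
    also have "norm \<dots> \<le> (\<Sum>b\<in>Basis. norm v * (L b * norm (y - x)))"
      by (intro sum_norm_le) (auto intro!: mult_mono L that Basis_le_norm)
    also have "\<dots> \<le> B' * norm (y - x) * norm v"
      using B(1) by (simp add: B'_def sum_distrib_left sum_distrib_right algebra_simps)
    finally show ?thesis .
  qed
  have "B \<le> B'" using L by (simp add: B'_def sum_nonneg)
  show thesis
  proof (rule that)
    show B': "B' \<ge> 0" using \<open>B \<le> B'\<close> B by linarith
    show "norm (f x) \<le> B'" if "x \<in> C" for x using B(2)[OF that] \<open>B \<le> B'\<close> by linarith
    show "norm (?D x v) \<le> B' * norm v" if "x \<in> C" for x v
      using B(3)[OF that] mult_right_mono[OF \<open>B \<le> B'\<close>, of "norm v"] by (meson norm_ge_zero order_trans)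
    show "norm (f y - f x) \<le> B' * norm (y - x)" if "x \<in> C" "y \<in> C" for x y
      using B(4)[OF that] mult_right_mono[OF \<open>B \<le> B'\<close>, of "norm (y - x)"]
      by (meson norm_ge_zero order_trans)
    show "norm (f y - f x - ?D x (y - x)) \<le> B' * (norm (y - x))\<^sup>2" if xy: "x \<in> C" "y \<in> C" for x y
    proof -
      have seg: "closed_segment x y \<subseteq> C" using that assms(3) by (simp add: closed_segment_subset)
      interpret x: linear "?D x" using D[OF that(1)] by (rule has_derivative_linear)
      define g where "g = (\<lambda>z. f z - ?D x z)"
      have g: "(g has_derivative (\<lambda>v. ?D z v - ?D x v)) (at z within closed_segment x y)"
        if "z \<in> closed_segment x y" for z
        unfolding g_def
      proof (rule has_derivative_at_withinI, rule has_derivative_diff)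
        show "(f has_derivative ?D z) (at z)" using seg that by (intro D) auto
        show "(?D x has_derivative ?D x) (at z)" by (rule linear_imp_has_derivative[OF x.linear_axioms])
      qed
      have on: "onorm (\<lambda>v. ?D z v - ?D x v) \<le> B' * norm (y - x)" if z: "z \<in> closed_segment x y" for z
      proof (rule onorm_le)
        fix v :: 'a
        have "norm (z - x) \<le> norm (y - x)"
          using dist_in_closed_segment[OF z] by (simp add: dist_norm norm_minus_commute)
        then have "B' * norm (z - x) * norm v \<le> B' * norm (y - x) * norm v"
          using B' by (intro mult_right_mono mult_left_mono) auto
        then show "norm (?D z v - ?D x v) \<le> B' * norm (y - x) * norm v"
          using L'[OF xy(1), of z v] seg z by (meson order_trans subsetD)
      qed
      have "norm (g y - g x) \<le> (B' * norm (y - x)) * norm (y - x)"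
        by (rule differentiable_bound[OF convex_closed_segment g on]) auto
      then show ?thesis by (simp add: g_def x.diff algebra_simps power2_eq_square)
    qed
  qed
qed

section \<open>Symmetry of second derivatives\<close>

text \<open>Two mean value theorems in succession, for the increment along \<open>v\<close> as a
  function of the step along \<open>u\<close> and then for the derivative along \<open>u\<close> as
  a function of the step along \<open>v\<close>. The bound on \<open>p\<close> makes the
  intermediate point converge to \<open>x\<close> as \<open>h\<close> shrinks.\<close>

lemma second_difference_mvt:
  fixes f :: "'a::euclidean_space \<Rightarrow> real"
  assumes f: "Ck_on (Suc (Suc 0)) S f" and S: "cball x d \<subseteq> S"
    and h: "0 < h" "h * (norm u + norm v) \<le> d"
  obtains p where "norm (p - x) \<le> h * (norm u + norm v)"
    "f (x + h *\<^sub>R u + h *\<^sub>R v) - f (x + h *\<^sub>R u) - (f (x + h *\<^sub>R v) - f x)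
      = h * (h * frechet_derivative (\<lambda>y. frechet_derivative f (at y) u) (at p) v)"
proof -
  let ?D = "\<lambda>w y. frechet_derivative f (at y) w"
  have inS: "x + a *\<^sub>R u + b *\<^sub>R v \<in> S" and le: "norm (a *\<^sub>R u + b *\<^sub>R v) \<le> h * (norm u + norm v)"
    if "0 \<le> a" "a \<le> h" "0 \<le> b" "b \<le> h" for a b
  proof -
    have "norm (a *\<^sub>R u + b *\<^sub>R v) \<le> a * norm u + b * norm v"
      using norm_triangle_ineq[of "a *\<^sub>R u" "b *\<^sub>R v"] that by simp
    also have "\<dots> \<le> h * (norm u + norm v)"
      using that by (auto simp: distrib_left intro!: add_mono mult_right_mono)
    finally show "norm (a *\<^sub>R u + b *\<^sub>R v) \<le> h * (norm u + norm v)" .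
    then show "x + a *\<^sub>R u + b *\<^sub>R v \<in> S"
      using h(2) norm_minus_cancel[of "a *\<^sub>R u + b *\<^sub>R v"]
      by (intro subsetD[OF S]) (simp add: dist_norm)
  qed
  define \<phi> where "\<phi> = (\<lambda>s. f (x + s *\<^sub>R u + h *\<^sub>R v) - f (x + s *\<^sub>R u))"
  have d\<phi>: "(\<phi> has_real_derivative ?D u (x + s *\<^sub>R u + h *\<^sub>R v) - ?D u (x + s *\<^sub>R u)) (at s)"
    if "0 \<le> s" "s \<le> h" for s
  proof -
    have 1: "((\<lambda>s. f (x + s *\<^sub>R u + b *\<^sub>R v)) has_derivative (\<lambda>t. ?D (t *\<^sub>R u) (x + s *\<^sub>R u + b *\<^sub>R v))) (at s)"
      if "0 \<le> b" "b \<le> h" for b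
      by (rule has_derivative_compose[where g = f, OF _ Ck_on_imp_has_derivative[OF f]])
        (auto intro!: derivative_eq_intros inS that \<open>0 \<le> s\<close> \<open>s \<le> h\<close>)
    have 2: "linear (\<lambda>w. ?D w (x + s *\<^sub>R u + b *\<^sub>R v))" if "0 \<le> b" "b \<le> h" for b
      by (rule has_derivative_linear[OF Ck_on_imp_has_derivative[OF f]])
        (intro inS that \<open>0 \<le> s\<close> \<open>s \<le> h\<close>)
    have "(\<phi> has_derivative (\<lambda>t. ?D (t *\<^sub>R u) (x + s *\<^sub>R u + h *\<^sub>R v) - ?D (t *\<^sub>R u) (x + s *\<^sub>R u))) (at s)"
      using has_derivative_diff[OF 1[of h] 1[of 0]] h(1) by (simp add: \<phi>_def)
    then show ?thesis
      using linear_scale[OF 2[of h]] linear_scale[OF 2[of 0]] h(1)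
      unfolding has_field_derivative_def
      by (elim has_derivative_eq_rhs) (auto simp: fun_eq_iff algebra_simps)
  qed
  obtain s where s: "0 < s" "s < h"
    "\<phi> h - \<phi> 0 = (h - 0) * (?D u (x + s *\<^sub>R u + h *\<^sub>R v) - ?D u (x + s *\<^sub>R u))"
    using MVT2[OF h(1) d\<phi>] by auto
  have d2: "((\<lambda>t. ?D u (x + s *\<^sub>R u + t *\<^sub>R v)) has_real_derivative
    frechet_derivative (?D u) (at (x + s *\<^sub>R u + t *\<^sub>R v)) v) (at t)" if "0 \<le> t" "t \<le> h" for t
  proof -
    let ?DD = "frechet_derivative (?D u) (at (x + s *\<^sub>R u + t *\<^sub>R v))"
    have f': "Ck_on (Suc 0) S (?D u)" using f by simp
    have D: "(?D u has_derivative ?DD) (at (x + s *\<^sub>R u + t *\<^sub>R v))"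
      using that s by (intro Ck_on_imp_has_derivative[OF f'] inS) auto
    have "((\<lambda>t. ?D u (x + s *\<^sub>R u + t *\<^sub>R v)) has_derivative (\<lambda>t. ?DD (t *\<^sub>R v))) (at t)"
      by (rule has_derivative_compose[where g = "?D u" and f = "\<lambda>t. x + s *\<^sub>R u + t *\<^sub>R v", OF _ D]) (auto intro!: derivative_eq_intros)
    then show ?thesis
      using linear_scale[OF has_derivative_linear[OF D]]
      by (simp add: has_field_derivative_def mult_commute_abs)
  qed
  obtain t where t: "0 < t" "t < h"
    "?D u (x + s *\<^sub>R u + h *\<^sub>R v) - ?D u (x + s *\<^sub>R u + 0 *\<^sub>R v)
      = (h - 0) * frechet_derivative (?D u) (at (x + s *\<^sub>R u + t *\<^sub>R v)) v"
    using MVT2[OF h(1) d2] by blast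
  show thesis
  proof (rule that)
    show "norm ((x + s *\<^sub>R u + t *\<^sub>R v) - x) \<le> h * (norm u + norm v)"
      using le[of s t] s t by (simp add: algebra_simps)
  qed (use s t in \<open>simp add: \<phi>_def\<close>)
qed

text \<open>The second difference is symmetric in \<open>u\<close> and \<open>v\<close>, so the two
  mixed derivatives agree at intermediate points \<open>p n\<close> and \<open>q n\<close> that both
  tend to \<open>x\<close>. Their continuity gives equality at \<open>x\<close>.\<close>

lemma Ck_on_symmetric_second_derivative_real:
  fixes f :: "'a::euclidean_space \<Rightarrow> real"
  assumes f: "Ck_on (Suc (Suc 0)) S f" and "open S" "x \<in> S"
  shows "frechet_derivative (\<lambda>y. frechet_derivative f (at y) u) (at x) v
    = frechet_derivative (\<lambda>y. frechet_derivative f (at y) v) (at x) u" (is "?G u v x = ?G v u x")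
proof -
  obtain d where d: "d > 0" "cball x d \<subseteq> S" using assms(2,3) by (auto simp: open_contains_cball)
  \<comment> \<open>The summand 1 keeps \<open>c\<close> positive even if \<open>u\<close> and
    \<open>v\<close> are both zero, so that \<open>h\<close> is well behaved.\<close>
  define c where "c = norm u + norm v + 1"
  have c: "c > 0" by (simp add: c_def add_nonneg_pos)
  define h where "h = (\<lambda>n. d / (c * real (Suc n)))"
  have h: "h n > 0" "h n * (norm u + norm v) \<le> d" for n
  proof -
    show "h n > 0" using d c by (simp add: h_def)
    have "h n * (norm u + norm v) \<le> h n * c"
      using \<open>h n > 0\<close> by (intro mult_left_mono) (auto simp: c_def)
    also have "\<dots> \<le> d" using c d by (simp add: h_def divide_simps)
    finally show "h n * (norm u + norm v) \<le> d" .
  qed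
  have "\<exists>p q. norm (p - x) \<le> h n * (norm u + norm v) \<and> norm (q - x) \<le> h n * (norm u + norm v) \<and>
      ?G u v p = ?G v u q" for n
  proof -
    obtain p where p: "norm (p - x) \<le> h n * (norm u + norm v)"
      "f (x + h n *\<^sub>R u + h n *\<^sub>R v) - f (x + h n *\<^sub>R u) - (f (x + h n *\<^sub>R v) - f x) = h n * (h n * ?G u v p)"
      using second_difference_mvt[OF f d(2) h] .
    obtain q where q: "norm (q - x) \<le> h n * (norm v + norm u)"
      "f (x + h n *\<^sub>R v + h n *\<^sub>R u) - f (x + h n *\<^sub>R v) - (f (x + h n *\<^sub>R u) - f x) = h n * (h n * ?G v u q)"
      using second_difference_mvt[OF f d(2) h(1), of n v u] h(2)[of n] by (auto simp: add.commute)
    have "h n * (h n * ?G u v p) = h n * (h n * ?G v u q)"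
      using p(2) q(2) by (simp add: algebra_simps)
    then show ?thesis using p(1) q(1) h(1)[of n] by (auto simp: add.commute)
  qed
  then obtain p q where pq: "\<And>n. norm (p n - x) \<le> h n * (norm u + norm v)"
    "\<And>n. norm (q n - x) \<le> h n * (norm u + norm v)" "\<And>n. ?G u v (p n) = ?G v u (q n)"
    by metis
  have "(\<lambda>n. d / c * inverse (real (Suc n)) * (norm u + norm v)) \<longlonglongrightarrow> 0"
    by (intro tendsto_mult_left_zero tendsto_mult_right_zero LIMSEQ_inverse_real_of_nat)
  then have "(\<lambda>n. h n * (norm u + norm v)) \<longlonglongrightarrow> 0"
    by (simp add: h_def divide_simps)
  from Lim_null_comparison[OF _ this, of "\<lambda>n. p n - x"] Lim_null_comparison[OF _ this, of "\<lambda>n. q n - x"]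
  have lim: "p \<longlonglongrightarrow> x" "q \<longlonglongrightarrow> x"
    by (simp_all add: LIM_zero_iff pq(1,2))
  have "isCont (?G w z) x" for w z
    using f assms(2,3) by (auto simp: continuous_on_eq_continuous_at)
  then have "(\<lambda>n. ?G u v (p n)) \<longlonglongrightarrow> ?G u v x" "(\<lambda>n. ?G v u (q n)) \<longlonglongrightarrow> ?G v u x"
    by (rule isCont_tendsto_compose[where g = "?G u v", OF _ lim(1)],
        rule isCont_tendsto_compose[where g = "?G v u", OF _ lim(2)])
  then show ?thesis unfolding pq(3) by (rule LIMSEQ_unique)
qed

lemma Ck_on_symmetric_second_derivative:
  fixes f :: "'a::euclidean_space \<Rightarrow> 'b::euclidean_space"
  assumes f: "Ck_on (Suc (Suc 0)) S f" and "open S" "x \<in> S"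
  shows "frechet_derivative (\<lambda>y. frechet_derivative f (at y) u) (at x) v
    = frechet_derivative (\<lambda>y. frechet_derivative f (at y) v) (at x) u"
proof (rule euclidean_eqI)
  fix b :: 'b
  define g where "g = (\<lambda>y. f y \<bullet> b)"
  have g: "Ck_on (Suc (Suc 0)) S g"
    unfolding g_def by (rule Ck_on_bounded_linear_compose[OF assms(2) bounded_linear_inner_left f])
  have 1: "frechet_derivative g (at y) = (\<lambda>w. frechet_derivative f (at y) w \<bullet> b)" if "y \<in> S" for y
    unfolding g_def
    by (rule frechet_derivative_at[symmetric])
      (intro has_derivative_inner_left Ck_on_imp_has_derivative[OF f] that)
  have 2: "frechet_derivative (\<lambda>y. frechet_derivative g (at y) w) (at x) z
    = frechet_derivative (\<lambda>y. frechet_derivative f (at y) w) (at x) z \<bullet> b" for w z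
  proof -
    have fw: "Ck_on (Suc 0) S (\<lambda>y. frechet_derivative f (at y) w)" using f by simp
    have "((\<lambda>y. frechet_derivative f (at y) w \<bullet> b) has_derivative
      (\<lambda>z. frechet_derivative (\<lambda>y. frechet_derivative f (at y) w) (at x) z \<bullet> b)) (at x)"
      by (intro has_derivative_inner_left Ck_on_imp_has_derivative[OF fw] assms(3))
    then have "((\<lambda>y. frechet_derivative g (at y) w) has_derivative
      (\<lambda>z. frechet_derivative (\<lambda>y. frechet_derivative f (at y) w) (at x) z \<bullet> b)) (at x)"
      by (rule has_derivative_transform_within_open[OF _ assms(2,3)]) (simp add: 1)
    from frechet_derivative_at[OF this, symmetric] show ?thesis by simp
  qed
  show "frechet_derivative (\<lambda>y. frechet_derivative f (at y) u) (at x) v \<bullet> b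
    = frechet_derivative (\<lambda>y. frechet_derivative f (at y) v) (at x) u \<bullet> b"
    using Ck_on_symmetric_second_derivative_real[OF g assms(2,3), of u v] by (simp only: 2)
qed

section \<open>A function that is flat at the origin\<close>

text \<open>\<open>flat_exp 0\<close> is the classical flat function exp(-1/t) extended by zero. The
  powers of 1/t make the family closed under differentiation up to linear combinations, so
  smoothness of all members is a single induction.\<close>

definition flat_exp :: "nat \<Rightarrow> real \<Rightarrow> real" where
  "flat_exp n t = (if t > 0 then inverse t ^ n * exp (- inverse t) else 0)"

lemma has_real_derivative_flat_exp:
  "(flat_exp n has_real_derivative flat_exp (n + 2) t - real n * flat_exp (n + 1) t) (at t)"
proof -
  consider "t > 0" | "t < 0" | "t = 0" by linarith
  then show ?thesis
  proof cases
    case 1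
    have "((\<lambda>t. inverse t ^ n * exp (- inverse t)) has_real_derivative
      real n * inverse t ^ (n - 1) * (- (inverse t * inverse t)) * exp (- inverse t)
        + inverse t ^ n * (exp (- inverse t) * (inverse t * inverse t))) (at t)"
      using 1 by (auto intro!: derivative_eq_intros simp: algebra_simps)
    also have "real n * inverse t ^ (n - 1) * (- (inverse t * inverse t)) * exp (- inverse t)
        + inverse t ^ n * (exp (- inverse t) * (inverse t * inverse t))
      = flat_exp (n + 2) t - real n * flat_exp (n + 1) t"
      using 1 by (cases n) (simp_all add: flat_exp_def algebra_simps)
    finally show ?thesis
      by (rule has_field_derivative_transform_within_open[where S = "{0<..}"])
        (use 1 in \<open>auto simp: flat_exp_def\<close>)
  next
    case 2
    have "((\<lambda>t. 0) has_real_derivative flat_exp (n + 2) t - real n * flat_exp (n + 1) t) (at t)"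
      using 2 by (simp add: flat_exp_def)
    then show ?thesis
      by (rule has_field_derivative_transform_within_open[where S = "{..<0}"])
        (use 2 in \<open>auto simp: flat_exp_def\<close>)
  next
    case 3
    \<comment> \<open>At the origin only the right-hand side matters: the difference quotient there
      is x^(n+1) / exp x with x = 1/s tending to infinity.\<close>
    have "((\<lambda>s. inverse s ^ (n + 1) / exp (inverse s)) \<longlongrightarrow> 0) (at_right (0::real))"
      by (rule filterlim_compose[OF tendsto_power_div_exp_0 filterlim_inverse_at_top_right])
    then have "((\<lambda>s. flat_exp n s / s) \<longlongrightarrow> 0) (at_right 0)"
      by (rule Lim_transform_eventually)
        (auto simp: eventually_at_filter flat_exp_def exp_minus field_simps)
    moreover have "((\<lambda>s. flat_exp n s / s) \<longlongrightarrow> 0) (at_left 0)"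
      by (rule Lim_transform_eventually[OF tendsto_const])
        (auto simp: eventually_at_filter flat_exp_def)
    ultimately have "((\<lambda>s. flat_exp n s / s) \<longlongrightarrow> 0) (at 0)"
      by (intro filterlim_split_at)
    then show ?thesis
      using 3 by (simp add: has_field_derivative_iff flat_exp_def)
  qed
qed

lemma Ck_on_flat_exp: "Ck_on k UNIV (flat_exp n)"
proof (induction k arbitrary: n)
  case 0
  then show ?case
    by (auto intro!: continuous_at_imp_continuous_on DERIV_isCont has_real_derivative_flat_exp)
next
  case (Suc k)
  show ?case
    by (rule Ck_on_SucI[OF _ has_field_derivative_imp_has_derivative[OF has_real_derivative_flat_exp]])
      (auto intro!: Ck_on_mult Ck_on_diff Suc)
qed

section \<open>Commuting total differential equations\<close>

text \<open>Turns quadratic error bounds into differentiability: of the coefficient field inside a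
  closed ball, and finally of the solution itself.\<close>

lemma has_derivative_withinI_quadratic:
  assumes "bounded_linear L" "0 < d"
    "\<And>y. y \<in> S \<Longrightarrow> norm (y - x) < d \<Longrightarrow> norm (f y - f x - L (y - x)) \<le> C * (norm (y - x))\<^sup>2"
  shows "(f has_derivative L) (at x within S)"
  unfolding has_derivative_within_alt
proof (intro conjI allI impI assms(1))
  fix e :: real assume e: "e > 0"
  define d' where "d' = min d (e / (\<bar>C\<bar> + 1))"
  have "norm (f y - f x - L (y - x)) \<le> e * norm (y - x)" if "y \<in> S" "norm (y - x) < d'" for y
  proof -
    have "norm (f y - f x - L (y - x)) \<le> C * (norm (y - x))\<^sup>2"
      using that assms(3) by (simp add: d'_def)
    also have "\<dots> \<le> ((\<bar>C\<bar> + 1) * norm (y - x)) * norm (y - x)"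
      by (auto simp: power2_eq_square mult.assoc intro!: mult_right_mono)
    also have "\<dots> \<le> e * norm (y - x)"
      using that(2) by (intro mult_right_mono) (auto simp: d'_def field_simps)
    finally show ?thesis .
  qed
  moreover have "d' > 0" using assms(2) e by (simp add: d'_def)
  ultimately show "\<exists>d>0. \<forall>y\<in>S. norm (y - x) < d \<longrightarrow> norm (f y - f x - L (y - x)) \<le> e * norm (y - x)"
    by blast
qed

text \<open>A Gronwall estimate without exponentials. On the unit interval the maximum
  \<open>M\<close> of \<open>norm (h s)\<close> is attained, and the mean value inequality from
  \<open>h 0 = 0\<close> gives M \<le> M/2 + b. The factor 1/2 is bought later by shrinking the
  radius.\<close>

lemma norm_le_of_self_bounded_derivative:
  fixes h :: "real \<Rightarrow> 'a::real_normed_vector"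
  assumes "h 0 = 0" and der: "\<And>t. t \<in> {0..1} \<Longrightarrow> (h has_vector_derivative h' t) (at t within {0..1})"
    and bound: "\<And>t M. t \<in> {0..1} \<Longrightarrow> \<forall>s\<in>{0..1}. norm (h s) \<le> M \<Longrightarrow> norm (h' t) \<le> M / 2 + b"
    and "t \<in> {0..1}"
  shows "norm (h t) \<le> 2 * b"
proof -
  have "continuous_on {0..1} h"
    by (auto simp: continuous_on_eq_continuous_within intro: has_vector_derivative_continuous[OF der])
  then obtain s where s: "s \<in> {0..1}" "\<And>t. t \<in> {0..1} \<Longrightarrow> norm (h t) \<le> norm (h s)"
    using continuous_attains_sup[OF compact_Icc _ continuous_on_norm, of 0 1 h] by auto
  define M where "M = norm (h s)"
  have M: "norm (h' t) \<le> M / 2 + b" if "t \<in> {0..1}" for t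
    using bound[OF that] s by (simp add: M_def)
  have "norm (h s - h 0) \<le> (M / 2 + b) * norm (s - 0)"
  proof (rule differentiable_bound[of "{0..1::real}"])
    show "(h has_derivative (\<lambda>x. x *\<^sub>R h' t)) (at t within {0..1})" if "t \<in> {0..1}" for t
      using der[OF that] by (simp add: has_vector_derivative_def)
    show "onorm (\<lambda>x. x *\<^sub>R h' t) \<le> M / 2 + b" if "t \<in> {0..1}" for t
      using M[OF that] by (simp add: onorm_scaleR_left_lemma onorm_scaleR_left onorm_id[unfolded id_def])
  qed (use s in auto)
  also have "\<dots> \<le> M / 2 + b"
    using M[OF s(1)] s(1) order_trans[OF norm_ge_zero] by (auto intro!: mult_left_le)
  finally have "M \<le> 2 * b" using assms(1) by (simp add: M_def)
  with s(2)[OF assms(4)] show ?thesis by (simp add: M_def)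
qed

text \<open>All rays are treated at once: the unknown is a function of the endpoint
  \<open>s\<close>, so continuity in \<open>s\<close> comes with the fixed point. Of the two bounds
  on \<open>C * r\<close>, the bound 1/2 makes the operator a contraction and the bound \<rho> keeps
  its values in the ball.\<close>

lemma Picard_fixed_point:
  fixes A :: "'a::euclidean_space \<Rightarrow> 'a \<Rightarrow> 'a"
  assumes lin: "\<And>x. linear (A x)" and C: "0 \<le> C" "0 \<le> \<rho>" "0 \<le> r" "C * r \<le> 1 / 2" "C * r \<le> \<rho>"
    and b0: "\<And>x v. x \<in> cball x0 \<rho> \<Longrightarrow> norm (A x v) \<le> C * norm v"
    and b1: "\<And>x y v. x \<in> cball x0 \<rho> \<Longrightarrow> y \<in> cball x0 \<rho> \<Longrightarrow>
      norm (A y v - A x v) \<le> C * norm (y - x) * norm v"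
  obtains \<phi> where "continuous_on UNIV \<phi>" "range \<phi> \<subseteq> cball x0 \<rho>"
    "\<And>s. s \<in> cball 0 r \<Longrightarrow> \<phi> s = x0 + integral {0..1} (\<lambda>t. A (\<phi> (t *\<^sub>R s)) s)"
proof -
  \<comment> \<open>The retraction onto \<open>cball 0 r\<close> lets the operator act on bounded
    continuous functions on the whole space, which form a complete space, while the coefficient
    field only receives directions of norm at most \<open>r\<close>.\<close>
  define p where "p = closest_point (cball (0::'a) r)"
  have p: "norm (p s) \<le> r" for s
    using closest_point_in_set[of "cball (0::'a) r" s] C(3) by (auto simp: p_def)
  have p_cont: "continuous_on S p" for S
    unfolding p_def using C(3) by (intro continuous_on_closest_point) auto
  have p_id: "p s = s" if "s \<in> cball 0 r" for s
    using that by (simp add: p_def closest_point_self)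
  have A_cont: "continuous_on (cball x0 \<rho> \<times> UNIV) (\<lambda>(x, v). A x v)"
  proof -
    have bl: "bounded_linear (A x)" for x
      using lin linear_conv_bounded_linear by blast
    have "((\<lambda>(y, w). A y w) \<longlongrightarrow> A x v) (at (x, v) within cball x0 \<rho> \<times> UNIV)" if "x \<in> cball x0 \<rho>" for x v
    proof (rule Lim_transform2)
      let ?F = "at (x, v) within cball x0 \<rho> \<times> UNIV"
      have "((\<lambda>z. A x (snd z)) \<longlongrightarrow> A x v) ?F"
        by (intro bounded_linear.tendsto[OF bl] tendsto_eq_intros) auto
      then show "((\<lambda>(y, w). A x w) \<longlongrightarrow> A x v) ?F" by (simp add: case_prod_unfold)
      have "((\<lambda>z. C * norm (fst z - x) * norm (snd z)) \<longlongrightarrow> C * norm (x - x) * norm v) ?F"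
        by (intro tendsto_intros tendsto_fst[where a = "(x, v)", simplified]
            tendsto_snd[where a = "(x, v)", simplified])
      then have "((\<lambda>z. C * norm (fst z - x) * norm (snd z)) \<longlongrightarrow> 0) ?F" by simp
      then show "((\<lambda>z. (case z of (y, w) \<Rightarrow> A x w) - (case z of (y, w) \<Rightarrow> A y w)) \<longlongrightarrow> 0) ?F"
        by (rule Lim_null_comparison[rotated])
          (auto simp: eventually_at_filter norm_minus_commute[of "A x _"] intro!: always_eventually b1 that)
    qed
    then show ?thesis by (auto simp: continuous_on_def)
  qed
  define g where "g = (\<lambda>(f :: 'a \<Rightarrow>\<^sub>C 'a) s t. A (f (t *\<^sub>R p s)) (p s))"
  define T where "T = (\<lambda>f s. x0 + integral {0..1} (g f s))"
  define X where "X = (PiC UNIV (\<lambda>_. cball x0 \<rho>) :: ('a \<Rightarrow>\<^sub>C 'a) set)"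
  have X: "f \<in> X \<longleftrightarrow> (\<forall>s. apply_bcontfun f s \<in> cball x0 \<rho>)" for f
    by (auto simp: X_def mem_PiC_iff)
  have g_cont: "continuous_on (UNIV \<times> cbox 0 1) (\<lambda>(s, t). g f s t)" if "f \<in> X" for f
    unfolding g_def case_prod_unfold
    by (rule continuous_on_compose2[OF A_cont[unfolded case_prod_unfold],
          of _ "\<lambda>z. (f (snd z *\<^sub>R p (fst z)), p (fst z))", simplified])
      (use that in \<open>auto simp: X intro!: continuous_intros continuous_on_compose2[OF p_cont]
          continuous_on_compose2[OF continuous_on_apply_bcontfun]\<close>)
  have g_int: "g f s integrable_on {0..1}" if "f \<in> X" for f s
    by (intro integrable_continuous_interval continuous_on_compose2[OF g_cont[OF that], of _ "\<lambda>t. (s, t)", simplified])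
      (auto intro!: continuous_intros)
  have g_le: "norm (g f s t) \<le> C * r" if "f \<in> X" for f s t
    using b0[of "f (t *\<^sub>R p s)" "p s"] that mult_left_mono[OF p[of s] C(1)]
    by (simp add: X g_def)
  have T_ball: "T f s \<in> cball x0 \<rho>" if "f \<in> X" for f s
  proof -
    have "norm (integral {0..1} (g f s)) \<le> C * r * (1 - 0)"
      by (rule integral_bound) (use g_cont[OF that] g_le[OF that] in \<open>auto intro!: continuous_on_compose2[OF g_cont[OF that], of _ "\<lambda>t. (s, t)", simplified] continuous_intros\<close>)
    then show ?thesis using C(5) by (simp add: T_def dist_norm)
  qed
  have T_bcont: "T f \<in> bcontfun" if "f \<in> X" for f
  proof -
    have "continuous_on UNIV (T f)"
      unfolding T_def using integral_continuous_on_param[OF g_cont[OF that]]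
      by (intro continuous_intros) simp
    moreover have "bounded (range (T f))"
      by (rule bounded_subset[OF bounded_cball]) (use T_ball[OF that] in blast)
    ultimately show ?thesis by (simp add: bcontfun_def)
  qed
  define P where "P = (\<lambda>f. Bcontfun (T f))"
  have P: "apply_bcontfun (P f) = T f" if "f \<in> X" for f
    by (simp add: P_def Bcontfun_inverse T_bcont[OF that])
  have contr: "dist (P f) (P h) \<le> 1 / 2 * dist f h" if "f \<in> X" "h \<in> X" for f h
  proof (rule dist_bound)
    fix s
    have "norm (integral {0..1} (\<lambda>t. g f s t - g h s t)) \<le> (1 / 2 * dist f h) * (1 - 0)"
    proof (rule integral_bound)
      show "continuous_on {0..1} (\<lambda>t. g f s t - g h s t)"
        by (intro continuous_intros continuous_on_compose2[OF g_cont[OF that(1)], of _ "\<lambda>t. (s, t)", simplified]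
            continuous_on_compose2[OF g_cont[OF that(2)], of _ "\<lambda>t. (s, t)", simplified]) auto
      fix t :: real
      have "norm (g f s t - g h s t) \<le> C * dist f h * norm (p s)"
      proof -
        have "norm (g f s t - g h s t) \<le> C * dist (f (t *\<^sub>R p s)) (h (t *\<^sub>R p s)) * norm (p s)"
          using that by (auto simp: g_def X dist_norm intro!: b1)
        also have "\<dots> \<le> C * dist f h * norm (p s)"
          by (intro mult_right_mono mult_left_mono dist_bounded C(1)) auto
        finally show ?thesis .
      qed
      also have "\<dots> \<le> C * dist f h * r"
        using C(1) p by (intro mult_left_mono) auto
      also have "\<dots> \<le> 1 / 2 * dist f h"
        using mult_right_mono[OF C(4), of "dist f h"] by (simp add: mult_ac)
      finally show "norm (g f s t - g h s t) \<le> 1 / 2 * dist f h" .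
    qed simp
    then show "dist (P f s) (P h s) \<le> 1 / 2 * dist f h"
      by (simp add: P that T_def dist_norm integral_diff g_int)
  qed
  have "\<exists>!f\<in>X. P f = f"
  proof (rule Banach_fix[where c = "1 / 2"])
    show "complete X" unfolding X_def by (simp add: complete_eq_closed closed_PiC)
    have "const_bcontfun x0 \<in> X" using C(2) by (simp add: X const_bcontfun.rep_eq)
    then show "X \<noteq> {}" by blast
    show "P ` X \<subseteq> X" using P T_ball X by auto
  qed (use contr in auto)
  then obtain f where f: "f \<in> X" "P f = f" by auto
  show thesis
  proof (rule that[of "apply_bcontfun f"])
    show "range f \<subseteq> cball x0 \<rho>" using f(1) X by blast
    show "f s = x0 + integral {0..1} (\<lambda>t. A (f (t *\<^sub>R s)) s)" if "s \<in> cball 0 r" for s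
      using P[OF f(1)] f(2) p_id[OF that] by (metis (no_types, lifting) T_def g_def ext)
  qed simp
qed

text \<open>Since \<open>A x\<close> is linear, the factor \<open>t\<close> in the direction
  \<open>t *\<^sub>R s\<close> is exactly the Jacobian of the substitution that rescales [0,1] to
  [0,t]. The equation at \<open>t *\<^sub>R s\<close> becomes an integral up to \<open>t\<close>, to
  which the fundamental theorem applies.\<close>

lemma Picard_ray_derivative:
  fixes A :: "'a::euclidean_space \<Rightarrow> 'a \<Rightarrow> 'a" and \<phi> :: "'a \<Rightarrow> 'a"
  assumes lin: "\<And>x. linear (A x)"
    and cont: "continuous_on {0..1} (\<lambda>t. A (\<phi> (t *\<^sub>R s)) s)"
    and fix_eq: "\<And>t. t \<in> {0..1} \<Longrightarrow>
      \<phi> (t *\<^sub>R s) = x0 + integral {0..1} (\<lambda>\<tau>. A (\<phi> (\<tau> *\<^sub>R t *\<^sub>R s)) (t *\<^sub>R s))"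
    and t: "t \<in> {0..1}"
  shows "((\<lambda>t. \<phi> (t *\<^sub>R s)) has_vector_derivative A (\<phi> (t *\<^sub>R s)) s) (at t within {0..1})"
proof -
  define g where "g = (\<lambda>t. A (\<phi> (t *\<^sub>R s)) s)"
  define G where "G = (\<lambda>t. integral {0..t} g)"
  have G: "(G has_vector_derivative g t) (at t within {0..1})" if "t \<in> {0..1}" for t
    unfolding G_def using cont that by (intro integral_has_vector_derivative) (auto simp: g_def)
  have eq: "\<phi> (t *\<^sub>R s) = x0 + G t" if t: "t \<in> {0..1}" for t
  proof -
    have img: "(*) t ` {0..1} \<subseteq> {0..1}" using t by (auto intro: mult_le_one)
    have "((G \<circ> (*) t) has_vector_derivative t *\<^sub>R g (t * \<tau>)) (at \<tau> within {0..1})"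
      if "\<tau> \<in> {0..1}" for \<tau>
    proof (rule vector_diff_chain_within)
      show "((*) t has_vector_derivative t) (at \<tau> within {0..1})"
        by (auto intro!: derivative_eq_intros simp: has_vector_derivative_def)
      show "(G has_vector_derivative g (t * \<tau>)) (at (t * \<tau>) within (*) t ` {0..1})"
        by (rule has_vector_derivative_within_subset[OF G img]) (use img that in blast)
    qed
    then have "((\<lambda>\<tau>. t *\<^sub>R g (t * \<tau>)) has_integral (G \<circ> (*) t) 1 - (G \<circ> (*) t) 0) {0..1}"
      by (intro fundamental_theorem_of_calculus) (auto simp: o_def)
    then have "integral {0..1} (\<lambda>\<tau>. t *\<^sub>R g (t * \<tau>)) = G t"
      by (auto simp: G_def dest!: integral_unique)
    then show ?thesis
      using fix_eq[OF t] linear_scale[OF lin] by (simp add: g_def mult.commute)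
  qed
  have "((\<lambda>t. x0 + G t) has_vector_derivative g t) (at t within {0..1})"
    by (auto intro!: derivative_eq_intros G t)
  then show ?thesis
    unfolding g_def by (rule has_vector_derivative_transform[OF t, rotated]) (simp add: eq)
qed

text \<open>Symmetry of \<open>A' x (A x u) v\<close> says that the fields \<open>A(\<cdot>) u\<close> commute. A solution is found
  along rays by Picard's theorem; symmetry enters in the linear differential equation along
  the ray satisfied by the defect \<open>\<phi> (t (s + v)) - \<phi> (t s) - t A (\<phi> (t s)) v\<close>.\<close>

lemma total_differential_equation:
  fixes A :: "'a::euclidean_space \<Rightarrow> 'a \<Rightarrow> 'a" and A' :: "'a \<Rightarrow> 'a \<Rightarrow> 'a \<Rightarrow> 'a"
  assumes lin: "\<And>x. linear (A x)"
    and lin': "\<And>x v. x \<in> cball x0 \<rho> \<Longrightarrow> linear (\<lambda>w. A' x w v)"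
    and "0 < \<rho>" "0 \<le> C"
    and b0: "\<And>x v. x \<in> cball x0 \<rho> \<Longrightarrow> norm (A x v) \<le> C * norm v"
    and b1: "\<And>x y v. x \<in> cball x0 \<rho> \<Longrightarrow> y \<in> cball x0 \<rho> \<Longrightarrow>
      norm (A y v - A x v) \<le> C * norm (y - x) * norm v"
    and b2: "\<And>x w v. x \<in> cball x0 \<rho> \<Longrightarrow> norm (A' x w v) \<le> C * norm w * norm v"
    and b3: "\<And>x y v. x \<in> cball x0 \<rho> \<Longrightarrow> y \<in> cball x0 \<rho> \<Longrightarrow>
      norm (A y v - A x v - A' x (y - x) v) \<le> C * (norm (y - x))\<^sup>2 * norm v"
    and sym: "\<And>x u v. x \<in> cball x0 \<rho> \<Longrightarrow> A' x (A x u) v = A' x (A x v) u"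
  obtains r \<phi> where "0 < r" "\<phi> 0 = x0" "\<And>s. s \<in> ball 0 r \<Longrightarrow> \<phi> s \<in> cball x0 \<rho>"
    "\<And>s. s \<in> ball 0 r \<Longrightarrow> (\<phi> has_derivative A (\<phi> s)) (at s)"
proof -
  \<comment> \<open>This radius gives C * r \<le> min (1/2) \<rho>; the \<open>+ 1\<close> allows
    \<open>C = 0\<close>.\<close>
  define r where "r = min (1 / 2) \<rho> / (C + 1)"
  have r: "r > 0" using \<open>0 < \<rho>\<close> \<open>0 \<le> C\<close> by (simp add: r_def)
  have "C * r \<le> (C + 1) * r" using r by (simp add: distrib_right)
  also have "\<dots> = min (1 / 2) \<rho>" using \<open>0 \<le> C\<close> by (simp add: r_def)
  finally have Cr: "C * r \<le> 1 / 2" "C * r \<le> \<rho>" by auto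
  obtain \<phi> where \<phi>: "continuous_on UNIV \<phi>" "range \<phi> \<subseteq> cball x0 \<rho>"
    "\<And>s. s \<in> cball 0 r \<Longrightarrow> \<phi> s = x0 + integral {0..1} (\<lambda>t. A (\<phi> (t *\<^sub>R s)) s)"
    by (rule Picard_fixed_point[OF lin \<open>0 \<le> C\<close> _ _ Cr b0 b1]) (use r \<open>0 < \<rho>\<close> in auto)
  have \<phi>_in: "\<phi> s \<in> cball x0 \<rho>" for s using \<phi>(2) by blast
  have lin'_bl: "bounded_linear (\<lambda>w. A' (\<phi> s) w v)" for s v
    using lin'[OF \<phi>_in] linear_conv_bounded_linear by blast
  have dA: "((\<lambda>y. A y v) has_derivative (\<lambda>w. A' (\<phi> s) w v)) (at (\<phi> s) within cball x0 \<rho>)" for s v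
    by (rule has_derivative_withinI_quadratic[OF lin'_bl, where d = 1 and C = "C * norm v"])
      (use b3[OF \<phi>_in] in \<open>auto simp: mult_ac\<close>)
  have ray: "((\<lambda>t. \<phi> (t *\<^sub>R s)) has_vector_derivative A (\<phi> (t *\<^sub>R s)) s) (at t within {0..1})"
    if "t \<in> {0..1}" "s \<in> ball 0 r" for t s
  proof (rule Picard_ray_derivative[where A = A and \<phi> = \<phi> and s = s and ?x0.0 = x0, OF lin _ _ that(1)])
    have "continuous_on (range \<phi>) (\<lambda>y. A y s)"
      unfolding continuous_on_eq_continuous_within
    proof
      fix y assume "y \<in> range \<phi>"
      then show "continuous (at y within range \<phi>) (\<lambda>y. A y s)"
        using continuous_within_subset[OF has_derivative_continuous[OF dA] \<phi>(2)] by blast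
    qed
    then show "continuous_on {0..1} (\<lambda>t. A (\<phi> (t *\<^sub>R s)) s)"
      by (rule continuous_on_compose2)
        (auto intro!: continuous_intros continuous_on_compose2[OF \<phi>(1)])
    show "\<phi> (t *\<^sub>R s) = x0 + integral {0..1} (\<lambda>\<tau>. A (\<phi> (\<tau> *\<^sub>R t *\<^sub>R s)) (t *\<^sub>R s))" if "t \<in> {0..1}" for t
    proof (rule \<phi>(3))
      have "t * norm s \<le> norm s" using that by (simp add: mult_left_le_one_le)
      then show "t *\<^sub>R s \<in> cball 0 r" using \<open>s \<in> ball 0 r\<close> that by simp
    qed
  qed
  \<comment> \<open>Lipschitz dependence on the endpoint, uniform along the ray. It makes every
    squared increment in the estimate of the defect a multiple of
    \<open>(norm v)\<^sup>2\<close>.\<close>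
  have increment: "norm (\<phi> (t *\<^sub>R (s + v)) - \<phi> (t *\<^sub>R s)) \<le> 2 * (C * norm v)"
    if "s \<in> ball 0 r" "s + v \<in> ball 0 r" "t \<in> {0..1}" for s v t
  proof (rule norm_le_of_self_bounded_derivative[OF _ _ _ that(3)])
    show "((\<lambda>t. \<phi> (t *\<^sub>R (s + v)) - \<phi> (t *\<^sub>R s)) has_vector_derivative
        A (\<phi> (t *\<^sub>R (s + v))) (s + v) - A (\<phi> (t *\<^sub>R s)) s) (at t within {0..1})" if "t \<in> {0..1}" for t
      by (intro has_vector_derivative_diff ray that \<open>s \<in> ball 0 r\<close> \<open>s + v \<in> ball 0 r\<close>)
    fix t M :: real assume t: "t \<in> {0..1}" and M: "\<forall>t\<in>{0..1}. norm (\<phi> (t *\<^sub>R (s + v)) - \<phi> (t *\<^sub>R s)) \<le> M"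
    define x y where "x = \<phi> (t *\<^sub>R s)" and "y = \<phi> (t *\<^sub>R (s + v))"
    have M0: "0 \<le> M" using M t order_trans[OF norm_ge_zero] by blast
    have "norm (A y s - A x s) \<le> C * norm (y - x) * norm s"
      using \<phi>_in by (simp add: b1 x_def y_def)
    also have "\<dots> \<le> C * M * r"
      using M t that(1) \<open>0 \<le> C\<close> M0
      by (intro mult_mono) (auto simp: x_def y_def)
    also have "\<dots> \<le> M / 2"
      using mult_right_mono[OF Cr(1) M0] by (simp add: mult_ac)
    finally have 1: "norm (A y s - A x s) \<le> M / 2" .
    have 2: "norm (A y v) \<le> C * norm v" using \<phi>_in by (simp add: b0 y_def)
    have 3: "A y (s + v) - A x s = (A y s - A x s) + A y v" by (simp add: linear_add[OF lin])
    have "norm (A y (s + v) - A x s) \<le> M / 2 + C * norm v"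
      unfolding 3 by (rule norm_triangle_le[OF add_mono[OF 1 2]])
    then show "norm (A (\<phi> (t *\<^sub>R (s + v))) (s + v) - A (\<phi> (t *\<^sub>R s)) s) \<le> M / 2 + C * norm v"
      by (simp add: x_def y_def)
  qed simp
  \<comment> \<open>The two summands bound the error terms \<open>1\<close> and \<open>2\<close>
    below: the second-order remainder of \<open>A\<close> in direction \<open>s\<close>, with
    increment at most \<open>2 * C * norm v\<close> and \<open>norm s \<le> r\<close>, and the
    variation of \<open>A\<close> in direction \<open>v\<close>.\<close>
  define C' where "C' = C * (2 * C)\<^sup>2 * r + 2 * C\<^sup>2"
  have defect: "norm (\<phi> (s + v) - \<phi> s - A (\<phi> s) v) \<le> 2 * (C' * (norm v)\<^sup>2)"
    if s: "s \<in> ball 0 r" "s + v \<in> ball 0 r" for s v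
  proof -
    define h where "h = (\<lambda>t. \<phi> (t *\<^sub>R (s + v)) - \<phi> (t *\<^sub>R s) - t *\<^sub>R A (\<phi> (t *\<^sub>R s)) v)"
    define h' where "h' = (\<lambda>t. A (\<phi> (t *\<^sub>R (s + v))) (s + v) - A (\<phi> (t *\<^sub>R s)) s
      - (A (\<phi> (t *\<^sub>R s)) v + t *\<^sub>R A' (\<phi> (t *\<^sub>R s)) (A (\<phi> (t *\<^sub>R s)) s) v))"
    have "norm (h 1) \<le> 2 * (C' * (norm v)\<^sup>2)"
    proof (rule norm_le_of_self_bounded_derivative[where h' = h'])
      show "h 0 = 0" by (simp add: h_def)
      show "(h has_vector_derivative h' t) (at t within {0..1})" if t: "t \<in> {0..1}" for t
      proof -
        have "(((\<lambda>y. A y v) \<circ> (\<lambda>t. \<phi> (t *\<^sub>R s))) has_vector_derivative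
          A' (\<phi> (t *\<^sub>R s)) (A (\<phi> (t *\<^sub>R s)) s) v) (at t within {0..1})"
          by (rule vector_derivative_diff_chain_within[OF ray[OF t s(1)]])
            (rule has_derivative_subset[OF dA], use \<phi>_in in blast)
        then show ?thesis
          unfolding h_def h'_def o_def
          by (intro has_vector_derivative_diff ray t s)
            (auto intro!: derivative_eq_intros simp: add.commute)
      qed
      fix t M :: real assume t: "t \<in> {0..1}" and M: "\<forall>t\<in>{0..1}. norm (h t) \<le> M"
      define x y where "x = \<phi> (t *\<^sub>R s)" and "y = \<phi> (t *\<^sub>R (s + v))"
      have xy: "x \<in> cball x0 \<rho>" "y \<in> cball x0 \<rho>" using \<phi>_in by (auto simp: x_def y_def)
      have d: "norm (y - x) \<le> 2 * C * norm v"
        using increment[OF s t] by (simp add: x_def y_def mult_ac)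
      have M0: "0 \<le> M" using M t order_trans[OF norm_ge_zero] by blast
      have le_r: "norm s \<le> r" using s(1) by simp
      interpret A': linear "\<lambda>w. A' x w s" using lin' xy(1) .
      \<comment> \<open>Here \<open>sym\<close> moves the directions \<open>s\<close> and
        \<open>v\<close> across. The leftover term of \<open>h'\<close> then merges with the
        linearization of the difference into \<open>A' x (h t) s\<close>, and the defect solves a
        linear equation with an error quadratic in \<open>v\<close>.\<close>
      have "A' x (h t) s = A' x (y - x) s - t *\<^sub>R A' x (A x s) v"
        by (simp add: h_def A'.diff A'.scale sym[OF xy(1), of v] flip: x_def y_def)
      then have eq: "h' t = (A y s - A x s - A' x (y - x) s) + (A y v - A x v) + A' x (h t) s"
        by (simp add: h'_def linear_add[OF lin] flip: x_def y_def)
      have 1: "norm (A y s - A x s - A' x (y - x) s) \<le> C * (2 * C)\<^sup>2 * r * (norm v)\<^sup>2"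
      proof -
        have "norm (A y s - A x s - A' x (y - x) s) \<le> C * (norm (y - x))\<^sup>2 * norm s"
          using xy by (intro b3)
        also have "\<dots> \<le> C * (2 * C * norm v)\<^sup>2 * r"
          using d le_r \<open>0 \<le> C\<close> by (intro mult_mono power_mono) auto
        finally show ?thesis by (simp add: power_mult_distrib mult_ac)
      qed
      have 2: "norm (A y v - A x v) \<le> 2 * C\<^sup>2 * (norm v)\<^sup>2"
      proof -
        have "norm (A y v - A x v) \<le> C * norm (y - x) * norm v"
          using xy by (intro b1)
        also have "\<dots> \<le> C * (2 * C * norm v) * norm v"
          using d \<open>0 \<le> C\<close> by (intro mult_mono) auto
        finally show ?thesis by (simp add: power2_eq_square mult_ac)
      qed
      have 3: "norm (A' x (h t) s) \<le> M / 2"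
      proof -
        have "norm (A' x (h t) s) \<le> C * norm (h t) * norm s" using xy(1) by (rule b2)
        also have "\<dots> \<le> C * M * r"
          using M t le_r \<open>0 \<le> C\<close> M0 by (intro mult_mono) auto
        also have "\<dots> \<le> M / 2" using mult_right_mono[OF Cr(1) M0] by (simp add: mult_ac)
        finally show ?thesis .
      qed
      show "norm (h' t) \<le> M / 2 + C' * (norm v)\<^sup>2"
        using norm_triangle_mono[OF norm_triangle_mono[OF 1 2] 3] by (simp add: eq C'_def distrib_right)
    qed simp
    then show ?thesis by (simp add: h_def)
  qed
  show thesis
  proof (rule that[OF r])
    show "\<phi> 0 = x0" using \<phi>(3)[of 0] r linear_0[OF lin] by simp
    show "\<phi> s \<in> cball x0 \<rho>" for s by (rule \<phi>_in)
    show "(\<phi> has_derivative A (\<phi> s)) (at s)" if s: "s \<in> ball 0 r" for s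
    proof -
      have "bounded_linear (A (\<phi> s))" using lin linear_conv_bounded_linear by blast
      then have "(\<phi> has_derivative A (\<phi> s)) (at s within ball 0 r)"
        by (rule has_derivative_withinI_quadratic[where d = 1 and C = "2 * C'"])
          (use defect[OF s, of "_ - s"] in \<open>auto simp: mult_ac\<close>)
      then show ?thesis by (simp only: at_within_open[OF s open_ball])
    qed
  qed
qed

section \<open>The local Frobenius theorem\<close>

lemma has_derivative_matrix_matrix_mult:
  fixes f :: "'a::real_normed_vector \<Rightarrow> real^'n^'m" and g :: "'a \<Rightarrow> real^'k^'n"
  assumes "(f has_derivative f') (at x)" "(g has_derivative g') (at x)"
  shows "((\<lambda>x. f x ** g x) has_derivative (\<lambda>v. f x ** g' v + f' v ** g x)) (at x)"
  by (rule bounded_bilinear.FDERIV[OF bounded_bilinear_matrix_matrix_mult assms])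

lemma matrix_diff_vector_mult: "((A :: real^'n^'m) - B) *v v = A *v v - B *v v"
  by (simp add: matrix_vector_mult_diff_rdistrib)

lemma matrix_sub_ldistrib: "(A :: real^'n^'m) ** (B - C) = A ** B - A ** (C :: real^'k^'n)"
  by (rule bounded_bilinear.diff_right[OF bounded_bilinear_matrix_matrix_mult])

lemma matrix_sub_rdistrib: "((A :: real^'n^'m) - B) ** C = A ** C - B ** (C :: real^'k^'n)"
  by (rule bounded_bilinear.diff_left[OF bounded_bilinear_matrix_matrix_mult])

lemma matrix_add_rdistrib_real: "((A :: real^'n^'m) + B) ** C = A ** C + B ** (C :: real^'k^'n)"
  by (rule bounded_bilinear.add_left[OF bounded_bilinear_matrix_matrix_mult])

section \<open>Two nearby projections and the lift between their ranges\<close>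

lemma matrix_inv_mult:
  assumes "det (B :: real^'n^'n) \<noteq> 0"
  shows "matrix_inv B ** B = mat 1" "B ** matrix_inv B = mat 1"
  using assms someI_ex[of "\<lambda>C. B ** C = mat 1 \<and> C ** B = mat 1"]
  by (auto simp: invertible_det_nz[symmetric] invertible_def matrix_inv_def)

text \<open>The standard operator B with B Q = P B for two projections. It is the identity for Q =
  P, hence invertible for Q near P.\<close>

definition intertwiner :: "real^'n^'n \<Rightarrow> real^'n^'n \<Rightarrow> real^'n^'n" where
  "intertwiner P Q = P ** Q + (mat 1 - P) ** (mat 1 - Q)"

lemma intertwiner:
  assumes "P ** P = P" "Q ** Q = Q"
  shows "intertwiner P Q ** Q = P ** Q" "P ** intertwiner P Q = P ** Q"
proof -
  have 1: "(mat 1 - Q) ** Q = 0" using assms(2) by (simp add: matrix_sub_rdistrib)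
  have 2: "P ** (mat 1 - P) = 0" using assms(1) by (simp add: matrix_sub_ldistrib)
  show "intertwiner P Q ** Q = P ** Q"
    using assms 1 by (simp add: intertwiner_def matrix_add_rdistrib_real matrix_mul_assoc[symmetric])
  show "P ** intertwiner P Q = P ** Q"
    using assms 2 by (simp add: intertwiner_def matrix_add_ldistrib matrix_mul_assoc)
qed

text \<open>If the intertwiner is invertible, \<open>P\<close> maps the range of \<open>Q\<close>
  bijectively onto the range of \<open>P\<close>, and this matrix is the inverse of that bijection,
  preceded by \<open>P\<close>. It exhibits the range of \<open>Q\<close> as a graph over the range
  of \<open>P\<close>.\<close>

definition graph_lift :: "real^'n^'n \<Rightarrow> real^'n^'n \<Rightarrow> real^'n^'n" where
  "graph_lift P Q = matrix_inv (intertwiner P Q) ** P"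

lemma graph_lift:
  assumes P: "P ** P = P" and Q: "Q ** Q = Q" and det: "det (intertwiner P Q) \<noteq> 0"
  shows "Q ** graph_lift P Q = graph_lift P Q" "P ** graph_lift P Q = P"
    "graph_lift P Q ** P = graph_lift P Q" "graph_lift P Q ** Q = Q"
proof -
  let ?B = "intertwiner P Q" and ?A = "graph_lift P Q"
  note inv = matrix_inv_mult[OF det] and B = intertwiner[OF P Q]
  show AP: "?A ** P = ?A" using P by (simp add: graph_lift_def matrix_mul_assoc[symmetric])
  have BA: "?B ** ?A = P" using inv by (simp add: graph_lift_def matrix_mul_assoc)
  have "?B ** (Q ** ?A) = P ** (?B ** ?A)" using B by (simp add: matrix_mul_assoc)
  then have "?B ** (Q ** ?A) = ?B ** ?A" using BA P by simp
  then have "matrix_inv ?B ** (?B ** (Q ** ?A)) = matrix_inv ?B ** (?B ** ?A)" by simp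
  then show QA: "Q ** ?A = ?A" using inv by (simp add: matrix_mul_assoc)
  have "P ** ?A = ?B ** (Q ** ?A)" using B QA by (metis matrix_mul_assoc)
  then show "P ** ?A = P" using QA BA by simp
  have "?B ** Q = P ** Q" by (rule B)
  then have "matrix_inv ?B ** (?B ** Q) = matrix_inv ?B ** (P ** Q)" by simp
  then show "?A ** Q = Q" using inv by (simp add: graph_lift_def matrix_mul_assoc)
qed

text \<open>Differentiates an identity that holds on an open set. The relations between derivatives
  of projections, lifts and transition maps are obtained in this way.\<close>

lemma has_derivative_unique_on_open:
  fixes f :: "'a::real_normed_vector \<Rightarrow> 'b::real_normed_vector"
  assumes "(f has_derivative f') (at x)" "(g has_derivative g') (at x)"
    "open S" "x \<in> S" "\<And>y. y \<in> S \<Longrightarrow> f y = g y"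
  shows "f' = g'"
  using has_derivative_transform_within_open[OF assms(1,3,4,5)] assms(2) has_derivative_unique by blast

text \<open>The involutivity condition for the range of a field \<open>Q\<close> of projections, expressed by its
  derivative \<open>Q'\<close>: it is \<open>(1 - Q) [Q X, Q Y] = 0\<close>, since \<open>(1 - Q) D\<^bsub>X\<^esub>(Q Y) = Q'(X) (Q Y)\<close>.\<close>

definition involutive_at :: "real^'n^'n \<Rightarrow> (real^'n \<Rightarrow> real^'n^'n) \<Rightarrow> bool" where
  "involutive_at P P' \<longleftrightarrow> (\<forall>a b. P *v a = a \<longrightarrow> P *v b = b \<longrightarrow> P' a *v b = P' b *v a)"

text \<open>The difference \<open>z\<close> of the two sides is the bracket of the lifted fields.
  Involutivity puts it into the range of \<open>Q x\<close>, as one sees by differentiating Q A = A.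
  Differentiating P A = P shows that \<open>P\<close> kills it. The lift recovers a vector of the
  range of \<open>Q x\<close> from its image under \<open>P\<close>, so \<open>z\<close>
  vanishes.\<close>

lemma commuting_lift:
  fixes Q :: "real^'n \<Rightarrow> real^'n^'n"
  assumes P: "P ** P = P" and S: "open S" "x \<in> S"
    and idem: "\<And>y. y \<in> S \<Longrightarrow> Q y ** Q y = Q y"
    and det: "\<And>y. y \<in> S \<Longrightarrow> det (intertwiner P (Q y)) \<noteq> 0"
    and DQ: "(Q has_derivative Q') (at x)"
    and DA: "((\<lambda>y. graph_lift P (Q y)) has_derivative A') (at x)"
    and inv: "involutive_at (Q x) Q'"
  shows "A' (graph_lift P (Q x) *v u) *v v = A' (graph_lift P (Q x) *v v) *v u"
proof -
  let ?A = "\<lambda>y. graph_lift P (Q y)"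
  note A = graph_lift[OF P idem det]
  have 1: "(\<lambda>w. Q x ** A' w + Q' w ** ?A x) = A'"
    by (rule has_derivative_unique_on_open[OF has_derivative_matrix_matrix_mult[OF DQ DA] DA S])
      (simp add: A)
  have 2: "(\<lambda>w. P ** A' w + 0 ** ?A x) = (\<lambda>w. 0)"
    by (rule has_derivative_unique_on_open[OF has_derivative_matrix_matrix_mult[OF has_derivative_const DA]
          has_derivative_const S]) (simp add: A)
  define z where "z = A' (?A x *v u) *v v - A' (?A x *v v) *v u"
  have "Q' (?A x *v u) *v (?A x *v v) = Q' (?A x *v v) *v (?A x *v u)"
    using inv A(1)[OF S(2) S(2)] unfolding involutive_at_def by (metis matrix_vector_mul_assoc)
  moreover have "A' w *v t = Q x *v (A' w *v t) + Q' w *v (?A x *v t)" for w t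
    using fun_cong[OF 1, of w] by (metis matrix_vector_mul_assoc matrix_vector_mult_add_rdistrib)
  ultimately have Qz: "Q x *v z = z"
    by (simp add: z_def matrix_vector_mult_diff_distrib) (metis add_diff_cancel_right)
  have "P *v (A' w *v t) = 0" for w t
    using fun_cong[OF 2, of w] by (simp add: matrix_vector_mul_assoc)
  then have Pz: "P *v z = 0" by (simp add: z_def matrix_vector_mult_diff_distrib)
  have "z = ?A x *v (P *v z)"
    using Qz A[OF S(2) S(2)] by (metis matrix_vector_mul_assoc)
  then have "z = 0" by (simp add: Pz)
  then show ?thesis by (simp add: z_def)
qed

lemma local_integral_map:
  fixes Q :: "real^'n \<Rightarrow> real^'n^'n"
  assumes W: "open W" "x0 \<in> W" and smooth: "smooth_on W Q"
    and idem: "\<And>y. y \<in> W \<Longrightarrow> Q y ** Q y = Q y"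
    and inv: "\<And>y. y \<in> W \<Longrightarrow> involutive_at (Q y) (frechet_derivative Q (at y))"
  obtains r \<phi> A where "0 < r" "\<phi> 0 = x0" "smooth_on (ball 0 r) \<phi>" "\<phi> ` ball 0 r \<subseteq> W"
    "\<And>s. s \<in> ball 0 r \<Longrightarrow> Q x0 *v \<phi> s = Q x0 *v (x0 + s)"
    "\<And>s. s \<in> ball 0 r \<Longrightarrow> (\<phi> has_derivative (*v) (A s)) (at s)"
    "\<And>s. s \<in> ball 0 r \<Longrightarrow> (*v) (A s) ` range ((*v) (Q x0)) = range ((*v) (Q (\<phi> s)))"
proof -
  define P where "P = Q x0"
  define A where "A = (\<lambda>y. graph_lift P (Q y))"
  \<comment> \<open>On this open set the lift is smooth by Cramer's rule. It contains
    \<open>x0\<close>, where the intertwiner of \<open>P\<close> with itself is the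
    identity.\<close>
  define W0 where "W0 = {y \<in> W. det (intertwiner P (Q y)) \<noteq> 0}"
  have P: "P ** P = P" using idem W by (simp add: P_def)
  have Ck: "Ck_on k W Q" for k using smooth by (simp add: smooth_on_def)
  have Ckdet: "Ck_on k W (\<lambda>y. intertwiner P (Q y))" for k
    unfolding intertwiner_def
    by (intro Ck_on_add Ck_on_matrix_matrix_mult Ck_on_diff Ck_on_const Ck W)
  have "open {y \<in> W. (\<lambda>y. det (intertwiner P (Q y))) y \<in> - {0}}"
    using continuous_open_preimage[OF Ck_on_imp_continuous[OF Ck_on_det[OF W(1) Ckdet]] W(1) open_delete[OF open_UNIV, of 0]]
    by (simp add: vimage_def Int_def)
  then have W0: "open W0" by (simp add: W0_def)
  have "intertwiner P P = mat 1"
    using P by (simp add: intertwiner_def matrix_sub_ldistrib matrix_sub_rdistrib)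
  then have x0: "x0 \<in> W0" using W by (simp add: W0_def P_def)
  have CkA: "Ck_on k W0 A" for k
    unfolding A_def graph_lift_def
    by (intro Ck_on_matrix_matrix_mult Ck_on_const Ck_on_matrix_inv W0 Ck_on_subset[OF Ckdet])
      (auto simp: W0_def)
  have A: "Q y ** A y = A y" "P ** A y = P" "A y ** P = A y" "A y ** Q y = Q y" if "y \<in> W0" for y
    unfolding A_def using that by (auto intro!: graph_lift P idem simp: W0_def)
  obtain \<rho> where \<rho>: "\<rho> > 0" "cball x0 \<rho> \<subseteq> W0"
    using W0 x0 by (auto simp: open_contains_cball)
  let ?A' = "\<lambda>y. frechet_derivative A (at y)"
  have dA: "(A has_derivative ?A' y) (at y)" if "y \<in> W0" for y
    using that by (rule Ck_on_imp_has_derivative[OF CkA])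
  obtain B where B: "B \<ge> 0" "\<And>x. x \<in> cball x0 \<rho> \<Longrightarrow> norm (A x) \<le> B"
    "\<And>x v. x \<in> cball x0 \<rho> \<Longrightarrow> norm (?A' x v) \<le> B * norm v"
    "\<And>x y. x \<in> cball x0 \<rho> \<Longrightarrow> y \<in> cball x0 \<rho> \<Longrightarrow> norm (A y - A x) \<le> B * norm (y - x)"
    "\<And>x y. x \<in> cball x0 \<rho> \<Longrightarrow> y \<in> cball x0 \<rho> \<Longrightarrow>
       norm (A y - A x - ?A' x (y - x)) \<le> B * (norm (y - x))\<^sup>2"
    using Ck_on_second_order_bounds[OF CkA compact_cball convex_cball \<rho>(2)] by blast
  obtain k where k: "k > 0" "\<And>(M::real^'n^'n) v. norm (M *v v) \<le> norm M * norm v * k"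
    using bounded_bilinear.pos_bounded[OF bounded_bilinear_matrix_vector_mult] by blast
  have le: "norm (M *v v) \<le> B * k * c * norm v" if "norm M \<le> B * c" for M :: "real^'n^'n" and v c
  proof -
    have "norm M * (norm v * k) \<le> B * c * (norm v * k)"
      using that k(1) by (intro mult_right_mono) auto
    with k(2)[of M v] show ?thesis by (simp only: mult_ac)
  qed
  obtain r \<phi> where \<phi>: "0 < r" "\<phi> 0 = x0" "\<And>s. s \<in> ball 0 r \<Longrightarrow> \<phi> s \<in> cball x0 \<rho>"
    "\<And>s. s \<in> ball 0 r \<Longrightarrow> (\<phi> has_derivative (*v) (A (\<phi> s))) (at s)"
  proof (rule total_differential_equation[of "\<lambda>y. (*v) (A y)" x0 \<rho> "\<lambda>y w v. ?A' y w *v v" "B * k"])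
    fix y assume y: "y \<in> cball x0 \<rho>"
    then have yW: "y \<in> W0" "y \<in> W" using \<rho> by (auto simp: W0_def)
    show "linear (\<lambda>w. ?A' y w *v v)" for v
      using linear_compose[OF has_derivative_linear[OF dA[OF yW(1)]]
        bounded_linear.linear[OF bounded_bilinear.bounded_linear_left[OF bounded_bilinear_matrix_vector_mult]], of v]
      by (simp add: o_def)
    show "?A' y (A y *v u) *v v = ?A' y (A y *v v) *v u" for u v
      unfolding A_def
    proof (rule commuting_lift[OF P W0 yW(1)])
      show "(Q has_derivative frechet_derivative Q (at y)) (at y)"
        using yW(2) by (rule Ck_on_imp_has_derivative[OF Ck])
      show "((\<lambda>y. graph_lift P (Q y)) has_derivative
        frechet_derivative (\<lambda>y. graph_lift P (Q y)) (at y)) (at y)"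
        using dA[OF yW(1)] by (simp add: A_def)
    qed (use idem inv yW in \<open>auto simp: W0_def\<close>)
    show "norm (A y *v v) \<le> B * k * norm v" for v
      using le[of "A y" 1 v] B(2)[OF y] by simp
    show "norm (?A' y w *v v) \<le> B * k * norm w * norm v" for w v
      using le[OF B(3)[OF y]] .
    fix z assume z: "z \<in> cball x0 \<rho>"
    show "norm (A z *v v - A y *v v) \<le> B * k * norm (z - y) * norm v" for v
      using le[OF B(4)[OF y z]] by (simp add: matrix_diff_vector_mult)
    show "norm (A z *v v - A y *v v - ?A' y (z - y) *v v) \<le> B * k * (norm (z - y))\<^sup>2 * norm v" for v
      using le[OF B(5)[OF y z]] by (simp add: matrix_diff_vector_mult)
  qed (use \<rho> B(1) k(1) in auto)
  have \<phi>W0: "\<phi> s \<in> W0" if "s \<in> ball 0 r" for s using \<phi>(3)[OF that] \<rho> by blast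
  \<comment> \<open>Bootstrapping: if \<phi> is of class k, then so is its derivative, the
    composition of the smooth \<open>A\<close> with \<phi>, and \<phi> is of class k + 1.\<close>
  have "Ck_on k (ball 0 r) \<phi>" for k
  proof (induction k)
    case 0
    then show ?case
      using \<phi>(4) by (auto intro!: continuous_at_imp_continuous_on has_derivative_continuous)
  next
    case (Suc k)
    show ?case
    proof (rule Ck_on_SucI[OF open_ball \<phi>(4)])
      show "Ck_on k (ball 0 r) (\<lambda>s. A (\<phi> s) *v v)" for v
        by (intro Ck_on_matrix_vector_mult Ck_on_const open_ball Ck_on_compose[OF open_ball Suc W0 CkA])
          (use \<phi>W0 in auto)
    qed
  qed
  then have smooth_\<phi>: "smooth_on (ball 0 r) \<phi>" by (simp add: smooth_on_def)
  \<comment> \<open>Since P A = P, the map \<open>P *v \<phi> s - P *v s\<close> has zero derivative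
    on the ball. This makes the image of \<phi> a graph over the range of \<open>P\<close>.\<close>
  have P\<phi>: "P *v \<phi> s = P *v (x0 + s)" if s: "s \<in> ball 0 r" for s
  proof -
    have "((\<lambda>s. P *v \<phi> s - P *v s) has_derivative (\<lambda>v. 0)) (at t within ball 0 r)" if "t \<in> ball 0 r" for t
    proof -
      have "((\<lambda>s. P *v \<phi> s - P *v s) has_derivative (\<lambda>v. P *v (A (\<phi> t) *v v) - P *v v)) (at t)"
        by (intro has_derivative_diff bounded_linear.has_derivative[OF matrix_vector_mul_bounded_linear] \<phi>(4) that
            has_derivative_ident)
      then show ?thesis
        using A(2)[OF \<phi>W0[OF that]] by (simp add: matrix_vector_mul_assoc has_derivative_at_withinI)
    qed
    then have "P *v \<phi> s - P *v s = P *v \<phi> 0 - P *v 0"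
      by (rule has_derivative_zero_unique[OF convex_ball]) (use s \<phi>(1) in auto)
    then show ?thesis by (simp add: \<phi>(2) matrix_vector_right_distrib algebra_simps)
  qed
  show thesis
  proof (rule that[OF \<phi>(1,2) smooth_\<phi>])
    show "\<phi> ` ball 0 r \<subseteq> W" using \<phi>W0 by (auto simp: W0_def)
    show "(*v) (A (\<phi> s)) ` range ((*v) (Q x0)) = range ((*v) (Q (\<phi> s)))" if "s \<in> ball 0 r" for s
    proof -
      note A = A[OF \<phi>W0[OF that]]
      have "(*v) (A (\<phi> s)) ` range ((*v) P) = range ((*v) (A (\<phi> s)))"
        using A(3) by (simp add: image_image matrix_vector_mul_assoc)
      also have "\<dots> = range ((*v) (Q (\<phi> s)))"
        using A(1,4) by (auto simp: image_iff set_eq_iff) (metis matrix_vector_mul_assoc)+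
      finally show ?thesis by (simp add: P_def)
    qed
  qed (use P\<phi> \<phi>(4) in \<open>auto simp: P_def\<close>)
qed

section \<open>Straightening an involutive distribution\<close>

lemma smooth_on_subset: "smooth_on S f \<Longrightarrow> T \<subseteq> S \<Longrightarrow> smooth_on T f"
  unfolding smooth_on_def by (blast intro: Ck_on_subset)

lemma smooth_on_cong: "open S \<Longrightarrow> smooth_on S f \<Longrightarrow> (\<And>x. x \<in> S \<Longrightarrow> f x = g x) \<Longrightarrow> smooth_on S g"
  unfolding smooth_on_def by (blast intro: Ck_on_cong)

lemma smooth_on_compose:
  fixes f :: "'a::euclidean_space \<Rightarrow> 'b::euclidean_space"
  shows "open S \<Longrightarrow> smooth_on S f \<Longrightarrow> open T \<Longrightarrow> smooth_on T g \<Longrightarrow> f ` S \<subseteq> T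
    \<Longrightarrow> smooth_on S (\<lambda>x. g (f x))"
  unfolding smooth_on_def by (blast intro: Ck_on_compose)

lemma smooth_on_imp_continuous: "smooth_on S f \<Longrightarrow> continuous_on S f"
  unfolding smooth_on_def by (blast intro: Ck_on_imp_continuous)

lemma smooth_on_has_derivative:
  "smooth_on S f \<Longrightarrow> x \<in> S \<Longrightarrow> (f has_derivative frechet_derivative f (at x)) (at x)"
  unfolding smooth_on_def by (blast intro: Ck_on_imp_has_derivative)

lemma smooth_on_Un:
  "open S \<Longrightarrow> open T \<Longrightarrow> smooth_on S f \<Longrightarrow> smooth_on T f \<Longrightarrow> smooth_on (S \<union> T) f"
  unfolding smooth_on_def by (blast intro: Ck_on_Un)

text \<open>The map \<phi> fills only the integral manifold, so it is completed to a local
  diffeomorphism by a shear. Its deviation \<open>h\<close> from a translation depends on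
  \<open>P *v y\<close> only and has values in the kernel of \<open>P\<close>; hence adding
  \<open>h\<close> is undone by subtracting the same \<open>h\<close>, which gives \<kappa>. On the
  range of \<open>P\<close> the shear \<eta> coincides with \<phi>.\<close>

lemma frobenius_straightening:
  fixes Q :: "real^'n \<Rightarrow> real^'n^'n"
  assumes W: "open W" "x0 \<in> W" and smooth: "smooth_on W Q"
    and idem: "\<And>y. y \<in> W \<Longrightarrow> Q y ** Q y = Q y"
    and inv: "\<And>y. y \<in> W \<Longrightarrow> involutive_at (Q y) (frechet_derivative Q (at y))"
  obtains U V \<kappa> \<eta> where "open U" "x0 \<in> U" "U \<subseteq> W" "open V" "homeomorphism U V \<kappa> \<eta>"
    "smooth_on U \<kappa>" "smooth_on V \<eta>" "\<kappa> x0 \<in> range ((*v) (Q x0))"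
    "\<And>y. y \<in> V \<Longrightarrow> y \<in> range ((*v) (Q x0)) \<Longrightarrow>
      frechet_derivative \<eta> (at y) ` range ((*v) (Q x0)) = range ((*v) (Q (\<eta> y)))"
proof -
  define P where "P = Q x0"
  have PP: "P *v (P *v v) = P *v v" for v
    using idem[OF W(2)] by (simp add: P_def matrix_vector_mul_assoc)
  obtain r \<phi> A where \<phi>: "0 < r" "\<phi> 0 = x0" "smooth_on (ball 0 r) \<phi>" "\<phi> ` ball 0 r \<subseteq> W"
    "\<And>s. s \<in> ball 0 r \<Longrightarrow> P *v \<phi> s = P *v (x0 + s)"
    "\<And>s. s \<in> ball 0 r \<Longrightarrow> (\<phi> has_derivative (*v) (A s)) (at s)"
    "\<And>s. s \<in> ball 0 r \<Longrightarrow> (*v) (A s) ` range ((*v) P) = range ((*v) (Q (\<phi> s)))"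
    using local_integral_map[OF W smooth idem inv] unfolding P_def by metis
  define S where "S = {y. P *v y \<in> ball 0 r}"
  define h where "h = (\<lambda>y. \<phi> (P *v y) - x0 - P *v y)"
  define \<kappa> where "\<kappa> = (\<lambda>x. x - x0 - h (x - x0))"
  define \<eta> where "\<eta> = (\<lambda>y. x0 + y + h y)"
  define U where "U = {x \<in> W. x - x0 \<in> S}"
  \<comment> \<open>The sets \<open>U\<close> and \<open>V\<close> are each cut down by
    \<open>W\<close> so that \<kappa> and \<eta> are mutually inverse between them and \<eta> stays
    inside the chart.\<close>
  define V where "V = {y \<in> S. \<eta> y \<in> W}"
  have S: "open S"
    unfolding S_def vimage_def[symmetric]
    by (intro open_vimage open_ball linear_continuous_on matrix_vector_mul_bounded_linear)
  have Ck_h: "Ck_on k S h" for k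
  proof -
    have "Ck_on k S ((*v) P)" by (rule Ck_on_bounded_linear[OF S matrix_vector_mul_bounded_linear])
    moreover from this have "Ck_on k S (\<lambda>y. \<phi> (P *v y))"
      by (rule Ck_on_compose[OF S _ open_ball]) (use \<phi>(3) in \<open>auto simp: smooth_on_def S_def\<close>)
    ultimately show ?thesis unfolding h_def by (intro Ck_on_diff Ck_on_const S)
  qed
  have Ck_\<eta>: "Ck_on k S \<eta>" for k
    unfolding \<eta>_def by (intro Ck_on_add Ck_on_const Ck_on_ident Ck_h S)
  have Ph: "P *v h y = 0" if "y \<in> S" for y
    using \<phi>(5)[of "P *v y"] that by (simp add: h_def S_def matrix_vector_right_distrib matrix_vector_mult_diff_distrib PP)
  have h_cong: "h y = h z" if "P *v y = P *v z" for y z using that by (simp add: h_def)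
  have S_cong: "y \<in> S \<longleftrightarrow> z \<in> S" if "P *v y = P *v z" for y z using that by (simp add: S_def)
  have P\<eta>: "P *v (\<eta> y - x0) = P *v y" if "y \<in> S" for y
    using Ph[OF that] by (simp add: \<eta>_def matrix_vector_right_distrib matrix_vector_mult_diff_distrib)
  have P\<kappa>: "P *v \<kappa> x = P *v (x - x0)" if "x - x0 \<in> S" for x
    using Ph[OF that] by (simp add: \<kappa>_def matrix_vector_mult_diff_distrib)
  have \<eta>\<kappa>: "\<eta> (\<kappa> x) = x" if "x - x0 \<in> S" for x
    using h_cong[OF P\<kappa>[OF that]] by (simp add: \<eta>_def \<kappa>_def)
  have \<kappa>\<eta>: "\<kappa> (\<eta> y) = y" if "y \<in> S" for y
    using h_cong[OF P\<eta>[OF that]] by (simp add: \<eta>_def \<kappa>_def)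
  have U: "open U"
  proof -
    have "U = W \<inter> (\<lambda>x. x - x0) -` S" by (auto simp: U_def)
    moreover have "open ((\<lambda>x. x - x0) -` S)"
      by (intro open_vimage S continuous_intros)
    ultimately show ?thesis using W(1) by auto
  qed
  have V: "open V"
  proof -
    have "V = S \<inter> \<eta> -` W" by (auto simp: V_def)
    then show ?thesis
      using continuous_open_preimage[OF Ck_on_imp_continuous[OF Ck_\<eta>] S W(1)] by simp
  qed
  have Ck_\<kappa>: "Ck_on k U \<kappa>" for k
  proof -
    have 1: "Ck_on k U (\<lambda>x. x - x0)" by (intro Ck_on_diff Ck_on_ident Ck_on_const U)
    have "Ck_on k U (\<lambda>x. h (x - x0))"
      by (rule Ck_on_compose[OF U 1 S Ck_h]) (auto simp: U_def)
    with 1 show ?thesis unfolding \<kappa>_def by (rule Ck_on_diff[OF U])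
  qed
  have Ck_\<eta>': "Ck_on k V \<eta>" for k
    by (rule Ck_on_subset[OF Ck_\<eta>]) (auto simp: V_def)
  have "0 \<in> S" using \<phi>(1) by (simp add: S_def)
  have h0: "h 0 = 0" by (simp add: h_def \<phi>(2))
  show thesis
  proof (rule that[OF U _ _ V])
    show "x0 \<in> U" using W(2) \<open>0 \<in> S\<close> by (simp add: U_def)
    show "U \<subseteq> W" by (auto simp: U_def)
    show "homeomorphism U V \<kappa> \<eta>"
    proof
      show "continuous_on U \<kappa>" by (rule Ck_on_imp_continuous[OF Ck_\<kappa>])
      show "continuous_on V \<eta>" by (rule Ck_on_imp_continuous[OF Ck_\<eta>'])
      show "\<kappa> ` U \<subseteq> V" using S_cong[OF P\<kappa>] \<eta>\<kappa> by (auto simp: U_def V_def)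
      show "\<eta> ` V \<subseteq> U" using S_cong[OF P\<eta>] by (auto simp: U_def V_def)
    qed (use \<eta>\<kappa> \<kappa>\<eta> in \<open>auto simp: U_def V_def\<close>)
    show "smooth_on U \<kappa>" "smooth_on V \<eta>" using Ck_\<kappa> Ck_\<eta>' by (auto simp: smooth_on_def)
    have "\<kappa> x0 = P *v 0" by (simp add: \<kappa>_def h0)
    then show "\<kappa> x0 \<in> range ((*v) (Q x0))" unfolding P_def by blast
    fix y assume y: "y \<in> V" "y \<in> range ((*v) (Q x0))"
    then have Py: "P *v y = y" using PP by (auto simp: P_def)
    then have y_ball: "y \<in> ball 0 r" using y(1) by (simp add: V_def S_def)
    have dP: "((*v) P has_derivative (*v) P) (at y)"
      by (rule bounded_linear_imp_has_derivative[OF matrix_vector_mul_bounded_linear])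
    have "((\<lambda>y. \<phi> (P *v y)) has_derivative (\<lambda>v. A y *v (P *v v))) (at y)"
      by (rule has_derivative_compose[OF dP]) (use \<phi>(6)[OF y_ball] in \<open>simp add: Py\<close>)
    then have "(\<eta> has_derivative (\<lambda>v. 0 + v + (A y *v (P *v v) - 0 - P *v v))) (at y)"
      unfolding \<eta>_def h_def
      by (intro has_derivative_add has_derivative_diff has_derivative_const has_derivative_ident dP)
    then have "(\<eta> has_derivative (\<lambda>v. v + (A y *v (P *v v) - P *v v))) (at y)" by simp
    then have "frechet_derivative \<eta> (at y) = (\<lambda>v. v + (A y *v (P *v v) - P *v v))"
      using frechet_derivative_at by metis
    then have "frechet_derivative \<eta> (at y) ` range ((*v) P) = (*v) (A y) ` range ((*v) P)"
      by (simp add: image_image PP)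
    also have "\<dots> = range ((*v) (Q (\<eta> y)))"
      using \<phi>(7)[OF y_ball] by (simp add: \<eta>_def h_def Py)
    finally show "frechet_derivative \<eta> (at y) ` range ((*v) (Q x0)) = range ((*v) (Q (\<eta> y)))"
      by (simp add: P_def)
  qed
qed

section \<open>Charts and transition maps\<close>

context smooth_manifold
begin

lemma chart:
  assumes "c \<in> A"
  shows chart_openin: "openin M (fst c)" and chart_open: "open (snd c ` fst c)"
    and chart_homeo: "homeomorphic_map (subtopology M (fst c)) (top_of_set (snd c ` fst c)) (snd c)"
    and chart_subset: "fst c \<subseteq> topspace M" and chart_inj: "inj_on (snd c) (fst c)"
proof -
  show 1: "openin M (fst c)" and "open (snd c ` fst c)"
    and 2: "homeomorphic_map (subtopology M (fst c)) (top_of_set (snd c ` fst c)) (snd c)"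
    using charts[OF assms] by (auto simp: is_chart_def)
  show 3: "fst c \<subseteq> topspace M" using 1 by (rule openin_subset)
  show "inj_on (snd c) (fst c)"
    using homeomorphic_imp_injective_map[OF 2] 3 by (simp add: inf.absorb2)
qed

lemma chart_image_open:
  assumes "c \<in> A" "openin M S" "S \<subseteq> fst c"
  shows "open (snd c ` S)"
proof -
  have "openin (subtopology M (fst c)) S"
    using assms chart_openin by (simp add: openin_open_subtopology)
  then have "openin (top_of_set (snd c ` fst c)) (snd c ` S)"
    using homeomorphic_imp_open_map[OF chart_homeo[OF assms(1)]] by (auto simp: open_map_def)
  then show ?thesis using chart_open[OF assms(1)] by (simp add: openin_open_eq)
qed

lemma chart_vimage_openin:
  assumes "c \<in> A" "open T"
  shows "openin M {p \<in> fst c. snd c p \<in> T}"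
proof -
  have "openin (subtopology M (fst c)) {p \<in> topspace (subtopology M (fst c)). snd c p \<in> T}"
    using homeomorphic_imp_continuous_map[OF chart_homeo[OF assms(1)]] assms(2)
    by (intro openin_continuous_map_preimage[where Y = euclidean])
      (auto simp: continuous_map_in_subtopology)
  then show ?thesis
    using chart_openin[OF assms(1)] chart_subset[OF assms(1)]
    by (auto simp: openin_open_subtopology inf.absorb2 topspace_subtopology)
qed

lemma overlap_open: "c \<in> A \<Longrightarrow> c' \<in> A \<Longrightarrow> open (snd c ` (fst c \<inter> fst c'))"
  by (intro chart_image_open openin_Int chart_openin) auto

lemma in_coords_apply: "c \<in> A \<Longrightarrow> p \<in> fst c \<Longrightarrow> in_coords c f (snd c p) = f p"
  by (simp add: in_coords_def chart_inj)

lemma transition_smooth: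
  "c \<in> A \<Longrightarrow> c' \<in> A \<Longrightarrow> smooth_on (snd c ` (fst c \<inter> fst c')) (in_coords c (snd c'))"
  using compat by (auto simp: compatible_def)

lemma transition_has_derivative:
  assumes "c \<in> A" "c' \<in> A" "p \<in> fst c \<inter> fst c'"
  shows "(in_coords c (snd c') has_derivative (*v) (transition_jacobian c c' p)) (at (snd c p))"
  using smooth_on_has_derivative[OF transition_smooth[OF assms(1,2)] imageI[OF assms(3)]]
  unfolding transition_jacobian_def by (metis differentiable_def jacobian_works)

lemma transition_jacobian_cocycle:
  assumes "c \<in> A" "c' \<in> A" "c'' \<in> A" "p \<in> fst c" "p \<in> fst c'" "p \<in> fst c''"
  shows "transition_jacobian c' c'' p ** transition_jacobian c c' p = transition_jacobian c c'' p"
proof -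
  let ?S = "snd c ` (fst c \<inter> fst c' \<inter> fst c'')"
  have S: "open ?S" "snd c p \<in> ?S"
    using assms by (auto intro!: chart_image_open openin_Int chart_openin)
  have "((\<lambda>y. in_coords c' (snd c'') (in_coords c (snd c') y)) has_derivative
      (\<lambda>v. transition_jacobian c' c'' p *v (transition_jacobian c c' p *v v))) (at (snd c p))"
    by (rule has_derivative_compose[OF transition_has_derivative[OF assms(1,2)]])
      (use assms transition_has_derivative[OF assms(2,3)] in \<open>auto simp: in_coords_apply\<close>)
  then have "(\<lambda>v. transition_jacobian c' c'' p *v (transition_jacobian c c' p *v v))
    = (*v) (transition_jacobian c c'' p)"
    by (rule has_derivative_unique_on_open[OF _ transition_has_derivative[OF assms(1,3)] S])
      (use assms in \<open>auto simp: in_coords_apply\<close>)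
  then show ?thesis
    by (simp add: matrix_eq matrix_vector_mul_assoc fun_eq_iff)
qed

lemma transition_jacobian_self:
  assumes "c \<in> A" "p \<in> fst c"
  shows "transition_jacobian c c p = mat 1"
proof -
  have "(*v) (transition_jacobian c c p) = (\<lambda>v. v)"
    by (rule has_derivative_unique_on_open[OF transition_has_derivative has_derivative_ident chart_open[OF assms(1)]])
      (use assms in \<open>auto simp: in_coords_apply\<close>)
  then show ?thesis by (simp add: matrix_eq)
qed

lemma transition_jacobian_inverse:
  assumes "c \<in> A" "c' \<in> A" "p \<in> fst c" "p \<in> fst c'"
  shows "transition_jacobian c' c p ** transition_jacobian c c' p = mat 1"
  using transition_jacobian_cocycle[OF assms(1,2,1,3,4,3)] assms by (simp add: transition_jacobian_self)

text \<open>The Jacobian applied to a fixed vector is a directional derivative of the transition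
  map, and these are smooth by the recursion of \<open>Ck_on\<close>. It is the coordinate form of a
  constant field transported to another chart.\<close>

lemma transition_jacobian_smooth:
  assumes "c \<in> A" "c' \<in> A"
  shows "smooth_on (snd c ` (fst c \<inter> fst c')) (in_coords c (\<lambda>p. transition_jacobian c c' p *v v))"
    (is "smooth_on ?S _")
proof -
  let ?\<tau> = "in_coords c (snd c')"
  have "Ck_on k ?S (\<lambda>y. frechet_derivative ?\<tau> (at y) v)" for k
    using transition_smooth[OF assms] by (metis Ck_on.simps(2) smooth_on_def)
  moreover have "frechet_derivative ?\<tau> (at y) v = in_coords c (\<lambda>p. transition_jacobian c c' p *v v) y"
    if "y \<in> ?S" for y
    using that assms frechet_derivative_at[OF transition_has_derivative[OF assms]]
    by (auto simp: in_coords_apply)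
  ultimately show ?thesis
    unfolding smooth_on_def by (blast intro: Ck_on_cong[OF overlap_open[OF assms]])
qed

end

section \<open>Integral manifolds of fields of projections\<close>

lemma cvec_eq_iff [simp]: "cvec x = cvec y \<longleftrightarrow> x = y"
  by (simp add: cvec_def vec_eq_iff)

lemma cvec_add: "cvec (x + y) = cvec x + cvec y"
  and cvec_diff: "cvec (x - y) = cvec x - cvec y"
  and cvec_scaleR: "cvec (r *\<^sub>R x) = complex_of_real r *s cvec x"
  and cvec_0 [simp]: "cvec 0 = 0"
  by (simp_all add: cvec_def vec_eq_iff)

lemma complexify_matrix_mult_cvec:
  "map_matrix complex_of_real P *v cvec x = cvec (P *v x)"
  by (simp add: cvec_def vec_eq_iff matrix_vector_mult_def)

lemma cvec_decomp: "(z :: complex^'n) = cvec (\<chi> i. Re (z $ i)) + \<i> *s cvec (\<chi> i. Im (z $ i))"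
  by (simp add: cvec_def vec_eq_iff complex_eq_iff)

lemma cvec_Re_Im_eq_iff:
  "cvec a + \<i> *s cvec b = cvec c + \<i> *s cvec d \<longleftrightarrow> a = c \<and> b = d"
  by (auto simp: cvec_def vec_eq_iff complex_eq_iff)

lemma complex_hull_range:
  "complex_hull (range ((*v) P)) = range ((*v) (map_matrix complex_of_real P))"
proof -
  have "map_matrix complex_of_real P *v (cvec x + \<i> *s cvec y)
    = cvec (P *v x) + \<i> *s cvec (P *v y)" for x y
    by (simp add: matrix_vector_right_distrib vector_scalar_commute complexify_matrix_mult_cvec)
  note mult = this
  show ?thesis
  proof (intro equalityI subsetI)
    fix z assume "z \<in> complex_hull (range ((*v) P))"
    then obtain x y where "z = cvec (P *v x) + \<i> *s cvec (P *v y)" unfolding complex_hull_def by blast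
    then show "z \<in> range ((*v) (map_matrix complex_of_real P))" using mult by (metis rangeI)
  next
    fix z assume "z \<in> range ((*v) (map_matrix complex_of_real P))"
    then obtain w where "z = map_matrix complex_of_real P *v w" by blast
    then have "z = cvec (P *v (\<chi> i. Re (w $ i))) + \<i> *s cvec (P *v (\<chi> i. Im (w $ i)))"
      using cvec_decomp[of w] mult by metis
    then show "z \<in> complex_hull (range ((*v) P))" unfolding complex_hull_def by blast
  qed
qed

text \<open>Lets the complex tangency condition in \<open>integral_manifold\<close> be read as an
  equality of real sets. A real vector \<open>x\<close> enters the hull paired with the imaginary
  part 0, and comparing real parts recovers it.\<close>

lemma complex_hull_eq_iff:
  assumes "0 \<in> V" "0 \<in> W"
  shows "complex_hull V = complex_hull W \<longleftrightarrow> V = W"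
proof
  have sub: "V \<subseteq> W" if "0 \<in> V" "complex_hull V \<subseteq> complex_hull W" for V W :: "(real^'n) set"
  proof
    fix x assume "x \<in> V"
    then have "cvec x + \<i> *s cvec 0 \<in> complex_hull V" using that(1) unfolding complex_hull_def by blast
    then have "cvec x + \<i> *s cvec 0 \<in> complex_hull W" using that(2) by blast
    then obtain a b where "cvec x + \<i> *s cvec 0 = cvec a + \<i> *s cvec b" "a \<in> W"
      unfolding complex_hull_def by blast
    then show "x \<in> W" using cvec_Re_Im_eq_iff by metis
  qed
  assume "complex_hull V = complex_hull W"
  then show "V = W" using assms sub by (metis order_refl subset_antisym)
qed simp

section \<open>Tangent spaces of slices and the necessity of involutivity\<close>

text \<open>Along the slice through \<open>y0\<close> the vectors \<psi>'(y) u are fixed by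
  \<open>G\<close>. Differentiating this in a slice direction \<open>v\<close> expresses G'(\<psi>'
  v) (\<psi>' u) by the second derivative of \<psi> in \<open>u\<close> and \<open>v\<close>, which
  is symmetric. By \<open>onto\<close>, such vectors exhaust the range of \<open>G\<close> at the
  point.\<close>

lemma involutive_at_parametrized:
  fixes \<psi> :: "real^'n \<Rightarrow> real^'n" and G :: "real^'n \<Rightarrow> real^'n^'n"
  assumes S: "open S" "y0 \<in> S" and \<psi>: "Ck_on (Suc (Suc 0)) S \<psi>"
    and G: "(G has_derivative G') (at (\<psi> y0))" and T: "subspace T"
    and tangent: "\<And>y u. y \<in> S \<Longrightarrow> y - y0 \<in> T \<Longrightarrow> u \<in> T \<Longrightarrow>
      G (\<psi> y) *v frechet_derivative \<psi> (at y) u = frechet_derivative \<psi> (at y) u"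
    and onto: "\<And>a. G (\<psi> y0) *v a = a \<Longrightarrow> a \<in> frechet_derivative \<psi> (at y0) ` T"
  shows "involutive_at (G (\<psi> y0)) G'"
proof -
  let ?D = "\<lambda>u y. frechet_derivative \<psi> (at y) u"
  let ?H = "\<lambda>u v. frechet_derivative (?D u) (at y0) v"
  have key: "G' (?D v y0) *v ?D u y0 = ?H u v - G (\<psi> y0) *v ?H u v" if uv: "u \<in> T" "v \<in> T" for u v
  proof -
    define f where "f = (\<lambda>y. G (\<psi> y) *v ?D u y - ?D u y)"
    define f' where "f' = (\<lambda>w. (G (\<psi> y0) *v ?H u w + G' (?D w y0) *v ?D u y0) - ?H u w)"
    have \<psi>': "Ck_on (Suc 0) S (?D u)" using \<psi> by simp
    have D\<psi>: "(\<psi> has_derivative (\<lambda>w. ?D w y0)) (at y0)"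
      using \<psi> S(2) by (rule Ck_on_imp_has_derivative)
    have "((\<lambda>y. G (\<psi> y)) has_derivative (\<lambda>w. G' (?D w y0))) (at y0)"
      by (rule has_derivative_compose[OF D\<psi> G])
    then have "(f has_derivative f') (at y0)"
      unfolding f_def f'_def
      by (intro has_derivative_diff bounded_bilinear.FDERIV[OF bounded_bilinear_matrix_vector_mult]
          Ck_on_imp_has_derivative[OF \<psi>' S(2)])
    \<comment> \<open>The function \<open>f\<close> is known to vanish on the slice only, not on an
      open set, so it is differentiated along the line through \<open>y0\<close> in direction
      \<open>v\<close>.\<close>
    then have 1: "((\<lambda>t. f (y0 + t *\<^sub>R v)) has_derivative (\<lambda>t. f' (t *\<^sub>R v))) (at (0::real))"
      by (intro has_derivative_compose[where g = f and f = "\<lambda>t. y0 + t *\<^sub>R v"])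
        (auto intro!: derivative_eq_intros)
    have 2: "open ((\<lambda>t::real. y0 + t *\<^sub>R v) -` S)"
      by (intro open_vimage S continuous_intros)
    have 3: "f (y0 + t *\<^sub>R v) = 0" if "t \<in> (\<lambda>t. y0 + t *\<^sub>R v) -` S" for t
      using that uv tangent[of "y0 + t *\<^sub>R v" u] subspace_scale[OF T] by (simp add: f_def)
    have "(\<lambda>t. f' (t *\<^sub>R v)) = (\<lambda>t::real. 0)"
      by (rule has_derivative_unique_on_open[OF 1 has_derivative_const 2 _ 3]) (use S in auto)
    from fun_cong[OF this, of 1] show ?thesis by (simp add: f'_def algebra_simps)
  qed
  have "G' b *v a = G' a *v b" if ab: "G (\<psi> y0) *v a = a" "G (\<psi> y0) *v b = b" for a b
  proof -
    obtain u v where "u \<in> T" "a = ?D u y0" "v \<in> T" "b = ?D v y0"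
      using onto[OF ab(1)] onto[OF ab(2)] by blast
    then show ?thesis
      using key[of u v] key[of v u] Ck_on_symmetric_second_derivative[OF \<psi> S, of u v] by simp
  qed
  then show ?thesis by (simp add: involutive_at_def)
qed

text \<open>A curve in the affine slice has constant inner product with any \<open>z\<close>
  orthogonal to \<open>S\<close>, so the normal component of its velocity is orthogonal to itself.
  Conversely, straight segments in the slice pull back through the chart to curves in
  \<open>N\<close>.\<close>

lemma submanifold_tangent_slice:
  assumes inj: "inj_on (snd c) (fst c)" and op: "open (snd c ` fst c)" and S: "subspace S"
    and slice: "snd c ` (fst c \<inter> N) = snd c ` fst c \<inter> (+) a ` S" and q: "q \<in> N" "q \<in> fst c"
  shows "submanifold_tangent N c q = S"
proof (intro equalityI subsetI)
  fix v assume "v \<in> submanifold_tangent N c q"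
  then obtain \<gamma> e where \<gamma>: "0 < e" "\<gamma> 0 = q" "\<And>t. \<bar>t\<bar> < e \<Longrightarrow> \<gamma> t \<in> N \<inter> fst c"
    "((snd c \<circ> \<gamma>) has_vector_derivative v) (at 0)"
    unfolding submanifold_tangent_def by blast
  have inS: "snd c (\<gamma> t) - a \<in> S" if "\<bar>t\<bar> < e" for t
  proof -
    have "snd c (\<gamma> t) \<in> (+) a ` S" using \<gamma>(3)[OF that] slice by blast
    then show ?thesis by auto
  qed
  obtain y z where yz: "y \<in> span S" "\<And>w. w \<in> span S \<Longrightarrow> orthogonal z w" "v = y + z"
    using orthogonal_subspace_decomp_exists[of S v] by blast
  have "((\<lambda>t. z \<bullet> (snd c \<circ> \<gamma>) t) has_derivative (\<lambda>t. z \<bullet> (t *\<^sub>R v))) (at 0)"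
    using \<gamma>(4) by (intro has_derivative_inner_right) (simp add: has_vector_derivative_def o_def)
  then have "(\<lambda>t. z \<bullet> (t *\<^sub>R v)) = (\<lambda>t. 0)"
  proof (rule has_derivative_unique_on_open[OF _ has_derivative_const, where S = "{-e<..<e}"])
    show "z \<bullet> (snd c \<circ> \<gamma>) t = z \<bullet> a" if "t \<in> {-e<..<e}" for t
      using yz(2)[OF span_base[OF inS[of t]]] that by (simp add: orthogonal_def inner_diff_right abs_less_iff)
  qed (use \<gamma>(1) in auto)
  from fun_cong[OF this, of 1] have "z \<bullet> z = 0"
    using yz by (simp add: orthogonal_def inner_add_right)
  then have "v \<in> span S" using yz by simp
  then show "v \<in> S" using S span_eq_iff by blast
next
  fix v assume v: "v \<in> S"
  let ?f = "\<lambda>t::real. snd c q + t *\<^sub>R v"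
  have "open (?f -` (snd c ` fst c))" by (intro open_vimage op continuous_intros)
  moreover have "0 \<in> ?f -` (snd c ` fst c)" using q by simp
  ultimately obtain e where e: "e > 0" "ball 0 e \<subseteq> ?f -` (snd c ` fst c)"
    by (meson open_contains_ball)
  define \<gamma> where "\<gamma> = (\<lambda>t. inv_into (fst c) (snd c) (?f t))"
  obtain s where s: "snd c q = a + s" "s \<in> S" using slice q by blast
  have f: "?f t \<in> snd c ` (fst c \<inter> N)" if "\<bar>t\<bar> < e" for t
    unfolding slice
  proof
    show "?f t \<in> snd c ` fst c" using e that by (auto simp: subset_iff)
    have "?f t = a + (s + t *\<^sub>R v)" using s by simp
    then show "?f t \<in> (+) a ` S" using S s v by (metis image_eqI subspace_add subspace_scale)
  qed
  have \<gamma>: "\<gamma> t \<in> N \<inter> fst c" "snd c (\<gamma> t) = ?f t" if "\<bar>t\<bar> < e" for t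
    using f[OF that] inj by (auto simp: \<gamma>_def)
  have eq: "?f t = (snd c \<circ> \<gamma>) t" if "t \<in> {-e<..<e}" for t
    using \<gamma>(2)[of t] that by (simp add: abs_less_iff)
  have Ck: "Ck_on k {-e<..<e} ?f" for k
    by (intro Ck_on_add Ck_on_const Ck_on_scaleR Ck_on_ident open_greaterThanLessThan)
  have "smooth_on {-e<..<e} (snd c \<circ> \<gamma>)"
    unfolding smooth_on_def by (blast intro: Ck_on_cong[OF _ Ck eq] open_greaterThanLessThan)
  moreover have "(?f has_vector_derivative v) (at 0)"
    by (auto intro!: derivative_eq_intros simp: has_vector_derivative_def)
  then have "((snd c \<circ> \<gamma>) has_vector_derivative v) (at 0)"
    by (rule has_vector_derivative_transform_within_open[where S = "{-e<..<e}"]) (use e(1) eq in auto)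
  moreover have "\<gamma> 0 = q" using inj q by (simp add: \<gamma>_def)
  ultimately show "v \<in> submanifold_tangent N c q"
    unfolding submanifold_tangent_def using e(1) \<gamma>(1) by blast
qed

context smooth_manifold
begin

lemma submanifold_tangent_transition_subset:
  assumes c: "c \<in> A" "c' \<in> A" "q \<in> fst c" "q \<in> fst c'" and v: "v \<in> submanifold_tangent N c q"
  shows "transition_jacobian c c' q *v v \<in> submanifold_tangent N c' q"
proof -
  let ?O = "snd c ` (fst c \<inter> fst c')"
  let ?\<tau> = "in_coords c (snd c')"
  obtain \<gamma> e where \<gamma>: "0 < e" "\<gamma> 0 = q" "\<And>t. \<bar>t\<bar> < e \<Longrightarrow> \<gamma> t \<in> N \<inter> fst c"
    "smooth_on {-e<..<e} (snd c \<circ> \<gamma>)" "((snd c \<circ> \<gamma>) has_vector_derivative v) (at 0)"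
    using v unfolding submanifold_tangent_def by blast
  \<comment> \<open>The curve is only known to lie in \<open>fst c\<close>. For short times its
    coordinates stay in the open overlap, and injectivity of the chart brings this back to the
    points of \<open>M\<close>.\<close>
  have "open ({-e<..<e} \<inter> (snd c \<circ> \<gamma>) -` ?O)"
    by (rule continuous_open_preimage[OF smooth_on_imp_continuous[OF \<gamma>(4)] _ overlap_open[OF c(1,2)]]) simp
  moreover have "0 \<in> {-e<..<e} \<inter> (snd c \<circ> \<gamma>) -` ?O" using \<gamma> c by auto
  ultimately obtain d where d: "d > 0" "ball 0 d \<subseteq> {-e<..<e} \<inter> (snd c \<circ> \<gamma>) -` ?O"
    by (meson open_contains_ball)
  then have d_sub: "{-d<..<d} \<subseteq> {-e<..<e}" "(snd c \<circ> \<gamma>) ` {-d<..<d} \<subseteq> ?O"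
    by (auto simp: ball_eq_greaterThanLessThan)
  have d': "\<bar>t\<bar> < e" "snd c (\<gamma> t) \<in> ?O" if "\<bar>t\<bar> < d" for t
    using d that by (auto simp: subset_iff abs_less_iff)
  have in': "\<gamma> t \<in> N \<inter> fst c \<inter> fst c'" if "\<bar>t\<bar> < d" for t
    using \<gamma>(3)[OF d'(1)[OF that]] d'(2)[OF that] inj_onD[OF chart_inj[OF c(1)]] by blast
  have eq: "?\<tau> ((snd c \<circ> \<gamma>) t) = (snd c' \<circ> \<gamma>) t" if "t \<in> {-d<..<d}" for t
    using in'[of t] that c by (auto simp: in_coords_apply)
  have "smooth_on {-d<..<d} (\<lambda>t. ?\<tau> ((snd c \<circ> \<gamma>) t))"
    by (rule smooth_on_compose[OF _ smooth_on_subset[OF \<gamma>(4)] overlap_open[OF c(1,2)] transition_smooth[OF c(1,2)]])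
      (use d_sub in auto)
  then have "smooth_on {-d<..<d} (snd c' \<circ> \<gamma>)"
    by (rule smooth_on_cong[rotated]) (use eq in auto)
  moreover have "((snd c' \<circ> \<gamma>) has_vector_derivative transition_jacobian c c' q *v v) (at 0)"
  proof (rule has_vector_derivative_transform_within_open[where S = "{-d<..<d}"])
    have "(?\<tau> has_derivative (*v) (transition_jacobian c c' q)) (at ((snd c \<circ> \<gamma>) 0))"
      using transition_has_derivative[OF c(1,2)] c \<gamma>(2) by simp
    then show "((\<lambda>t. ?\<tau> ((snd c \<circ> \<gamma>) t)) has_vector_derivative transition_jacobian c c' q *v v) (at 0)"
      using has_derivative_compose[OF \<gamma>(5)[unfolded has_vector_derivative_def]]
      by (fastforce simp: has_vector_derivative_def matrix_scaleR_vector_ac scaleR_matrix_vector_assoc)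
  qed (use d eq in auto)
  ultimately show ?thesis
    unfolding submanifold_tangent_def using d(1) \<gamma>(2) in' by blast
qed

lemma submanifold_tangent_transition:
  assumes c: "c \<in> A" "c' \<in> A" "q \<in> fst c" "q \<in> fst c'"
  shows "submanifold_tangent N c' q = (*v) (transition_jacobian c c' q) ` submanifold_tangent N c q"
proof
  show "submanifold_tangent N c' q \<subseteq> (*v) (transition_jacobian c c' q) ` submanifold_tangent N c q"
  proof
    fix v assume "v \<in> submanifold_tangent N c' q"
    then have "transition_jacobian c' c q *v v \<in> submanifold_tangent N c q"
      using c by (intro submanifold_tangent_transition_subset)
    moreover have "v = transition_jacobian c c' q *v (transition_jacobian c' c q *v v)"
      using transition_jacobian_inverse[OF c(2,1,4,3)] by (simp add: matrix_vector_mul_assoc)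
    ultimately show "v \<in> (*v) (transition_jacobian c c' q) ` submanifold_tangent N c q" by blast
  qed
qed (use submanifold_tangent_transition_subset[OF c] in blast)

end

lemma range_idempotent_matrix:
  assumes "P ** P = P"
  shows "range ((*v) (P :: real^'n^'n)) = {a. P *v a = a}"
  using assms by (auto simp: matrix_vector_mul_assoc) (metis rangeI)

lemma image_range_vector_mult:
  assumes "Q ** J = J ** P" "J ** J' = mat 1"
  shows "(*v) J ` range ((*v) P) = range ((*v) (Q :: real^'n^'n))"
proof -
  have "(*v) J ` range ((*v) P) = (\<lambda>v. Q *v (J *v v)) ` UNIV"
    using assms(1) by (simp add: image_image matrix_vector_mul_assoc)
  also have "\<dots> = (*v) Q ` range ((*v) J)" by (simp add: image_image)
  also have "range ((*v) J) = UNIV"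
    using assms(2) by (metis matrix_vector_mul_assoc matrix_vector_mul_lid surjI)
  finally show ?thesis .
qed

lemma image_distribution_complexify:
  "image_distribution (complexify_tensor Q) c q = complex_hull (range ((*v) (Q c q)))"
  by (simp add: image_distribution_def complexify_tensor_def complex_hull_range)

context smooth_manifold
begin

lemma smooth_tensor_field_transition:
  "smooth_tensor_field A Q \<Longrightarrow> c \<in> A \<Longrightarrow> c' \<in> A \<Longrightarrow> q \<in> fst c \<Longrightarrow> q \<in> fst c' \<Longrightarrow>
    Q c' q ** transition_jacobian c c' q = transition_jacobian c c' q ** Q c q"
  by (auto simp: smooth_tensor_field_def)

text \<open>The slice chart \<open>c'\<close> of an integral manifold need not be the chart
  \<open>c\<close> in which involutivity is claimed; the transition map from \<open>c'\<close> to
  \<open>c\<close> serves as the parametrization \<psi>.\<close>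

lemma involutive_if_integrable:
  assumes Q: "smooth_tensor_field A Q"
    and idem: "\<And>c p. c \<in> A \<Longrightarrow> p \<in> fst c \<Longrightarrow> Q c p ** Q c p = Q c p"
    and int: "integrable_distribution M A (image_distribution (complexify_tensor Q))"
    and c: "c \<in> A" "p \<in> fst c"
  shows "involutive_at (Q c p) (frechet_derivative (in_coords c (Q c)) (at (snd c p)))"
proof -
  obtain N where N: "p \<in> N" "integral_manifold M A (image_distribution (complexify_tensor Q)) N"
    using int c chart_subset[OF c(1)] by (auto simp: integrable_distribution_def)
  then obtain c' S a where c': "c' \<in> A" "p \<in> fst c'" and S: "subspace S"
    and slice: "snd c' ` (fst c' \<inter> N) = snd c' ` fst c' \<inter> (+) a ` S"
    unfolding integral_manifold_def embedded_submanifold_def by metis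
  let ?O = "snd c' ` (fst c' \<inter> fst c)" and ?\<psi> = "in_coords c' (snd c)"
  have range: "range ((*v) (Q c q)) = (*v) (transition_jacobian c' c q) ` S"
    if q: "q \<in> N" "q \<in> fst c" "q \<in> fst c'" for q
  proof -
    have T: "submanifold_tangent N c q = (*v) (transition_jacobian c' c q) ` S"
      using submanifold_tangent_transition[OF c'(1) c(1) q(3,2)]
        submanifold_tangent_slice[OF chart_inj[OF c'(1)] chart_open[OF c'(1)] S slice q(1,3)] by simp
    have "complex_hull (submanifold_tangent N c q) = complex_hull (range ((*v) (Q c q)))"
      using N(2) q c(1) by (simp add: integral_manifold_def image_distribution_complexify)
    moreover have "0 \<in> range ((*v) (Q c q))" by (metis matrix_vector_mult_0_right rangeI)
    moreover have "0 \<in> submanifold_tangent N c q"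
      unfolding T using subspace_0[OF S] by (metis imageI matrix_vector_mult_0_right)
    ultimately show ?thesis using complex_hull_eq_iff T by metis
  qed
  define y0 where "y0 = snd c' p"
  have y0: "y0 \<in> ?O" using c c' by (simp add: y0_def)
  obtain s0 where s0: "y0 = a + s0" "s0 \<in> S"
    using slice c'(2) N(1) unfolding y0_def by blast
  have D\<psi>: "frechet_derivative ?\<psi> (at (snd c' q)) = (*v) (transition_jacobian c' c q)"
    if "q \<in> fst c'" "q \<in> fst c" for q
    using frechet_derivative_at[OF transition_has_derivative[OF c'(1) c(1), of q]] that by simp
  have \<psi>y0: "?\<psi> y0 = snd c p" using c' by (simp add: y0_def in_coords_apply)
  have "involutive_at (in_coords c (Q c) (?\<psi> y0)) (frechet_derivative (in_coords c (Q c)) (at (snd c p)))"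
  proof (rule involutive_at_parametrized[OF overlap_open[OF c'(1) c(1)] y0 _ _ S])
    show "Ck_on (Suc (Suc 0)) ?O ?\<psi>"
      using transition_smooth[OF c'(1) c(1)] unfolding smooth_on_def by blast
    show "(in_coords c (Q c) has_derivative frechet_derivative (in_coords c (Q c)) (at (snd c p))) (at (?\<psi> y0))"
      unfolding \<psi>y0 using Q c by (intro smooth_on_has_derivative[of "snd c ` fst c"]) (auto simp: smooth_tensor_field_def)
    fix a' assume "in_coords c (Q c) (?\<psi> y0) *v a' = a'"
    then have "Q c p *v a' = a'" using c by (simp add: \<psi>y0 in_coords_apply)
    then have "a' \<in> range ((*v) (Q c p))" by (metis rangeI)
    then show "a' \<in> frechet_derivative ?\<psi> (at y0) ` S"
      using range[OF N(1) c(2) c'(2)] D\<psi>[OF c'(2) c(2)] by (simp add: y0_def)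
  next
    fix y u assume y: "y \<in> ?O" "y - y0 \<in> S" and u: "u \<in> S"
    obtain q where q: "y = snd c' q" "q \<in> fst c'" "q \<in> fst c" using y(1) by blast
    \<comment> \<open>The slice \<open>a + S\<close> is also \<open>y0 + S\<close>, so displacement
      from \<open>y0\<close> by an element of \<open>S\<close> stays on \<open>N\<close>.\<close>
    have "y = a + (s0 + (y - y0))" using s0 by simp
    then have "y \<in> snd c' ` fst c' \<inter> (+) a ` S"
      using q s0(2) y(2) subspace_add[OF S] by blast
    then have "q \<in> N" using slice q inj_onD[OF chart_inj[OF c'(1)]] by blast
    then have "frechet_derivative ?\<psi> (at y) u \<in> range ((*v) (Q c q))"
      using range[OF _ q(3,2)] D\<psi>[OF q(2,3)] q(1) u by auto
    then show "in_coords c (Q c) (?\<psi> y) *v frechet_derivative ?\<psi> (at y) u = frechet_derivative ?\<psi> (at y) u"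
      using range_idempotent_matrix[OF idem[OF c(1) q(3)]] q c c' by (simp add: in_coords_apply)
  qed
  then show ?thesis using c by (simp add: \<psi>y0 in_coords_apply)
qed

section \<open>Slice charts and the sufficiency of involutivity\<close>

text \<open>An embedded submanifold has to be flat in a chart of the atlas itself. Composing a chart
  with a local diffeomorphism gives a chart compatible with all others, and maximality of the atlas
  admits it.\<close>

lemma chart_straighten:
  assumes c: "c \<in> A" and U: "open U" "U \<subseteq> snd c ` fst c" and V: "open V"
    and hom: "homeomorphism U V \<kappa> \<eta>" and smooth: "smooth_on U \<kappa>" "smooth_on V \<eta>"
  defines "c0 \<equiv> ({q \<in> fst c. snd c q \<in> U}, \<kappa> \<circ> snd c)"
  shows "c0 \<in> A" "snd c0 ` fst c0 = V" "\<And>y. y \<in> V \<Longrightarrow> in_coords c0 (snd c) y = \<eta> y"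
proof -
  have img: "snd c ` fst c0 = U" using U(2) by (auto simp: c0_def)
  show V_eq: "snd c0 ` fst c0 = V"
  proof -
    have "snd c0 ` fst c0 = \<kappa> ` snd c ` fst c0" by (auto simp: c0_def)
    then show ?thesis using hom img by (simp add: homeomorphism_def)
  qed
  have fst_sub: "fst c0 \<subseteq> fst c" by (auto simp: c0_def)
  have inj: "inj_on (snd c0) (fst c0)"
  proof (rule inj_onI)
    fix x y assume "x \<in> fst c0" "y \<in> fst c0" "snd c0 x = snd c0 y"
    then have "snd c x = snd c y" using homeomorphism_apply1[OF hom] by (auto simp: c0_def) metis
    then show "x = y" using chart_inj[OF c] fst_sub \<open>x \<in> fst c0\<close> \<open>y \<in> fst c0\<close> by (auto dest: inj_onD)
  qed
  have apply_c0: "in_coords c0 f (snd c0 q) = f q" if "q \<in> fst c0" for f :: "'m \<Rightarrow> 'b" and q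
    using that inj by (simp add: in_coords_def)
  show \<eta>: "in_coords c0 (snd c) y = \<eta> y" if "y \<in> V" for y
  proof -
    obtain q where "q \<in> fst c0" "y = snd c0 q" using V_eq \<open>y \<in> V\<close> by blast
    then show ?thesis using apply_c0 homeomorphism_apply1[OF hom] by (auto simp: c0_def)
  qed
  have chart: "is_chart M c0"
    unfolding is_chart_def
  proof (intro conjI)
    show op: "openin M (fst c0)" using chart_vimage_openin[OF c U(1)] by (simp add: c0_def)
    show "open (snd c0 ` fst c0)" by (simp add: V_eq V)
    have "homeomorphic_map (subtopology (subtopology M (fst c)) (fst c0))
        (subtopology (top_of_set (snd c ` fst c)) U) (snd c)"
      by (rule homeomorphic_map_subtopologies[OF chart_homeo[OF c]])
        (use img fst_sub U(2) chart_subset[OF c] in \<open>auto simp: inf.absorb2 inf.absorb1\<close>)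
    then have 1: "homeomorphic_map (subtopology M (fst c0)) (top_of_set U) (snd c)"
      using fst_sub U(2) by (simp add: subtopology_subtopology inf.absorb2)
    have 2: "homeomorphic_map (top_of_set U) (top_of_set V) \<kappa>"
      using hom by (auto simp: homeomorphic_map_maps homeomorphic_maps_def homeomorphism_def)
    show "homeomorphic_map (subtopology M (fst c0)) (top_of_set (snd c0 ` fst c0)) (snd c0)"
      using homeomorphic_map_compose[OF 1 2] by (simp add: V_eq) (simp add: c0_def)
  qed
  have "compatible c0 c'" if c': "c' \<in> A" for c'
    unfolding compatible_def
  proof
    let ?O = "snd c ` (fst c0 \<inter> fst c')" and ?O' = "snd c' ` (fst c0 \<inter> fst c')"
    have op: "openin M (fst c0 \<inter> fst c')"
      using chart chart_openin[OF c'] by (simp add: is_chart_def openin_Int)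
    have O: "open ?O" by (rule chart_image_open[OF c op]) (use fst_sub in auto)
    have O': "open ?O'" by (rule chart_image_open[OF c' op]) auto
    have "snd c0 ` (fst c0 \<inter> fst c') = V \<inter> \<eta> -` ?O"
      using hom img V_eq by (auto simp: c0_def homeomorphism_def) 
    then have O0: "open (snd c0 ` (fst c0 \<inter> fst c'))"
      using continuous_open_preimage[OF smooth_on_imp_continuous[OF smooth(2)] V O] by simp
    have "smooth_on (snd c0 ` (fst c0 \<inter> fst c')) (\<lambda>y. in_coords c (snd c') (\<eta> y))"
    proof (rule smooth_on_compose[where g = "in_coords c (snd c')" and f = \<eta>, OF O0 _ O])
      show "smooth_on (snd c0 ` (fst c0 \<inter> fst c')) \<eta>"
        by (rule smooth_on_subset[OF smooth(2)]) (use V_eq in auto)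
      show "smooth_on ?O (in_coords c (snd c'))"
        by (rule smooth_on_subset[OF transition_smooth[OF c c']]) (use fst_sub in auto)
      show "\<eta> ` snd c0 ` (fst c0 \<inter> fst c') \<subseteq> ?O"
        using homeomorphism_apply1[OF hom] by (auto simp: c0_def)
    qed
    then show "smooth_on (snd c0 ` (fst c0 \<inter> fst c')) (in_coords c0 (snd c'))"
    proof (rule smooth_on_cong[OF O0])
      fix y assume "y \<in> snd c0 ` (fst c0 \<inter> fst c')"
      then obtain q where q: "q \<in> fst c0" "q \<in> fst c'" "y = snd c0 q" by blast
      then have "\<eta> y = snd c q" using homeomorphism_apply1[OF hom] by (auto simp: c0_def)
      then show "in_coords c (snd c') (\<eta> y) = in_coords c0 (snd c') y"
        using q fst_sub c by (auto simp: apply_c0 in_coords_apply)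
    qed
    have "smooth_on ?O' (\<lambda>y. \<kappa> (in_coords c' (snd c) y))"
    proof (rule smooth_on_compose[where g = \<kappa> and f = "in_coords c' (snd c)", OF O' _ U(1) smooth(1)])
      show "smooth_on ?O' (in_coords c' (snd c))"
        by (rule smooth_on_subset[OF transition_smooth[OF c' c]]) (use fst_sub in auto)
      show "in_coords c' (snd c) ` ?O' \<subseteq> U" using c' by (auto simp: in_coords_apply c0_def)
    qed
    then show "smooth_on (snd c' ` (fst c0 \<inter> fst c')) (in_coords c' (snd c0))"
      by (rule smooth_on_cong[OF O']) (use c' in \<open>auto simp: in_coords_apply c0_def\<close>)
  qed
  with chart show "c0 \<in> A" by (rule maximal)
qed

text \<open>The integral manifold is the linear slice of the straightened chart \<open>c0\<close>.
  Its tangent space is read off in \<open>c0\<close>, carried to \<open>c\<close> by the derivative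
  of \<eta>, and to an arbitrary chart by the transformation law of the tensor
  \<open>Q\<close>.\<close>

lemma integrable_if_involutive:
  assumes Q: "smooth_tensor_field A Q"
    and idem: "\<And>c p. c \<in> A \<Longrightarrow> p \<in> fst c \<Longrightarrow> Q c p ** Q c p = Q c p"
    and inv: "\<And>c p. c \<in> A \<Longrightarrow> p \<in> fst c \<Longrightarrow>
      involutive_at (Q c p) (frechet_derivative (in_coords c (Q c)) (at (snd c p)))"
  shows "integrable_distribution M A (image_distribution (complexify_tensor Q))"
  unfolding integrable_distribution_def
proof
  fix p assume "p \<in> topspace M"
  then obtain c where c: "c \<in> A" "p \<in> fst c" using covers by blast
  let ?G = "in_coords c (Q c)" and ?S = "range ((*v) (Q c p))"
  have Gp: "?G (snd c p) = Q c p" using c by (simp add: in_coords_apply)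
  obtain U V \<kappa> \<eta> where UV: "open U" "snd c p \<in> U" "U \<subseteq> snd c ` fst c" "open V" "homeomorphism U V \<kappa> \<eta>"
    "smooth_on U \<kappa>" "smooth_on V \<eta>" "\<kappa> (snd c p) \<in> ?S"
    "\<And>y. y \<in> V \<Longrightarrow> y \<in> ?S \<Longrightarrow> frechet_derivative \<eta> (at y) ` ?S = range ((*v) (?G (\<eta> y)))"
  proof (rule frobenius_straightening[OF chart_open[OF c(1)], of "snd c p" ?G, unfolded Gp])
    show "snd c p \<in> snd c ` fst c" using c by simp
    show "smooth_on (snd c ` fst c) ?G" using Q c by (simp add: smooth_tensor_field_def)
    show "?G y ** ?G y = ?G y" if "y \<in> snd c ` fst c" for y
      using that c(1) idem[OF c(1)] by (auto simp: in_coords_apply)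
    show "involutive_at (?G y) (frechet_derivative ?G (at y))" if "y \<in> snd c ` fst c" for y
      using that c(1) inv[OF c(1)] by (auto simp: in_coords_apply)
  qed blast
  define c0 where "c0 = ({q \<in> fst c. snd c q \<in> U}, \<kappa> \<circ> snd c)"
  note c0 = chart_straighten[OF c(1) UV(1,3-7), folded c0_def]
  \<comment> \<open>The slice is the subspace itself, with offset 0, because \<kappa> sends the base
    point into the range of \<open>Q c p\<close>.\<close>
  define N where "N = {q \<in> fst c0. snd c0 q \<in> ?S}"
  have sub: "fst c0 \<subseteq> fst c" by (auto simp: c0_def)
  have S: "subspace ?S"
    by (rule linear_subspace_image[OF _ subspace_UNIV]) simp
  have slice: "snd c0 ` (fst c0 \<inter> N) = snd c0 ` fst c0 \<inter> (+) 0 ` ?S"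
    by (auto simp: N_def)
  have "embedded_submanifold M A (dim ?S) N"
    unfolding embedded_submanifold_def
  proof (intro conjI ballI)
    show "N \<subseteq> topspace M" using chart_subset[OF c0(1)] by (auto simp: N_def)
    show "\<exists>c\<in>A. q \<in> fst c \<and> (\<exists>S a. subspace S \<and> dim S = dim ?S \<and>
        snd c ` (fst c \<inter> N) = snd c ` fst c \<inter> (+) a ` S)" if "q \<in> N" for q
      using that c0(1)
      by (intro bexI[of _ c0] conjI exI[of _ ?S] exI[of _ 0] S slice refl) (simp_all add: N_def)
  qed
  moreover have "complex_hull (submanifold_tangent N c' q) = image_distribution (complexify_tensor Q) c' q"
    if q: "c' \<in> A" "q \<in> N" "q \<in> fst c'" for c' q
  proof -
    have q0: "q \<in> fst c0" "q \<in> fst c" "snd c0 q \<in> ?S" "snd c0 q \<in> V"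
      using q(2) sub c0(2) by (auto simp: N_def)
    have \<eta>q: "\<eta> (snd c0 q) = snd c q"
      using c0(3)[OF q0(4)] q0 c0(1) by (simp add: in_coords_apply)
    have "(\<eta> has_derivative (*v) (transition_jacobian c0 c q)) (at (snd c0 q))"
      by (rule has_derivative_transform_within_open[OF transition_has_derivative[OF c0(1) c(1)] UV(4) q0(4)])
        (use q0 c0(3) in auto)
    then have "(*v) (transition_jacobian c0 c q) = frechet_derivative \<eta> (at (snd c0 q))"
      by (rule frechet_derivative_at)
    then have "(*v) (transition_jacobian c0 c q) ` ?S = range ((*v) (Q c q))"
      using UV(9)[OF q0(4,3)] q0 c by (simp add: \<eta>q in_coords_apply)
    then have "submanifold_tangent N c q = range ((*v) (Q c q))"
      using submanifold_tangent_transition[OF c0(1) c(1) q0(1,2), of N]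
        submanifold_tangent_slice[OF chart_inj[OF c0(1)] chart_open[OF c0(1)] S slice q(2) q0(1)] by simp
    then have "submanifold_tangent N c' q = range ((*v) (Q c' q))"
      using submanifold_tangent_transition[OF c(1) q(1) q0(2) q(3), of N]
        image_range_vector_mult[OF smooth_tensor_field_transition[OF Q c(1) q(1) q0(2) q(3)]
          transition_jacobian_inverse[OF q(1) c(1) q(3) q0(2)]] by simp
    then show ?thesis by (simp add: image_distribution_complexify)
  qed
  moreover have "p \<in> N" using c UV(2,8) by (simp add: N_def c0_def)
  ultimately show "\<exists>N. p \<in> N \<and> integral_manifold M A (image_distribution (complexify_tensor Q)) N"
    unfolding integral_manifold_def by blast
qed

theorem integrable_iff_involutive:
  assumes "smooth_tensor_field A Q"
    and "\<And>c p. c \<in> A \<Longrightarrow> p \<in> fst c \<Longrightarrow> Q c p ** Q c p = Q c p"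
  shows "integrable_distribution M A (image_distribution (complexify_tensor Q)) \<longleftrightarrow>
    (\<forall>c\<in>A. \<forall>p\<in>fst c. involutive_at (Q c p) (frechet_derivative (in_coords c (Q c)) (at (snd c p))))"
  using involutive_if_integrable[OF assms] integrable_if_involutive[OF assms] by blast

end

section \<open>The Nijenhuis tensor in coordinates\<close>

text \<open>The part of the coordinate expression of N_F(X,Y) that contains the derivative of
  \<open>F\<close>, for fields with the values \<open>a\<close> and \<open>b\<close>.\<close>

definition nijenhuis_form ::
    "real^'n^'n \<Rightarrow> (real^'n \<Rightarrow> real^'n^'n) \<Rightarrow> real^'n \<Rightarrow> real^'n \<Rightarrow> real^'n" where
  "nijenhuis_form F F' a b = F' (F *v a) *v b - F' (F *v b) *v a - F *v (F' a *v b) + F *v (F' b *v a)"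

lemma bounded_linear_cvec: "bounded_linear (cvec :: real^'n \<Rightarrow> complex^'n)"
  by (rule linear_conv_bounded_linear[THEN iffD1], rule linearI)
    (simp_all add: cvec_def vec_eq_iff, simp add: scaleR_conv_of_real)

lemma cvec_sum: "cvec (\<Sum>i\<in>I. f i) = (\<Sum>i\<in>I. cvec (f i))"
  using linear_sum[OF bounded_linear.linear[OF bounded_linear_cvec]] .

context smooth_manifold
begin

text \<open>Because \<open>cvec\<close> is linear, the coordinate sum collapses to one real
  derivative. Since only \<open>Y\<close> is differentiated, its representation must hold on the
  chart domain, that of \<open>X\<close> at \<open>p\<close> alone.\<close>

lemma directional_cvec:
  assumes c: "c \<in> A" "p \<in> fst c"
    and XY: "X c p = cvec u" "\<And>q. q \<in> fst c \<Longrightarrow> Y c q = cvec (b (snd c q))"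
    and b: "(b has_derivative b') (at (snd c p))"
  shows "directional X Y c p = cvec (b' u)"
proof -
  have "((\<lambda>y. cvec (b y)) has_derivative (\<lambda>v. cvec (b' v))) (at (snd c p))"
    by (rule bounded_linear.has_derivative[OF bounded_linear_cvec b])
  then have "(in_coords c (Y c) has_derivative (\<lambda>v. cvec (b' v))) (at (snd c p))"
    by (rule has_derivative_transform_within_open[OF _ chart_open[OF c(1)]])
      (use c XY(2) in \<open>auto simp: in_coords_apply\<close>)
  then have "frechet_derivative (in_coords c (Y c)) (at (snd c p)) = (\<lambda>v. cvec (b' v))"
    using frechet_derivative_at by metis
  then have "directional X Y c p = (\<Sum>j\<in>UNIV. cvec (u $ j *\<^sub>R b' (axis j 1)))"
    by (simp add: directional_def XY(1) cvec_scaleR) (simp add: cvec_def)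
  also have "\<dots> = cvec (b' u)"
  proof -
    interpret linear b' using b by (rule has_derivative_linear)
    have "b' u = (\<Sum>j\<in>UNIV. u $ j *\<^sub>R b' (axis j 1))"
      by (subst basis_expansion[of u, symmetric]) (simp add: sum scale scalar_mult_eq_scaleR)
    then show ?thesis by (simp add: cvec_sum)
  qed
  finally show ?thesis .
qed

lemma lie_bracket_cvec:
  assumes c: "c \<in> A" "p \<in> fst c"
    and X: "\<And>q. q \<in> fst c \<Longrightarrow> X c q = cvec (a (snd c q))" "(a has_derivative a') (at (snd c p))"
    and Y: "\<And>q. q \<in> fst c \<Longrightarrow> Y c q = cvec (b (snd c q))" "(b has_derivative b') (at (snd c p))"
  shows "lie_bracket X Y c p = cvec (b' (a (snd c p)) - a' (b (snd c p)))"
  using directional_cvec[where X = X and Y = Y and c = c and p = p and b = b and b' = b', OF c X(1)[OF c(2)] Y]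
    directional_cvec[where X = Y and Y = X and c = c and p = p and b = a and b' = a', OF c Y(1)[OF c(2)] X]
  by (simp add: lie_bracket_def cvec_diff)

lemma apply_complexify_tensor:
  assumes "X c q = cvec v"
  shows "apply_tensor (complexify_tensor F) X c q = cvec (F c q *v v)"
  using assms by (simp add: apply_tensor_def complexify_tensor_def complexify_matrix_mult_cvec)

text \<open>Tensoriality in coordinates: the terms with the derivatives \<open>a'\<close> and
  \<open>b'\<close> of the fields cancel in pairs among the four brackets.\<close>

lemma nijenhuis_complexify:
  assumes c: "c \<in> A" "p \<in> fst c"
    and F: "(in_coords c (F c) has_derivative F') (at (snd c p))"
    and X: "\<And>q. q \<in> fst c \<Longrightarrow> X c q = cvec (a (snd c q))" "(a has_derivative a') (at (snd c p))"
    and Y: "\<And>q. q \<in> fst c \<Longrightarrow> Y c q = cvec (b (snd c q))" "(b has_derivative b') (at (snd c p))"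
  shows "nijenhuis (complexify_tensor F) X Y c p
    = cvec (nijenhuis_form (F c p) F' (a (snd c p)) (b (snd c p)))"
proof -
  let ?G = "in_coords c (F c)" and ?T = "apply_tensor (complexify_tensor F)" and ?x = "snd c p"
  have Gp: "?G ?x = F c p" using c by (simp add: in_coords_apply)
  have FX: "?T X c q = cvec (?G (snd c q) *v a (snd c q))"
    and FY: "?T Y c q = cvec (?G (snd c q) *v b (snd c q))" if "q \<in> fst c" for q
    using that X(1) Y(1) c(1) by (auto simp: apply_complexify_tensor in_coords_apply)
  have Fa: "((\<lambda>y. ?G y *v a y) has_derivative (\<lambda>v. F c p *v a' v + F' v *v a ?x)) (at ?x)"
    and Fb: "((\<lambda>y. ?G y *v b y) has_derivative (\<lambda>v. F c p *v b' v + F' v *v b ?x)) (at ?x)"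
    using bounded_bilinear.FDERIV[OF bounded_bilinear_matrix_vector_mult F X(2)]
      bounded_bilinear.FDERIV[OF bounded_bilinear_matrix_vector_mult F Y(2)] by (simp_all add: Gp)
  let ?Ga = "\<lambda>y. ?G y *v a y" and ?Gb = "\<lambda>y. ?G y *v b y"
  note bracket = lie_bracket_cvec[where c = c and p = p, OF c]
  have 1: "lie_bracket (?T X) (?T Y) c p = cvec ((F c p *v b' (F c p *v a ?x) + F' (F c p *v a ?x) *v b ?x)
      - (F c p *v a' (F c p *v b ?x) + F' (F c p *v b ?x) *v a ?x))"
    using bracket[where X = "?T X" and Y = "?T Y" and a = ?Ga and b = ?Gb, OF FX Fa FY Fb] by (simp add: Gp)
  have 2: "lie_bracket (?T X) Y c p = cvec (b' (F c p *v a ?x) - (F c p *v a' (b ?x) + F' (b ?x) *v a ?x))"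
    using bracket[where X = "?T X" and Y = Y and a = ?Ga and b = b, OF FX Fa Y] by (simp add: Gp)
  have 3: "lie_bracket X (?T Y) c p = cvec ((F c p *v b' (a ?x) + F' (a ?x) *v b ?x) - a' (F c p *v b ?x))"
    using bracket[where X = X and Y = "?T Y" and a = a and b = ?Gb, OF X FY Fb] by (simp add: Gp)
  have 4: "lie_bracket X Y c p = cvec (b' (a ?x) - a' (b ?x))"
    using bracket[where X = X and Y = Y and a = a and b = b, OF X Y] .
  note T = apply_complexify_tensor[where c = c and q = p and F = F]
  show ?thesis
    unfolding nijenhuis_def 1 T[where X = "lie_bracket (?T X) Y", OF 2] T[where X = "lie_bracket X (?T Y)", OF 3]
      T[where X = "?T (lie_bracket X Y)", OF T[where X = "lie_bracket X Y", OF 4]] cvec_add[symmetric] cvec_diff[symmetric] cvec_eq_iff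
    by (simp add: nijenhuis_form_def matrix_vector_right_distrib matrix_vector_mult_diff_distrib)
qed

end

text \<open>Only the two components \<open>(1 - L) N(L a, L b)\<close> and \<open>N((1 - L) a, (1 - L) b)\<close> of the identity
  survive; they lie in complementary subspaces.\<close>

lemma nijenhuis_identity_iff_involutive:
  fixes F L :: "real^'n^'n" and F' L' :: "real^'n \<Rightarrow> real^'n^'n"
  assumes lin: "linear F'" "linear L'"
    and LL: "L ** L = L" and FL: "F ** L = F" and LF: "L ** F = F"
    and ker: "\<And>z. F *v z = 0 \<Longrightarrow> L *v z = 0"
    and range: "\<And>w. L *v w = w \<Longrightarrow> \<exists>u. w = F *v u"
    and D1: "\<And>w. F' w = L ** F' w + L' w ** F"
    and D2: "\<And>w. F' w = F ** L' w + F' w ** L"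
    and D3: "\<And>w. L' w = L ** L' w + L' w ** L"
  defines "N \<equiv> nijenhuis_form F F'" and "m \<equiv> mat 1 - L"
  shows "(\<forall>a b. N a b = L *v N (L *v a) (L *v b) + N (L *v a) (m *v b) + N (m *v a) (L *v b)) \<longleftrightarrow>
    involutive_at L L' \<and> involutive_at m (\<lambda>w. - L' w)"
proof -
  note dist = matrix_vector_right_distrib matrix_vector_mult_diff_distrib
    matrix_vector_mult_add_rdistrib matrix_vector_mult_diff_rdistrib
    linear_add[OF lin(1)] linear_diff[OF lin(1)] linear_add[OF lin(2)] linear_diff[OF lin(2)]
  have m: "m *v v = v - L *v v" for v by (simp add: m_def dist)
  have LL: "L *v (L *v v) = L *v v" and FL: "F *v (L *v v) = F *v v" and LF: "L *v (F *v v) = F *v v" for v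
    by (simp_all add: matrix_vector_mul_assoc LL FL LF)
  have D1: "F' w *v v = L *v (F' w *v v) + L' w *v (F *v v)"
    and D2: "F' w *v v = F *v (L' w *v v) + F' w *v (L *v v)"
    and D3: "L' w *v v = L *v (L' w *v v) + L' w *v (L *v v)" for w v
    using D1[of w] D2[of w] D3[of w] by (metis matrix_vector_mul_assoc matrix_vector_mult_add_rdistrib)+
  have "N (a + a') b = N a b + N a' b" "N a (b + b') = N a b + N a b'" for a a' b b'
    by (simp_all add: N_def nijenhuis_form_def dist)
  then have split: "N a b = N (L *v a) (L *v b) + N (L *v a) (m *v b) + N (m *v a) (L *v b) + N (m *v a) (m *v b)" for a b
    by (metis (no_types, opaque_lifting) add.assoc add.commute add_diff_cancel_left' diff_add_cancel m)
  \<comment> \<open>For fields, \<open>S\<close> is m [F X, F Y] and \<open>T\<close> is - l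
    [m X, m Y]: both are written with \<open>L'\<close> only, using (1 - l) D_X(l Y) = L'(X) (l Y)
    and its counterpart for m.\<close>
  define S T where "S = (\<lambda>a b. L' (F *v a) *v (F *v b) - L' (F *v b) *v (F *v a))"
    and "T = (\<lambda>a b. L' (m *v a) *v (m *v b) - L' (m *v b) *v (m *v a))"
  have S: "m *v N (L *v a) (L *v b) = S a b" for a b
  proof -
    have 1: "m *v (F *v v) = 0" for v by (simp add: m LF)
    have 2: "m *v (F' w *v (L *v v)) = L' w *v (F *v v)" for w v
      using D1[of w "L *v v"] unfolding m FL by (metis add_diff_cancel_left')
    show ?thesis by (simp add: N_def nijenhuis_form_def S_def FL dist 1 2)
  qed
  have Fm: "F *v (m *v v) = 0" for v by (simp add: m FL dist)
  have T: "N (m *v a) (m *v b) = - (F *v (F *v T a b))" for a b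
  proof -
    have "F' w *v (m *v v) = F *v (L' w *v (m *v v))" for w v
      using D2[of w "m *v v"] by (simp add: m LL dist)
    then show ?thesis
      using linear_0[OF lin(1)] by (simp add: N_def nijenhuis_form_def T_def Fm dist)
  qed
  have LT: "L *v T a b = T a b" for a b
  proof -
    have "L' w *v (m *v v) = L *v (L' w *v (m *v v))" for w v
      using D3[of w "m *v v"] by (simp add: m LL dist)
    then show ?thesis by (simp add: T_def dist)
  qed
  have LS: "L *v S a b = 0" for a b
    unfolding S[symmetric] by (simp add: m dist LL)
  have "N a b = L *v N (L *v a) (L *v b) + N (L *v a) (m *v b) + N (m *v a) (L *v b)
    \<longleftrightarrow> S a b = F *v (F *v T a b)" for a b
  proof -
    have "N (L *v a) (L *v b) = L *v N (L *v a) (L *v b) + S a b"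
      unfolding S[symmetric] m by simp
    then have "N a b = (L *v N (L *v a) (L *v b) + N (L *v a) (m *v b) + N (m *v a) (L *v b))
      + (S a b - F *v (F *v T a b))"
      using split[of a b] unfolding T by (simp add: algebra_simps)
    then show ?thesis by (metis add_cancel_right_right right_minus_eq)
  qed
  moreover have "S a b = F *v (F *v T a b) \<longleftrightarrow> S a b = 0 \<and> T a b = 0" for a b
  proof
    assume eq: "S a b = F *v (F *v T a b)"
    then have "S a b = L *v S a b" by (simp add: LF)
    then have S0: "S a b = 0" by (simp add: LS)
    \<comment> \<open>The hypothesis \<open>ker\<close> is applied twice, once for each factor
      \<open>F\<close>. Between the applications L F = F strips the projection, and at the end L T =
      T gives T = 0.\<close>
    then have "L *v (F *v T a b) = 0" using eq by (intro ker) simp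
    then have "L *v T a b = 0" by (intro ker) (simp add: LF)
    then show "S a b = 0 \<and> T a b = 0" using S0 LT[of a b] by simp
  qed simp
  \<comment> \<open>By \<open>range\<close> the vectors \<open>F *v a\<close> exhaust those fixed by
    \<open>L\<close>, so quantifying over \<open>a\<close> and \<open>b\<close> here covers all
    pairs in the distribution.\<close>
  moreover have "(\<forall>a b. S a b = 0) \<longleftrightarrow> involutive_at L L'"
    using LF range unfolding S_def involutive_at_def by (metis eq_iff_diff_eq_0)
  moreover have "(\<forall>a b. T a b = 0) \<longleftrightarrow> involutive_at m (\<lambda>w. - L' w)"
  proof -
    have mm: "m *v (m *v v) = m *v v" for v by (simp add: m LL dist)
    have neg: "(- P) *v v = - (P *v v)" for P :: "real^'n^'n" and v
      using matrix_vector_mult_diff_rdistrib[of 0 P v] by simp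
    show ?thesis
      unfolding T_def involutive_at_def neg neg_equal_iff_equal
      using mm by (metis eq_iff_diff_eq_0)
  qed
  ultimately show ?thesis by blast
qed

section \<open>Vector fields with a prescribed value\<close>

context smooth_manifold
begin

text \<open>Closed in all of \<open>M\<close>, not merely in the chart domain: the set is a
  homeomorphic image of a compact ball and \<open>M\<close> is Hausdorff. This keeps the support of
  a bump function away from the boundary of the chart.\<close>

lemma chart_cball_closedin:
  assumes c: "c \<in> A" and r: "cball x r \<subseteq> snd c ` fst c"
  shows "closedin M {q \<in> fst c. snd c q \<in> cball x r}"
proof -
  let ?U = "subtopology M (fst c)"
  obtain g where g: "homeomorphic_maps ?U (top_of_set (snd c ` fst c)) (snd c) g"
    using chart_homeo[OF c] homeomorphic_map_maps by blast
  have gk: "g (snd c q) = q" if "q \<in> fst c" for q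
    using g that chart_subset[OF c] by (auto simp: homeomorphic_maps_def)
  have "compactin (top_of_set (snd c ` fst c)) (cball x r)"
    using r by (simp add: compactin_subtopology)
  then have "compactin ?U (g ` cball x r)"
    using g by (intro image_compactin) (auto simp: homeomorphic_maps_def)
  moreover have "g ` cball x r = {q \<in> fst c. snd c q \<in> cball x r}"
  proof (intro equalityI subsetI)
    fix q assume "q \<in> g ` cball x r"
    then obtain y where y: "y \<in> cball x r" "q = g y" by blast
    then obtain q' where q': "q' \<in> fst c" "y = snd c q'" using r by blast
    then have "q = q'" using y(2) gk by simp
    then show "q \<in> {q \<in> fst c. snd c q \<in> cball x r}" using q' y(1) by blast
  next
    fix q assume "q \<in> {q \<in> fst c. snd c q \<in> cball x r}"
    then show "q \<in> g ` cball x r" using gk[of q] by (intro image_eqI[of q g "snd c q"]) simp_all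
  qed
  ultimately have "compactin M {q \<in> fst c. snd c q \<in> cball x r}"
    by (simp add: compactin_subtopology)
  then show ?thesis by (rule compactin_imp_closedin[OF Hausdorff])
qed

lemma global_vector_field_through:
  assumes c: "c \<in> A" "p \<in> fst c"
  obtains X where "smooth_vector_field A X" "X c p = v"
proof -
  define x0 where "x0 = snd c p"
  obtain r where r: "r > 0" "cball x0 r \<subseteq> snd c ` fst c"
    using chart_open[OF c(1)] c(2) open_contains_cball[of "snd c ` fst c"] unfolding x0_def by blast
  \<comment> \<open>A smooth bump, positive exactly on the open ball of radius \<open>r\<close>
    about \<open>x0\<close>.\<close>
  define \<rho> where "\<rho> = (\<lambda>y. flat_exp 0 (r\<^sup>2 - (y - x0) \<bullet> (y - x0)))"
  have \<rho>_Ck: "Ck_on k UNIV \<rho>" for k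
    unfolding \<rho>_def
    by (rule Ck_on_compose[OF open_UNIV _ open_UNIV Ck_on_flat_exp])
      (auto intro!: Ck_on_diff Ck_on_bilinear[OF _ bounded_bilinear_inner] Ck_on_ident)
  have \<rho>_0: "\<rho> y = 0" if "y \<notin> cball x0 r" for y
  proof -
    have "r < norm (y - x0)" using that by (simp add: dist_norm norm_minus_commute)
    then have "r\<^sup>2 < (norm (y - x0))\<^sup>2" using r(1) by (intro power_strict_mono) auto
    then show ?thesis by (simp add: \<rho>_def flat_exp_def power2_norm_eq_inner)
  qed
  have \<rho>_x0: "\<rho> x0 \<noteq> 0" using r(1) by (simp add: \<rho>_def flat_exp_def)
  \<comment> \<open>Rescaled so that the bump factor at \<open>x0\<close> cancels and the field
    takes the value \<open>v\<close> at \<open>p\<close>.\<close>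
  define w where "w = (1 / \<rho> x0) *\<^sub>R v"
  define X where "X = (\<lambda>c' q. if q \<in> fst c then \<rho> (snd c q) *\<^sub>R (transition_jacobian c c' q *v w) else 0)"
  have "smooth_on (snd c' ` fst c') (in_coords c' (X c'))" if c': "c' \<in> A" for c'
  proof -
    \<comment> \<open>Smoothness is checked on two open sets covering the image of
      \<open>c'\<close>: the overlap with \<open>c\<close>, where the field is given by the formula,
      and the complement of the closed set \<open>?B\<close>, where it is zero.\<close>
    let ?B = "{q \<in> fst c. snd c q \<in> cball x0 r}"
    let ?O = "snd c' ` (fst c' \<inter> fst c)" and ?O' = "snd c' ` (fst c' - ?B)"
    have O: "open ?O" by (rule overlap_open[OF c' c(1)])
    have "openin M (fst c' - ?B)"
      by (intro openin_diff chart_openin c' chart_cball_closedin c r)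
    then have O': "open ?O'" by (intro chart_image_open[OF c']) auto
    have "smooth_on ?O (in_coords c' (X c'))"
      unfolding smooth_on_def
    proof
      fix k
      let ?\<tau> = "in_coords c' (snd c)" and ?J = "in_coords c (\<lambda>q. transition_jacobian c c' q *v w)"
      have \<tau>: "Ck_on k ?O ?\<tau>" using transition_smooth[OF c' c(1)] by (simp add: smooth_on_def)
      have 1: "Ck_on k ?O (\<lambda>y. \<rho> (?\<tau> y))"
        by (rule Ck_on_compose[OF O \<tau> open_UNIV \<rho>_Ck]) simp
      have 2: "Ck_on k ?O (\<lambda>y. ?J (?\<tau> y))"
      proof (rule Ck_on_compose[OF O \<tau> overlap_open[OF c(1) c']])
        show "Ck_on k (snd c ` (fst c \<inter> fst c')) ?J"
          using transition_jacobian_smooth[OF c(1) c'] by (simp add: smooth_on_def)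
        show "?\<tau> ` ?O \<subseteq> snd c ` (fst c \<inter> fst c')" using c' by (auto simp: in_coords_apply)
      qed
      show "Ck_on k ?O (in_coords c' (X c'))"
        by (rule Ck_on_cong[OF O Ck_on_scaleR[OF O 1 2]]) (use c(1) c' in \<open>auto simp: X_def in_coords_apply\<close>)
    qed
    moreover have "smooth_on ?O' (in_coords c' (X c'))"
    proof (rule smooth_on_cong[OF O', of "\<lambda>y. 0"])
      fix y assume "y \<in> ?O'"
      then obtain q where q: "y = snd c' q" "q \<in> fst c'" "q \<notin> ?B" by blast
      then have "X c' q = 0" using \<rho>_0[of "snd c q"] by (cases "q \<in> fst c") (simp_all add: X_def)
      then show "0 = in_coords c' (X c') y" using c' q by (simp add: in_coords_apply)
    qed (simp add: smooth_on_def)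
    ultimately have "smooth_on (?O \<union> ?O') (in_coords c' (X c'))" by (rule smooth_on_Un[OF O O'])
    moreover have "?O \<union> ?O' = snd c' ` fst c'" by blast
    ultimately show ?thesis by simp
  qed
  moreover have "X c'' q = transition_jacobian c' c'' q *v X c' q"
    if "c' \<in> A" "c'' \<in> A" "q \<in> fst c' \<inter> fst c''" for c' c'' q
    using transition_jacobian_cocycle[OF c(1) that(1,2), of q] that(3)
    by (cases "q \<in> fst c") (simp_all add: X_def matrix_vector_mult_scaleR matrix_vector_mul_assoc)
  ultimately have "smooth_vector_field A X" unfolding smooth_vector_field_def by blast
  moreover have "X c p = \<rho> x0 *\<^sub>R w"
    using c(2) by (simp only: X_def x0_def if_True transition_jacobian_self[OF c] matrix_vector_mul_lid)
  then have "X c p = v" using \<rho>_x0 by (simp add: w_def)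
  ultimately show thesis by (rule that)
qed

end

section \<open>Reality of the projection l\<close>

lemma matpow_commute: "matpow B k ** B = B ** matpow B k"
  by (induction k) (simp_all add: matrix_mul_assoc[symmetric])

lemma matpow_intertwine:
  assumes "(B :: real^'n^'n) ** J = J ** C" shows "matpow B k ** J = J ** matpow C k"
proof (induction k)
  case (Suc k)
  have "matpow B (Suc k) ** J = (B ** J) ** matpow C k"
    using Suc by (simp add: matrix_mul_assoc[symmetric])
  then show ?case using assms by (simp add: matrix_mul_assoc)
qed simp

lemma complexify_matrix_mult:
  "map_matrix complex_of_real (B ** C) = map_matrix complex_of_real B ** map_matrix complex_of_real C"
  by (simp add: vec_eq_iff matrix_matrix_mult_def)

lemma matpow_complexify:
  "matpow (map_matrix complex_of_real B) k = map_matrix complex_of_real (matpow B k)"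
proof (induction k)
  case 0
  show ?case by (simp add: vec_eq_iff mat_def)
qed (simp add: complexify_matrix_mult)

lemma Ck_on_matpow:
  fixes f :: "'a::euclidean_space \<Rightarrow> real^'n^'n"
  shows "open S \<Longrightarrow> Ck_on k S f \<Longrightarrow> Ck_on k S (\<lambda>x. matpow (f x) j)"
  by (induction j) (auto intro: Ck_on_matrix_matrix_mult)

lemma matrix_scaleR_left_mult: "(r *\<^sub>R B) ** C = r *\<^sub>R (B ** (C :: real^'k^'n))" for B :: "real^'n^'m"
  by (rule bounded_bilinear.scaleR_left[OF bounded_bilinear_matrix_matrix_mult])

lemma matrix_scaleR_right_mult: "B ** (r *\<^sub>R C) = r *\<^sub>R (B ** (C :: real^'k^'n))" for B :: "real^'n^'m"
  by (rule bounded_bilinear.scaleR_right[OF bounded_bilinear_matrix_matrix_mult])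

definition real_l :: "nat \<Rightarrow> complex \<Rightarrow> complex \<Rightarrow> real^'n^'n \<Rightarrow> real^'n^'n" where
  "real_l K \<alpha> \<beta> B = - (Re \<alpha> *\<^sub>R matpow B K + Re \<beta> *\<^sub>R matpow B (K - 1))"

text \<open>The imaginary part \<open>W = Im \<alpha> B\<^sup>K + Im \<beta> B\<^sup>K\<^sup>-\<^sup>1\<close> of \<open>- l\<close> is killed by \<open>B\<close>, but
  \<open>l W = W\<close> and \<open>l\<close> is a multiple of \<open>B\<close>; so \<open>l\<close> is real.\<close>

lemma real_l:
  fixes B :: "real^'n^'n"
  assumes K: "3 \<le> K"
    and eq: "\<alpha> *\<^sub>M matpow (map_matrix complex_of_real B) (K + 1)
      + \<beta> *\<^sub>M matpow (map_matrix complex_of_real B) K + map_matrix complex_of_real B = 0"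
  defines "L \<equiv> real_l K \<alpha> \<beta> B"
  shows "B ** L = B" "L ** B = B" "L ** L = L" "\<exists>R. L = B ** R \<and> L = R ** B"
    "- (\<alpha> *\<^sub>M matpow (map_matrix complex_of_real B) K + \<beta> *\<^sub>M matpow (map_matrix complex_of_real B) (K - 1))
      = map_matrix complex_of_real L"
proof -
  \<comment> \<open>Writing K = k + 2 exposes a factor \<open>B\<close> in both powers occurring in
    \<open>L\<close>. This yields \<open>R\<close> with L = B R = R B, and the matrix
    \<open>V\<close> whose product with \<open>B\<close> is the imaginary part in question.\<close>
  obtain k where k: "K = Suc (Suc k)" using K that[of "K - 2"] by simp
  note mult = matrix_sub_ldistrib matrix_sub_rdistrib matrix_add_ldistrib matrix_add_rdistrib_real
    matrix_scaleR_left_mult matrix_scaleR_right_mult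
  define R where "R = - (Re \<alpha> *\<^sub>R matpow B (Suc k) + Re \<beta> *\<^sub>R matpow B k)"
  define V where "V = Im \<alpha> *\<^sub>R matpow B (Suc k) + Im \<beta> *\<^sub>R matpow B k"
  have neg: "B ** (- C) = - (B ** C)" "(- B) ** C = - (B ** C)" for B C :: "real^'n^'n"
    using matrix_sub_ldistrib[of B 0 C] matrix_sub_rdistrib[of 0 B C] by simp_all
  have comp: "\<alpha> * complex_of_real (matpow B (K + 1) $ i $ j) + \<beta> * complex_of_real (matpow B K $ i $ j)
      + complex_of_real (B $ i $ j) = 0" for i j
    using eq unfolding matpow_complexify by (simp add: matrix_scale_def vec_eq_iff)
  have re: "Re \<alpha> *\<^sub>R matpow B (K + 1) + Re \<beta> *\<^sub>R matpow B K + B = 0"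
    and im: "Im \<alpha> *\<^sub>R matpow B (K + 1) + Im \<beta> *\<^sub>R matpow B K = 0"
    using comp by (simp_all add: vec_eq_iff complex_eq_iff)
  have pow: "matpow B K = B ** matpow B (Suc k)" "matpow B (K - 1) = B ** matpow B k"
    "matpow B (K + 1) = B ** matpow B K" "B ** matpow B (K - 1) = matpow B K"
    by (simp_all add: k)
  have L1: "L = B ** R"
    unfolding L_def real_l_def pow R_def neg mult ..
  have "R ** B = B ** R"
    unfolding R_def neg mult matpow_commute ..
  then have L2: "L = R ** B" using L1 by simp
  have "B ** L = - (Re \<alpha> *\<^sub>R matpow B (K + 1) + Re \<beta> *\<^sub>R matpow B K)"
    unfolding L_def real_l_def neg mult pow(3) by (simp add: k)
  then show BL: "B ** L = B" using re by (metis add.inverse_inverse add_eq_0_iff)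
  have "L ** B = (B ** R) ** B" by (simp only: L1)
  also have "\<dots> = B ** L" unfolding matrix_mul_assoc[symmetric] L2 ..
  finally show LB: "L ** B = B" using BL by simp
  have "L ** L = (L ** B) ** R" unfolding matrix_mul_assoc[symmetric] using L1 by simp
  then show "L ** L = L" using LB L1 by simp
  show "\<exists>R. L = B ** R \<and> L = R ** B" using L1 L2 by blast
  have BV: "B ** V = Im \<alpha> *\<^sub>R matpow B K + Im \<beta> *\<^sub>R matpow B (K - 1)"
    unfolding pow(1,2) V_def mult ..
  have "B ** (B ** V) = 0" using im unfolding BV mult pow(3,4) .
  then have "L ** (B ** V) = 0"
    unfolding L2 matrix_mul_assoc[symmetric]
    by (simp add: bounded_bilinear.zero_right[OF bounded_bilinear_matrix_matrix_mult])
  then have "B ** V = 0" using LB by (simp add: matrix_mul_assoc)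
  then have im': "Im \<alpha> *\<^sub>R matpow B K + Im \<beta> *\<^sub>R matpow B (K - 1) = 0"
    by (simp only: BV)
  show "- (\<alpha> *\<^sub>M matpow (map_matrix complex_of_real B) K + \<beta> *\<^sub>M matpow (map_matrix complex_of_real B) (K - 1))
      = map_matrix complex_of_real L"
    using im' unfolding matpow_complexify L_def real_l_def
    by (simp add: matrix_scale_def vec_eq_iff complex_eq_iff neg_eq_iff_add_eq_0)
qed

section \<open>The integrability criterion\<close>

context smooth_manifold
begin

lemma integrable_distribution_cong:
  assumes "\<And>c p. c \<in> A \<Longrightarrow> p \<in> fst c \<Longrightarrow> D c p = D' c p"
  shows "integrable_distribution M A D \<longleftrightarrow> integrable_distribution M A D'"
  using assms unfolding integrable_distribution_def integral_manifold_def
  by (metis (no_types, lifting) Int_iff)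

lemma smooth_tensor_field_real_l:
  assumes F: "smooth_tensor_field A F"
  shows "smooth_tensor_field A (\<lambda>c p. real_l K \<alpha> \<beta> (F c p))"
  unfolding smooth_tensor_field_def
proof (intro conjI ballI)
  fix c assume c: "c \<in> A"
  have "Ck_on k (snd c ` fst c) (\<lambda>y. real_l K \<alpha> \<beta> (in_coords c (F c) y))" for k
    unfolding real_l_def
    using F c by (intro Ck_on_uminus Ck_on_add Ck_on_scaleR Ck_on_const Ck_on_matpow chart_open)
      (auto simp: smooth_tensor_field_def smooth_on_def)
  then show "smooth_on (snd c ` fst c) (in_coords c (\<lambda>p. real_l K \<alpha> \<beta> (F c p)))"
    by (simp add: smooth_on_def in_coords_def o_def)
next
  fix c c' p assume c: "c \<in> A" "c' \<in> A" "p \<in> fst c \<inter> fst c'"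
  let ?J = "transition_jacobian c c' p"
  have "matpow (F c' p) k ** ?J = ?J ** matpow (F c p) k" for k
    by (rule matpow_intertwine[OF smooth_tensor_field_transition[OF F]]) (use c in auto)
  moreover have "(- B) ** C = - (B ** C)" "C ** (- B) = - (C ** B)" for B C :: "real^'n^'n"
    using matrix_sub_ldistrib[of C 0 B] matrix_sub_rdistrib[of 0 B C] by simp_all
  ultimately show "real_l K \<alpha> \<beta> (F c' p) ** ?J = ?J ** real_l K \<alpha> \<beta> (F c p)"
    by (simp only: real_l_def matrix_add_ldistrib matrix_add_rdistrib_real
        matrix_scaleR_left_mult matrix_scaleR_right_mult)
qed

lemma smooth_tensor_field_complement:
  assumes L: "smooth_tensor_field A L"
  shows "smooth_tensor_field A (\<lambda>c p. mat 1 - L c p)"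
  unfolding smooth_tensor_field_def
proof (intro conjI ballI)
  fix c assume c: "c \<in> A"
  have "Ck_on k (snd c ` fst c) (\<lambda>y. mat 1 - in_coords c (L c) y)" for k
    using L c by (intro Ck_on_diff Ck_on_const chart_open) (auto simp: smooth_tensor_field_def smooth_on_def)
  then show "smooth_on (snd c ` fst c) (in_coords c (\<lambda>p. mat 1 - L c p))"
    by (simp add: smooth_on_def in_coords_def o_def)
next
  fix c c' p assume "c \<in> A" "c' \<in> A" "p \<in> fst c \<inter> fst c'"
  then show "(mat 1 - L c' p) ** transition_jacobian c c' p = transition_jacobian c c' p ** (mat 1 - L c p)"
    using smooth_tensor_field_transition[OF L, of c c' p] by (simp add: matrix_sub_ldistrib matrix_sub_rdistrib)
qed

end

section \<open>The criterion on an F-structure manifold\<close>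

context F_structure_manifold
begin

abbreviation L :: "('m, 'n) tfield" where
  "L \<equiv> \<lambda>c p. real_l K \<alpha> \<beta> (F c p)"

lemma L_properties:
  assumes "c \<in> A" "p \<in> fst c"
  shows "F c p ** L c p = F c p" "L c p ** F c p = F c p" "L c p ** L c p = L c p"
    "\<exists>R. L c p = F c p ** R \<and> L c p = R ** F c p"
    "l_tensor F K \<alpha> \<beta> c p = complexify_tensor L c p"
    "m_tensor F K \<alpha> \<beta> c p = complexify_tensor (\<lambda>c p. mat 1 - L c p) c p"
proof -
  note L = real_l[OF K_ge_3, of \<alpha> "F c p" \<beta>]
  have eq: "\<alpha> *\<^sub>M matpow (map_matrix complex_of_real (F c p)) (K + 1)
      + \<beta> *\<^sub>M matpow (map_matrix complex_of_real (F c p)) K + map_matrix complex_of_real (F c p) = 0"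
    using F_eq[OF assms] by (simp only: tensor_pow_def complexify_tensor_def)
  show "F c p ** L c p = F c p" "L c p ** F c p = F c p" "L c p ** L c p = L c p"
    "\<exists>R. L c p = F c p ** R \<and> L c p = R ** F c p"
    using L(1-4)[OF eq] .
  show l: "l_tensor F K \<alpha> \<beta> c p = complexify_tensor L c p"
    using L(5)[OF eq] by (simp only: l_tensor_def tensor_pow_def complexify_tensor_def)
  have "m_tensor F K \<alpha> \<beta> c p = mat 1 - l_tensor F K \<alpha> \<beta> c p"
    by (simp add: l_tensor_def m_tensor_def)
  also have "\<dots> = complexify_tensor (\<lambda>c p. mat 1 - L c p) c p"
    unfolding l by (simp add: complexify_tensor_def vec_eq_iff mat_def)
  finally show "m_tensor F K \<alpha> \<beta> c p = complexify_tensor (\<lambda>c p. mat 1 - L c p) c p" .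
qed

lemma L_smooth: "smooth_tensor_field A L" "smooth_tensor_field A (\<lambda>c p. mat 1 - L c p)"
  using smooth_tensor_field_real_l[OF F_smooth] smooth_tensor_field_complement by blast+

lemma tensor_has_derivative:
  assumes "smooth_tensor_field A Q" "c \<in> A" "p \<in> fst c"
  shows "(in_coords c (Q c) has_derivative frechet_derivative (in_coords c (Q c)) (at (snd c p))) (at (snd c p))"
  using assms by (intro smooth_on_has_derivative[of "snd c ` fst c"]) (auto simp: smooth_tensor_field_def)

abbreviation "D \<equiv> \<lambda>(Q :: ('m, 'n) tfield) c p. frechet_derivative (in_coords c (Q c)) (at (snd c p))"

lemma nijenhuis_form_identity_iff:
  assumes c: "c \<in> A" "p \<in> fst c"
  defines "N \<equiv> nijenhuis_form (F c p) (D F c p)" and "m \<equiv> mat 1 - L c p"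
  shows "(\<forall>a b. N a b = L c p *v N (L c p *v a) (L c p *v b)
      + N (L c p *v a) (m *v b) + N (m *v a) (L c p *v b)) \<longleftrightarrow>
    involutive_at (L c p) (D L c p) \<and> involutive_at m (D (\<lambda>c p. mat 1 - L c p) c p)"
proof -
  let ?G = "in_coords c (F c)" and ?GL = "in_coords c (L c)"
  have dF: "(?G has_derivative D F c p) (at (snd c p))" and dL: "(?GL has_derivative D L c p) (at (snd c p))"
    by (rule tensor_has_derivative[OF _ c], rule F_smooth L_smooth)+
  note op = chart_open[OF c(1)] and uniq = has_derivative_unique_on_open
  have mem: "snd c p \<in> snd c ` fst c" using c by simp
  have at: "?G (snd c p) = F c p" "?GL (snd c p) = L c p" using c by (simp_all add: in_coords_apply)
  have all: "?G y ** ?GL y = ?G y" "?GL y ** ?G y = ?G y" "?GL y ** ?GL y = ?GL y"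
    if "y \<in> snd c ` fst c" for y
    using that c(1) L_properties[OF c(1)] by (auto simp: in_coords_apply)
  have D: "(\<lambda>w. L c p ** D F c p w + D L c p w ** F c p) = D F c p"
    "(\<lambda>w. F c p ** D L c p w + D F c p w ** L c p) = D F c p"
    "(\<lambda>w. L c p ** D L c p w + D L c p w ** L c p) = D L c p"
    using uniq[OF has_derivative_matrix_matrix_mult[OF dL dF] dF op mem all(2)]
      uniq[OF has_derivative_matrix_matrix_mult[OF dF dL] dF op mem all(1)]
      uniq[OF has_derivative_matrix_matrix_mult[OF dL dL] dL op mem all(3)] by (simp_all only: at)
  \<comment> \<open>The two factorizations give the inclusions Im L in Im F and Ker F in Ker L,
    which are the hypotheses \<open>range\<close> and \<open>ker\<close> of the algebraic
    lemma.\<close>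
  obtain R where R: "L c p = F c p ** R" "L c p = R ** F c p" using L_properties(4)[OF c] by blast
  have "((\<lambda>y. mat 1 - ?GL y) has_derivative (\<lambda>w. 0 - D L c p w)) (at (snd c p))"
    by (intro has_derivative_diff has_derivative_const dL)
  then have "D (\<lambda>c p. mat 1 - L c p) c p = (\<lambda>w. - D L c p w)"
    by (simp add: in_coords_def o_def frechet_derivative_at[symmetric])
  moreover have "(\<forall>a b. N a b = L c p *v N (L c p *v a) (L c p *v b)
      + N (L c p *v a) (m *v b) + N (m *v a) (L c p *v b)) \<longleftrightarrow>
    involutive_at (L c p) (D L c p) \<and> involutive_at m (\<lambda>w. - D L c p w)"
    unfolding N_def m_def
  proof (rule nijenhuis_identity_iff_involutive)
    show "L c p *v z = 0" if "F c p *v z = 0" for z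
      using that R(2) by (metis matrix_vector_mul_assoc matrix_vector_mult_0_right)
    show "\<exists>u. w = F c p *v u" if "L c p *v w = w" for w
      using that R(1) by (metis matrix_vector_mul_assoc)
  qed (use dF dL has_derivative_linear L_properties[OF c] fun_cong[OF D(1)] fun_cong[OF D(2)] fun_cong[OF D(3)] in auto)
  ultimately show ?thesis by simp
qed

text \<open>One evaluation for all terms of the identity, with the identity, \<open>L\<close> or 1 -
  L in the place of \<open>P\<close> and \<open>Q\<close>. The agreement of \<open>S\<close> and
  \<open>T\<close> with real tensors is required on the whole chart domain, since the brackets
  differentiate the resulting fields.\<close>

lemma nijenhuis_complexify_vector_fields:
  assumes X: "smooth_vector_field A X" and Y: "smooth_vector_field A Y" and c: "c \<in> A" "p \<in> fst c"
    and P: "smooth_tensor_field A P" "\<And>q. q \<in> fst c \<Longrightarrow> S c q = complexify_tensor P c q"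
    and Q: "smooth_tensor_field A Q" "\<And>q. q \<in> fst c \<Longrightarrow> T c q = complexify_tensor Q c q"
  shows "nijenhuis (complexify_tensor F) (apply_tensor S (complexify_field X)) (apply_tensor T (complexify_field Y)) c p
    = cvec (nijenhuis_form (F c p) (D F c p) (P c p *v X c p) (Q c p *v Y c p))"
proof -
  have rep: "apply_tensor S (complexify_field X) c q = cvec ((in_coords c (P c) (snd c q)) *v in_coords c (X c) (snd c q))"
    if "q \<in> fst c" "\<And>q. q \<in> fst c \<Longrightarrow> S c q = complexify_tensor P c q"
    for q X and P :: "('m, 'n) tfield" and S
    using that c(1) by (simp add: apply_tensor_def complexify_field_def complexify_tensor_def
        complexify_matrix_mult_cvec in_coords_apply)
  have diff: "\<exists>f'. ((\<lambda>y. in_coords c (P c) y *v in_coords c (X c) y) has_derivative f') (at (snd c p))"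
    if P: "smooth_tensor_field A P" and X: "smooth_vector_field A X" for P X
  proof -
    have "(in_coords c (X c) has_derivative frechet_derivative (in_coords c (X c)) (at (snd c p))) (at (snd c p))"
      using X c by (intro smooth_on_has_derivative[of "snd c ` fst c"]) (auto simp: smooth_vector_field_def)
    from bounded_bilinear.FDERIV[OF bounded_bilinear_matrix_vector_mult tensor_has_derivative[OF P c] this]
    show ?thesis by blast
  qed
  obtain a' where a': "((\<lambda>y. in_coords c (P c) y *v in_coords c (X c) y) has_derivative a') (at (snd c p))"
    using diff[OF P(1) X] by blast
  obtain b' where b': "((\<lambda>y. in_coords c (Q c) y *v in_coords c (Y c) y) has_derivative b') (at (snd c p))"
    using diff[OF Q(1) Y] by blast
  let ?a = "\<lambda>y. in_coords c (P c) y *v in_coords c (X c) y"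
    and ?b = "\<lambda>y. in_coords c (Q c) y *v in_coords c (Y c) y"
  have SX: "apply_tensor S (complexify_field X) c q = cvec (?a (snd c q))"
    and TY: "apply_tensor T (complexify_field Y) c q = cvec (?b (snd c q))" if "q \<in> fst c" for q
    using rep[where S = S and P = P and X = X, OF that P(2)] rep[where S = T and P = Q and X = Y, OF that Q(2)]
    by blast+
  have "nijenhuis (complexify_tensor F) (apply_tensor S (complexify_field X)) (apply_tensor T (complexify_field Y)) c p
      = cvec (nijenhuis_form (F c p) (D F c p) (?a (snd c p)) (?b (snd c p)))"
    by (rule nijenhuis_complexify[where c = c and p = p and F = F and a = ?a and b = ?b
          and X = "apply_tensor S (complexify_field X)" and Y = "apply_tensor T (complexify_field Y)",
          OF c tensor_has_derivative[OF F_smooth c] _ a' _ b']) (fact SX TY)+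
  then show ?thesis using c by (simp add: in_coords_apply)
qed

lemma smooth_tensor_field_id: "smooth_tensor_field A (\<lambda>c p. mat 1)"
  by (auto simp: smooth_tensor_field_def smooth_on_def in_coords_def o_def)

lemma nijenhuis_identity_at_iff:
  assumes X: "smooth_vector_field A X" and Y: "smooth_vector_field A Y" and c: "c \<in> A" "p \<in> fst c"
  defines "N \<equiv> nijenhuis (complexify_tensor F)" and "n \<equiv> nijenhuis_form (F c p) (D F c p)"
    and "l \<equiv> l_tensor F K \<alpha> \<beta>" and "m \<equiv> m_tensor F K \<alpha> \<beta>" and "m' \<equiv> mat 1 - L c p"
    and "X' \<equiv> complexify_field X" and "Y' \<equiv> complexify_field Y"
  shows "N X' Y' c p = apply_tensor l (N (apply_tensor l X') (apply_tensor l Y')) c p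
      + N (apply_tensor l X') (apply_tensor m Y') c p + N (apply_tensor m X') (apply_tensor l Y') c p \<longleftrightarrow>
    n (X c p) (Y c p) = L c p *v n (L c p *v X c p) (L c p *v Y c p)
      + n (L c p *v X c p) (m' *v Y c p) + n (m' *v X c p) (L c p *v Y c p)"
proof -
  note lc = L_properties(5)[OF c(1)] and mc = L_properties(6)[OF c(1)]
  let ?L = "\<lambda>c p. L c p" and ?M = "\<lambda>c p. mat 1 - L c p" and ?I = "\<lambda>c p. mat 1"
  note nij = nijenhuis_complexify_vector_fields[OF X Y c, folded N_def X'_def Y'_def n_def]
  have id: "apply_tensor (complexify_tensor (\<lambda>c p. mat 1)) Z = Z" for Z :: "('m, 'n) cvfield"
  proof -
    have "map_matrix complex_of_real (mat 1 :: real^'n^'n) = mat 1" by (simp add: vec_eq_iff mat_def)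
    then show ?thesis by (simp add: fun_eq_iff apply_tensor_def complexify_tensor_def)
  qed
  \<comment> \<open>The undecorated N_F(X,Y) is the instance where both tensors are the identity
    field.\<close>
  have 0: "N X' Y' c p = cvec (n (X c p) (Y c p))"
    using nij[where S = "complexify_tensor ?I" and P = ?I and T = "complexify_tensor ?I" and Q = ?I,
        OF smooth_tensor_field_id refl smooth_tensor_field_id refl] by (simp add: id)
  have 1: "N (apply_tensor l X') (apply_tensor l Y') c p = cvec (n (L c p *v X c p) (L c p *v Y c p))"
    unfolding l_def by (rule nij[where S = "l_tensor F K \<alpha> \<beta>" and P = ?L and T = "l_tensor F K \<alpha> \<beta>" and Q = ?L, OF L_smooth(1) lc L_smooth(1) lc])
  have 2: "N (apply_tensor l X') (apply_tensor m Y') c p = cvec (n (L c p *v X c p) (m' *v Y c p))"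
    unfolding l_def m_def m'_def by (rule nij[where S = "l_tensor F K \<alpha> \<beta>" and P = ?L and T = "m_tensor F K \<alpha> \<beta>" and Q = ?M, OF L_smooth(1) lc L_smooth(2) mc])
  have 3: "N (apply_tensor m X') (apply_tensor l Y') c p = cvec (n (m' *v X c p) (L c p *v Y c p))"
    unfolding l_def m_def m'_def by (rule nij[where S = "m_tensor F K \<alpha> \<beta>" and P = ?M and T = "l_tensor F K \<alpha> \<beta>" and Q = ?L, OF L_smooth(2) mc L_smooth(1) lc])
  have 4: "apply_tensor l (N (apply_tensor l X') (apply_tensor l Y')) c p
    = cvec (L c p *v n (L c p *v X c p) (L c p *v Y c p))"
    unfolding apply_tensor_def[of l] 1 unfolding l_def lc[OF c(2)] complexify_tensor_def
    by (rule complexify_matrix_mult_cvec)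
  show ?thesis unfolding 0 2 3 4 cvec_add[symmetric] cvec_eq_iff ..
qed

theorem integrable_l_m_iff:
  defines "l \<equiv> l_tensor F K \<alpha> \<beta>" and "m \<equiv> m_tensor F K \<alpha> \<beta>" and "N \<equiv> nijenhuis (complexify_tensor F)"
  shows "integrable_distribution M A (image_distribution l) \<and> integrable_distribution M A (image_distribution m) \<longleftrightarrow>
    (\<forall>X Y. smooth_vector_field A X \<and> smooth_vector_field A Y \<longrightarrow>
      (\<forall>c\<in>A. \<forall>p\<in>fst c. N (complexify_field X) (complexify_field Y) c p
        = apply_tensor l (N (apply_tensor l (complexify_field X)) (apply_tensor l (complexify_field Y))) c p
          + N (apply_tensor l (complexify_field X)) (apply_tensor m (complexify_field Y)) c p
          + N (apply_tensor m (complexify_field X)) (apply_tensor l (complexify_field Y)) c p))"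
    (is "?int \<longleftrightarrow> (\<forall>X Y. _ \<longrightarrow> (\<forall>c\<in>A. \<forall>p\<in>fst c. ?id X Y c p))")
proof -
  let ?M = "\<lambda>c p. mat 1 - L c p"
  let ?form = "\<lambda>c p a b. nijenhuis_form (F c p) (D F c p) a b
    = L c p *v nijenhuis_form (F c p) (D F c p) (L c p *v a) (L c p *v b)
      + nijenhuis_form (F c p) (D F c p) (L c p *v a) (?M c p *v b)
      + nijenhuis_form (F c p) (D F c p) (?M c p *v a) (L c p *v b)"
  have MM: "?M c p ** ?M c p = ?M c p" if "c \<in> A" "p \<in> fst c" for c p
    using L_properties(3)[OF that] by (simp add: matrix_sub_ldistrib matrix_sub_rdistrib)
  have "integrable_distribution M A (image_distribution l) \<longleftrightarrow>
      integrable_distribution M A (image_distribution (complexify_tensor L))"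
    by (rule integrable_distribution_cong) (simp add: image_distribution_def l_def L_properties(5))
  moreover have "integrable_distribution M A (image_distribution m) \<longleftrightarrow>
      integrable_distribution M A (image_distribution (complexify_tensor ?M))"
    by (rule integrable_distribution_cong) (simp add: image_distribution_def m_def L_properties(6))
  ultimately have "?int \<longleftrightarrow>
      (\<forall>c\<in>A. \<forall>p\<in>fst c. involutive_at (L c p) (D L c p) \<and> involutive_at (?M c p) (D ?M c p))"
    using integrable_iff_involutive[OF L_smooth(1) L_properties(3)]
      integrable_iff_involutive[OF L_smooth(2) MM] by blast
  also have "\<dots> \<longleftrightarrow> (\<forall>c\<in>A. \<forall>p\<in>fst c. \<forall>a b. ?form c p a b)"
    using nijenhuis_form_identity_iff by blast
  also have "\<dots> \<longleftrightarrow> (\<forall>X Y. smooth_vector_field A X \<and> smooth_vector_field A Y \<longrightarrow>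
      (\<forall>c\<in>A. \<forall>p\<in>fst c. ?id X Y c p))"
  proof (intro iffI allI impI ballI)
    fix X Y c p
    assume "\<forall>c\<in>A. \<forall>p\<in>fst c. \<forall>a b. ?form c p a b"
      and XY: "smooth_vector_field A X \<and> smooth_vector_field A Y" and c: "c \<in> A" "p \<in> fst c"
    then have "?form c p (X c p) (Y c p)" by blast
    then show "?id X Y c p"
      unfolding N_def l_def m_def
      using nijenhuis_identity_at_iff[of X Y c p] XY c by blast
  next
    fix c p a b
    assume all: "\<forall>X Y. smooth_vector_field A X \<and> smooth_vector_field A Y \<longrightarrow> (\<forall>c\<in>A. \<forall>p\<in>fst c. ?id X Y c p)"
      and c: "c \<in> A" "p \<in> fst c"
    \<comment> \<open>The assumption concerns global fields, so the two tangent vectors at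
      \<open>p\<close> are first extended to such fields; by tensoriality the choice of extension
      leaves the values at \<open>p\<close> unaffected.\<close>
    obtain X where X: "smooth_vector_field A X" "X c p = a" by (rule global_vector_field_through[OF c])
    obtain Y where Y: "smooth_vector_field A Y" "Y c p = b" by (rule global_vector_field_through[OF c])
    have "?id X Y c p" using all X(1) Y(1) c by blast
    then show "?form c p a b"
      unfolding N_def l_def m_def
      using nijenhuis_identity_at_iff[OF X(1) Y(1) c] X(2) Y(2) by blast
  qed
  finally show ?thesis .
qed

end

theorem theorem5p10:
  fixes M :: "'m topology" and A :: "('m, 'n::finite) chart set"
    and F :: "('m, 'n) tfield" and K r :: nat and \<alpha> \<beta> :: complex
  assumes "F_structure_manifold M A F K r \<alpha> \<beta>"
  shows
    "(let l = l_tensor F K \<alpha> \<beta>; m = m_tensor F K \<alpha> \<beta>;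
          N = nijenhuis (complexify_tensor F)
      in integrable_distribution M A (image_distribution l) \<and>
         integrable_distribution M A (image_distribution m) \<longleftrightarrow>
         (\<forall>X Y. smooth_vector_field A X \<and> smooth_vector_field A Y \<longrightarrow>
            (let X' = complexify_field X; Y' = complexify_field Y in
             \<forall>c\<in>A. \<forall>p\<in>fst c.
               N X' Y' c p =
                 apply_tensor l (N (apply_tensor l X') (apply_tensor l Y')) c p
                 + N (apply_tensor l X') (apply_tensor m Y') c p
                 + N (apply_tensor m X') (apply_tensor l Y') c p)))"
  unfolding Let_def by (rule F_structure_manifold.integrable_l_m_iff[OF assms])

end
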